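(* For $s\ge0$, $k,l\in\{1,\dots,d\}$ and $n\ge1$ let $$X(s,k,l,n)=p_k(n)\Big[\sum_{1\le i,j\le n}a(i,j;n,k,l,s)\,e(i,j;n)\Big]p_l(n)$$ be a random matrix. Assume that $\{\mathrm{Re}\, a(i,j;n,k,l,s)\}\cup\{\mathrm{Im}\, a(i,j;n,k,l,s)\}$ (over all $1\le i,j\le n$, $k,l\in\{1,\dots,d\}$, $s\in\mathbb N$) are independent centered Gaussian random variables with variance $(2n)^{-1}$. Let $(B(j,n))_{j\in\mathbb N}$ be a family of elements of $\mathfrak M_n$, stable under multiplication and adjunction, which contains $p_1(n),\dots,p_d(n)$, such that for every $j$ the sequence $(\|E(B(j,n))\|)_n$ is bounded, and which converges in $\mathcal D$-distribution as $n\to\infty$. Then the family $(\{B(j,n):j\in\mathbb N\},(\{X(s,k,l,n)\})_{s,k,l})$ is asymptotically free with amalgamation over $\mathcal D$ as $n\to\infty$.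
   Context: $(\mathcal A,\varphi)$ is a tracial $*$-noncommutative probability space with self-adjoint nonzero pairwise orthogonal projections $p_1,\dots,p_d$ with sum $1$; $\rho_i=\varphi(p_i)\ne0$; $\mathcal D=\mathrm{Span}\{p_1,\dots,p_d\}$; $E(x)=\sum_i\rho_i^{-1}\varphi(p_ixp_i)p_i$ is the conditional expectation $\mathcal A\to\mathcal D$. For $n\ge1$, $q_1(n),\dots,q_d(n)$ are positive integers with sum $n$ and $q_i(n)/n\to\rho_i$. $\mathfrak M_n$ is the algebra of (constant) complex $n\times n$ matrices, $e(i,j;n)$ its matrix units, $\mathrm{tr}$ the normalized trace. $\mathcal D$ is identified with a $*$-subalgebra of $\mathfrak M_n$ by $\sum\lambda_ip_i\mapsto\mathrm{diag}(\lambda_1I_{q_1(n)},\dots,\lambda_dI_{q_d(n)})$; $p_k(n)$ is the image of $p_k$. Random $n\times n$ matrices (with entries having all moments) form an algebra $M_n$ with state $\mathbb E\,\mathrm{tr}$, and $E:M_n\to\mathcal D$ is $E(X)=\sum_k\frac{\mathbb E\,\mathrm{Tr}(p_k(n)Xp_k(n))}{q_k(n)}p_k$. $\|\cdot\|$ on $\mathcal D$ is the operator norm. The $\mathcal D$-distribution of a family $(a_i)$ is the map sending each word $X_{i_0}^{\epsilon_0}d_0\cdots X_{i_m}^{\epsilon_m}d_m$ ($d_j\in\mathcal D$, $\epsilon_j\in\{1,*\}$) to $E(a_{i_0}^{\epsilon_0}d_0\cdots a_{i_m}^{\epsilon_m}d_m)$; convergence in $\mathcal D$-distribution is pointwise convergence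 of $\mathcal D$-distributions to that of a family in $\mathcal A$ (possibly after enlarging $(\mathcal A,\varphi)$). $*$-subalgebras $(\mathcal A_i)_{i\in I}$ containing $\mathcal D$ are free with amalgamation over $\mathcal D$ if $E(x(1)\cdots x(m))=0$ whenever $i_1\neq\cdots\neq i_m$ (consecutive indices distinct) and $x(j)\in\mathcal A_{i_j}\cap\ker E$; subsets are free with amalgamation over $\mathcal D$ if they are contained in such $*$-subalgebras. A family of sets of matrices is asymptotically free with amalgamation over $\mathcal D$ if the whole collection of matrices converges jointly in $\mathcal D$-distribution and the corresponding sets of limit elements are free with amalgamation over $\mathcal D$. *)

theory Defs
  imports
    "HOL-Probability.Probability"
    "Jordan_Normal_Form.Schur_Decomposition"
begin

hide_const (open) Finite_Cartesian_Product.mat Determinants.trace Determinants.det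
hide_type (open) Finite_Cartesian_Product.vec

section \<open>Tracial *-probability spaces over the diagonal algebra\<close>

text \<open>A complex *-algebra is a (not necessarily commutative) ring that is also a module over
  the field of complex numbers (the library locale for algebras is restricted to commutative
  ones).\<close>

record 'a star_prob_space = "(complex, 'a) module" +
  involution :: "'a \<Rightarrow> 'a"
  state :: "'a \<Rightarrow> complex"

locale tracial_star_prob_space = ring A + module class_ring A
  for A :: "('a, 'm) star_prob_space_scheme" (structure) +
  assumes smult_mult_left:
      "\<lbrakk>x \<in> carrier A; y \<in> carrier A\<rbrakk> \<Longrightarrow> (c \<odot> x) \<otimes> y = c \<odot> (x \<otimes> y)"
    and smult_mult_right:
      "\<lbrakk>x \<in> carrier A; y \<in> carrier A\<rbrakk> \<Longrightarrow> x \<otimes> (c \<odot> y) = c \<odot> (x \<otimes> y)"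
    and involution_closed: "x \<in> carrier A \<Longrightarrow> involution A x \<in> carrier A"
    and involution_involution: "x \<in> carrier A \<Longrightarrow> involution A (involution A x) = x"
    and involution_add:
      "\<lbrakk>x \<in> carrier A; y \<in> carrier A\<rbrakk>
        \<Longrightarrow> involution A (x \<oplus> y) = involution A x \<oplus> involution A y"
    and involution_smult: "x \<in> carrier A \<Longrightarrow> involution A (c \<odot> x) = cnj c \<odot> involution A x"
    and involution_mult:
      "\<lbrakk>x \<in> carrier A; y \<in> carrier A\<rbrakk>
        \<Longrightarrow> involution A (x \<otimes> y) = involution A y \<otimes> involution A x"
    and state_add: "\<lbrakk>x \<in> carrier A; y \<in> carrier A\<rbrakk> \<Longrightarrow> state A (x \<oplus> y) = state A x + state A y"
    and state_smult: "x \<in> carrier A \<Longrightarrow> state A (c \<odot> x) = c * state A x"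
    and state_one: "state A \<one> = 1"
    and state_positive: "x \<in> carrier A \<Longrightarrow> state A (involution A x \<otimes> x) \<in> \<real>\<^sub>\<ge>\<^sub>0"
    and state_trace: "\<lbrakk>x \<in> carrier A; y \<in> carrier A\<rbrakk> \<Longrightarrow> state A (x \<otimes> y) = state A (y \<otimes> x)"

text \<open>The projections are indexed by \<open>k < d\<close>.\<close>

locale diag_prob_space = tracial_star_prob_space A
  for A :: "('a, 'm) star_prob_space_scheme" (structure) and d :: nat and p :: "nat \<Rightarrow> 'a" +
  assumes proj_closed: "k < d \<Longrightarrow> p k \<in> carrier A"
    and proj_selfadjoint: "k < d \<Longrightarrow> involution A (p k) = p k"
    and proj_idem: "k < d \<Longrightarrow> p k \<otimes> p k = p k"
    and proj_nonzero: "k < d \<Longrightarrow> p k \<noteq> \<zero>"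
    and proj_orthogonal: "\<lbrakk>k < d; l < d; k \<noteq> l\<rbrakk> \<Longrightarrow> p k \<otimes> p l = \<zero>"
    and proj_sum: "(\<Oplus>k\<in>{..<d}. p k) = \<one>"
    and proj_state: "k < d \<Longrightarrow> state A (p k) \<noteq> 0"

text \<open>An element of \<open>\<D>\<close>, the span of the projections, is given by its coordinates in the basis
  of the projections: a function \<open>nat \<Rightarrow> complex\<close> of which only the values at \<open>k < d\<close> matter.\<close>

definition diag_elem ::
    "('a, 'm) star_prob_space_scheme \<Rightarrow> nat \<Rightarrow> (nat \<Rightarrow> 'a) \<Rightarrow> (nat \<Rightarrow> complex) \<Rightarrow> 'a" where
  "diag_elem A d p c = (\<Oplus>\<^bsub>A\<^esub>k\<in>{..<d}. c k \<odot>\<^bsub>A\<^esub> p k)"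

definition diag_algebra :: "('a, 'm) star_prob_space_scheme \<Rightarrow> nat \<Rightarrow> (nat \<Rightarrow> 'a) \<Rightarrow> 'a set" where
  "diag_algebra A d p = range (diag_elem A d p)"

definition cond_exp_coord ::
    "('a, 'm) star_prob_space_scheme \<Rightarrow> (nat \<Rightarrow> 'a) \<Rightarrow> 'a \<Rightarrow> nat \<Rightarrow> complex" where
  "cond_exp_coord A p x k = state A (p k \<otimes>\<^bsub>A\<^esub> x \<otimes>\<^bsub>A\<^esub> p k) / state A (p k)"

definition cond_exp_diag ::
    "('a, 'm) star_prob_space_scheme \<Rightarrow> nat \<Rightarrow> (nat \<Rightarrow> 'a) \<Rightarrow> 'a \<Rightarrow> 'a" where
  "cond_exp_diag A d p x = diag_elem A d p (cond_exp_coord A p x)"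

text \<open>The projections of the larger space are the images \<open>\<iota> (p k)\<close>.\<close>

definition enlargement ::
    "('a, 'm) star_prob_space_scheme \<Rightarrow> ('b, 'n) star_prob_space_scheme \<Rightarrow> ('a \<Rightarrow> 'b) \<Rightarrow> bool" where
  "enlargement A A' \<iota> \<longleftrightarrow>
     tracial_star_prob_space A' \<and>
     \<iota> \<in> Ring.ring_hom A A' \<and> inj_on \<iota> (carrier A) \<and>
     (\<forall>c. \<forall>x\<in>carrier A. \<iota> (c \<odot>\<^bsub>A\<^esub> x) = c \<odot>\<^bsub>A'\<^esub> \<iota> x) \<and>
     (\<forall>x\<in>carrier A. \<iota> (involution A x) = involution A' (\<iota> x)) \<and>
     (\<forall>x\<in>carrier A. state A' (\<iota> x) = state A x)"

section \<open>Freeness with amalgamation\<close>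

definition star_subalgebra :: "('a, 'm) star_prob_space_scheme \<Rightarrow> 'a set \<Rightarrow> bool" where
  "star_subalgebra A S \<longleftrightarrow>
     S \<subseteq> carrier A \<and> \<one>\<^bsub>A\<^esub> \<in> S \<and>
     (\<forall>x\<in>S. \<forall>y\<in>S. x \<oplus>\<^bsub>A\<^esub> y \<in> S \<and> x \<otimes>\<^bsub>A\<^esub> y \<in> S) \<and>
     (\<forall>c. \<forall>x\<in>S. c \<odot>\<^bsub>A\<^esub> x \<in> S) \<and>
     (\<forall>x\<in>S. involution A x \<in> S)"

text \<open>An alternating product \<open>x(1) \<cdots> x(m)\<close> with \<open>x(j) \<in> \<A> (i\<^sub>j)\<close> is encoded by the nonempty list
  of the pairs \<open>(i\<^sub>j, x(j))\<close>.\<close>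

definition free_amalg_algebras ::
    "('a, 'm) star_prob_space_scheme \<Rightarrow> nat \<Rightarrow> (nat \<Rightarrow> 'a) \<Rightarrow> 'i set \<Rightarrow> ('i \<Rightarrow> 'a set) \<Rightarrow> bool" where
  "free_amalg_algebras A d p I \<A> \<longleftrightarrow>
     (\<forall>i\<in>I. star_subalgebra A (\<A> i) \<and> diag_algebra A d p \<subseteq> \<A> i) \<and>
     (\<forall>w. w \<noteq> [] \<and> distinct_adj (map fst w) \<and>
          (\<forall>(i, x) \<in> set w. i \<in> I \<and> x \<in> \<A> i \<and> cond_exp_diag A d p x = \<zero>\<^bsub>A\<^esub>)
        \<longrightarrow> cond_exp_diag A d p (foldr (\<lambda>x y. x \<otimes>\<^bsub>A\<^esub> y) (map snd w) \<one>\<^bsub>A\<^esub>) = \<zero>\<^bsub>A\<^esub>)"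

definition free_amalg ::
    "('a, 'm) star_prob_space_scheme \<Rightarrow> nat \<Rightarrow> (nat \<Rightarrow> 'a) \<Rightarrow> 'i set \<Rightarrow> ('i \<Rightarrow> 'a set) \<Rightarrow> bool" where
  "free_amalg A d p I S \<longleftrightarrow>
     (\<exists>\<A>. free_amalg_algebras A d p I \<A> \<and> (\<forall>i\<in>I. S i \<subseteq> \<A> i))"

section \<open>Random matrices\<close>

text \<open>Rows and columns are indexed by \<open>0, \<dots>, n - 1\<close>; the \<open>k\<close>-th block has size \<open>q k n\<close>.
  Positive block sizes with sum \<open>n\<close> exist only for \<open>n \<ge> d\<close>; smaller \<open>n\<close> carry no hypotheses.\<close>

definition block :: "(nat \<Rightarrow> nat \<Rightarrow> nat) \<Rightarrow> nat \<Rightarrow> nat \<Rightarrow> nat set" where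
  "block q n k = {(\<Sum>l<k. q l n)..<(\<Sum>l\<le>k. q l n)}"

definition diag_blocks ::
    "nat \<Rightarrow> (nat \<Rightarrow> nat \<Rightarrow> nat) \<Rightarrow> nat \<Rightarrow> (nat \<Rightarrow> complex) \<Rightarrow> complex mat" where
  "diag_blocks d q n c = mat_diag n (\<lambda>i. \<Sum>k<d. if i \<in> block q n k then c k else 0)"

definition proj_mat :: "nat \<Rightarrow> (nat \<Rightarrow> nat \<Rightarrow> nat) \<Rightarrow> nat \<Rightarrow> nat \<Rightarrow> complex mat" where
  "proj_mat d q n k = diag_blocks d q n (\<lambda>l. if l = k then 1 else 0)"

definition mat_trace :: "complex mat \<Rightarrow> complex" where
  "mat_trace X = (\<Sum>i<dim_row X. X $$ (i, i))"

definition l2_norm_vec :: "complex vec \<Rightarrow> real" where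
  "l2_norm_vec v = sqrt (\<Sum>i<dim_vec v. (cmod (v $ i))\<^sup>2)"

definition mat_op_norm :: "complex mat \<Rightarrow> real" where
  "mat_op_norm X =
     (SUP v \<in> {v \<in> carrier_vec (dim_col X). l2_norm_vec v \<le> 1}. l2_norm_vec (X *\<^sub>v v))"

definition mat_cond_exp ::
    "'w measure \<Rightarrow> nat \<Rightarrow> (nat \<Rightarrow> nat \<Rightarrow> nat) \<Rightarrow> nat \<Rightarrow> ('w \<Rightarrow> complex mat) \<Rightarrow> nat \<Rightarrow> complex" where
  "mat_cond_exp M d q n X k =
     (LINT \<omega>|M. mat_trace (proj_mat d q n k * X \<omega> * proj_mat d q n k)) / of_nat (q k n)"

definition gaussian_entries ::
    "'w measure \<Rightarrow> nat \<Rightarrow> nat \<Rightarrow> (nat \<Rightarrow> nat \<Rightarrow> nat \<Rightarrow> nat \<Rightarrow> nat \<Rightarrow> nat \<Rightarrow> 'w \<Rightarrow> complex) \<Rightarrow> bool" where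
  "gaussian_entries M d n a \<longleftrightarrow>
     (let I = {(part, i, j, k, l, s). part \<in> {Re, Im} \<and> i < n \<and> j < n \<and> k < d \<and> l < d};
          G = (\<lambda>(part, i, j, k, l, s) \<omega>. part (a i j n k l s \<omega>))
      in prob_space.indep_vars M (\<lambda>_. borel) G I \<and>
         (\<forall>t\<in>I. distributed M lborel (G t) (normal_density 0 (sqrt (1 / (2 * real n))))))"

definition block_gaussian_mat ::
    "nat \<Rightarrow> (nat \<Rightarrow> nat \<Rightarrow> nat) \<Rightarrow> (nat \<Rightarrow> nat \<Rightarrow> nat \<Rightarrow> nat \<Rightarrow> nat \<Rightarrow> nat \<Rightarrow> 'w \<Rightarrow> complex) \<Rightarrow>
     nat \<Rightarrow> nat \<Rightarrow> nat \<Rightarrow> nat \<Rightarrow> 'w \<Rightarrow> complex mat" where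
  "block_gaussian_mat d q a s k l n \<omega> =
     proj_mat d q n k * mat n n (\<lambda>(i, j). a i j n k l s \<omega>) * proj_mat d q n l"

section \<open>Convergence in distribution over the diagonal algebra\<close>

text \<open>The word \<open>X\<^bsub>i\<^sub>0\<^esub>\<^sup>\<epsilon> d\<^sub>0 \<cdots>\<close> is encoded by the list of its triples (index, is the letter starred,
  coordinates of the element of \<open>\<D>\<close> following it).\<close>

type_synonym 'i diag_word = "('i \<times> bool \<times> (nat \<Rightarrow> complex)) list"

definition word_alg ::
    "('a, 'm) star_prob_space_scheme \<Rightarrow> nat \<Rightarrow> (nat \<Rightarrow> 'a) \<Rightarrow> ('i \<Rightarrow> 'a) \<Rightarrow> 'i diag_word \<Rightarrow> 'a" where
  "word_alg A d p x w =
     foldr (\<lambda>(i, st, c) y.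
       (if st then involution A (x i) else x i) \<otimes>\<^bsub>A\<^esub> diag_elem A d p c \<otimes>\<^bsub>A\<^esub> y) w \<one>\<^bsub>A\<^esub>"

definition word_mat ::
    "nat \<Rightarrow> (nat \<Rightarrow> nat \<Rightarrow> nat) \<Rightarrow> nat \<Rightarrow> ('i \<Rightarrow> complex mat) \<Rightarrow> 'i diag_word \<Rightarrow> complex mat" where
  "word_mat d q n X w =
     foldr (\<lambda>(i, st, c) Y.
       (if st then mat_adjoint (X i) else X i) * diag_blocks d q n c * Y) w (1\<^sub>m n)"

definition converges_in_diag_distribution ::
    "'w measure \<Rightarrow> nat \<Rightarrow> (nat \<Rightarrow> nat \<Rightarrow> nat) \<Rightarrow> 'i set \<Rightarrow> ('i \<Rightarrow> nat \<Rightarrow> 'w \<Rightarrow> complex mat) \<Rightarrow>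
     ('a, 'm) star_prob_space_scheme \<Rightarrow> (nat \<Rightarrow> 'a) \<Rightarrow> ('i \<Rightarrow> 'a) \<Rightarrow> bool" where
  "converges_in_diag_distribution M d q I X A p x \<longleftrightarrow>
     x \<in> I \<rightarrow> carrier A \<and>
     (\<forall>w. w \<noteq> [] \<and> fst ` set w \<subseteq> I \<longrightarrow>
        (\<forall>k<d. (\<lambda>n. mat_cond_exp M d q n (\<lambda>\<omega>. word_mat d q n (\<lambda>i. X i n \<omega>) w) k)
           \<longlonglongrightarrow> cond_exp_coord A p (word_alg A d p x w) k))"

text \<open>The sets of matrices, indexed by \<open>b \<in> K\<close>, are \<open>{X i n | i \<in> S b}\<close>.  The type over which
  the enlargement is sought is no restriction: within any enlargement containing the limits, the
  *-subalgebra they generate together with the image of \<open>A\<close> is a quotient of the free algebra on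
  the elements of \<open>A\<close>, the limits and their adjoints, hence is isomorphic to an algebra of
  classes of complex-valued functions on words.\<close>

definition asymptotically_free_amalg ::
    "'w measure \<Rightarrow> nat \<Rightarrow> (nat \<Rightarrow> nat \<Rightarrow> nat) \<Rightarrow> ('a, 'm) star_prob_space_scheme \<Rightarrow> (nat \<Rightarrow> 'a) \<Rightarrow>
     'b set \<Rightarrow> ('b \<Rightarrow> 'i set) \<Rightarrow> ('i \<Rightarrow> nat \<Rightarrow> 'w \<Rightarrow> complex mat) \<Rightarrow> bool" where
  "asymptotically_free_amalg M d q A p K S X \<longleftrightarrow>
     (\<exists>(A' :: (('a + 'i \<times> bool) list \<Rightarrow> complex) set star_prob_space) \<iota> x.
        enlargement A A' \<iota> \<and>
        converges_in_diag_distribution M d q (\<Union>b\<in>K. S b) X A' (\<iota> \<circ> p) x \<and>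
        free_amalg A' d (\<iota> \<circ> p) K (\<lambda>b. x ` S b))"

text \<open>Indices of the constant matrices \<open>B(j,n)\<close> and of the Gaussian matrices \<open>X(s,k,l,n)\<close>.\<close>

datatype mat_index = B_index nat | X_index nat nat nat

datatype set_index = B_set | X_set nat nat nat

fun mat_family ::
    "(nat \<Rightarrow> nat \<Rightarrow> complex mat) \<Rightarrow> (nat \<Rightarrow> nat \<Rightarrow> nat \<Rightarrow> nat \<Rightarrow> 'w \<Rightarrow> complex mat) \<Rightarrow>
     mat_index \<Rightarrow> nat \<Rightarrow> 'w \<Rightarrow> complex mat" where
  "mat_family B X (B_index j) n \<omega> = B j n"
| "mat_family B X (X_index s k l) n \<omega> = X s k l n \<omega>"

fun mats_in_set :: "set_index \<Rightarrow> mat_index set" where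
  "mats_in_set B_set = range B_index"
| "mats_in_set (X_set s k l) = {X_index s k l}"

definition set_indices :: "nat \<Rightarrow> set_index set" where
  "set_indices d = insert B_set {X_set s k l | s k l. k < d \<and> l < d}"

end

theory Submission
  imports Defs "HOL-Library.Poly_Mapping"
begin

text \<open>Let \<open>C\<close> be the given enlargement that contains the limits \<open>b\<^sub>j\<close> of the constant
  matrices. Adjoin to it circular elements \<open>c(s,k,l)\<close>, free from \<open>C\<close> and from each other over the
  complex numbers, and take \<open>p\<^sub>k c(s,k,l) p\<^sub>l\<close> as the limit of \<open>X(s,k,l,n)\<close>. The state on words in
  \<open>C\<close> and the circular elements is the vacuum expectation on a Fock space whose vectors are stacks
  \<open>c\<^sub>0 t\<^sub>1 c\<^sub>1 \<cdots> t\<^sub>m c\<^sub>m\<close> of constants separated by generators. It is positive because the inner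
  product of stacks is a product of positive kernels; it is a trace because letters acting from the
  left commute with letters acting from the right; and it satisfies the recursion
  \<open>\<tau>(t w) = \<Sum> \<tau>(u) \<tau>(v)\<close> over the factorisations \<open>w = u t\<^sup>* v\<close>.

  The expectations of products of normalized traces of words in the random matrices satisfy the same
  recursion up to terms of order \<open>n\<^sup>-\<^sup>2\<close>, by Gaussian integration by parts; induction on the number of
  Gaussian letters gives the convergence.

  Freeness over \<open>\<D>\<close> is read off the Fock space: a centered element of one of the algebras maps each
  stack whose top has another type to a combination of stacks whose top has its own type, and no such
  stack has a component along the vacuum. Finally, the limit space is the quotient of the free algebra on
  the elements of \<open>A\<close> and the limits by the ideal of the elements that are null for the state and
  vanish in \<open>C\<close> when the circular elements are set to zero; the second condition keeps \<open>A\<close> embedded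
  although its state need not be faithful.\<close>

section \<open>The Fock functional\<close>

text \<open>The state of \<open>C\<close> need not be faithful, and constants are formal symbols, so
  that a sum of constants is not a sum of stacks. Hence no vector space of stacks is formed: a
  linear relation is a list of coefficients and stacks on which the functionals in question vanish.

  Each generator \<open>g\<close> owns two markers. The letter \<open>Gen g s\<close> creates the
  marker \<open>(g, s)\<close> and annihilates \<open>(g, \<not> s)\<close>; this is the realisation
  of a circular element as the sum of one creation operator and the adjoint of another, free one. A
  contraction across a constant \<open>c\<close> has the scalar weight \<open>state A c\<close>:
  freeness of the generators is over the complex numbers, and the diagonal algebra enters only
  through the corners and the choice of subalgebras. The weight matches the second absolute moment
  1/n of a matrix entry, the sum of two variances 1/(2n).

  For finite n the expectation of a product of traces does not factor, so the recursion for a single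
  trace already involves products. This is why the induction runs over lists of words.\<close>

datatype ('c, 'g) letter = Const 'c | Gen 'g bool

type_synonym ('c, 'g) stack = "'c \<times> (('g \<times> bool) \<times> 'c) list"

text \<open>One pair arises for each occurrence of the letter in the word. These pairs index the
  right-hand sides of both recursions, for the Fock functional and for the Gaussian traces.\<close>

fun splits :: "'g \<Rightarrow> bool \<Rightarrow> ('c, 'g) letter list \<Rightarrow> (('c, 'g) letter list \<times> ('c, 'g) letter list) list" where
  "splits g s [] = []"
| "splits g s (l # w) =
     (if l = Gen g s then [([], w)] else []) @ map (\<lambda>(u, v). (l # u, v)) (splits g s w)"

lemma splits_append:
  assumes "(u, v) \<in> set (splits g s w)"
  shows "w = u @ Gen g s # v"
  using assms
proof (induction w arbitrary: u)
  case (Cons l w)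
  have "(u = [] \<and> v = w \<and> l = Gen g s) \<or> (\<exists>u'. u = l # u' \<and> (u', v) \<in> set (splits g s w))"
    using Cons.prems by (cases "l = Gen g s") (simp_all add: image_iff Bex_def case_prod_unfold, blast+)
  then show ?case using Cons.IH by (elim disjE exE conjE) simp_all
qed simp

context tracial_star_prob_space
begin

text \<open>A letter sees only the top of a stack. Creation buries the old top constant under the
  new marker and puts \<one> on top; annihilation consumes the top constant through its state and
  exposes the next one.\<close>

fun left_act :: "('a, 'g) letter \<Rightarrow> ('a, 'g) stack \<Rightarrow> (complex \<times> ('a, 'g) stack) list" where
  "left_act (Const b) (c, xs) = [(1, (b \<otimes> c, xs))]"
| "left_act (Gen g s) (c, []) = [(1, (\<one>, [((g, s), c)]))]"
| "left_act (Gen g s) (c, ((h, t), e) # xs) =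
     (1, (\<one>, ((g, s), c) # ((h, t), e) # xs)) #
     (if h = g \<and> t \<noteq> s then [(state A c, (e, xs))] else [])"

text \<open>The mirror image of \<open>left_act\<close> at the bottom of the stack. It lies in the
  commutant of the left action and serves to prove the trace property.\<close>

definition right_act :: "('a, 'g) letter \<Rightarrow> ('a, 'g) stack \<Rightarrow> (complex \<times> ('a, 'g) stack) list" where
  "right_act l = (\<lambda>(c, xs). case l of
     Const b \<Rightarrow> [(1, if xs = [] then (c \<otimes> b, [])
                  else (c, butlast xs @ [(fst (last xs), snd (last xs) \<otimes> b)]))]
   | Gen g s \<Rightarrow> (1, (c, xs @ [((g, s), \<one>)])) #
       (if xs \<noteq> [] \<and> fst (fst (last xs)) = g \<and> snd (fst (last xs)) \<noteq> s
        then [(state A (snd (last xs)), (c, butlast xs))] else []))"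

text \<open>Letters act on functionals on stacks instead of vectors, so that stacks need no linear structure.\<close>

definition left_op ::
    "('a, 'g) letter \<Rightarrow> (('a, 'g) stack \<Rightarrow> complex) \<Rightarrow> ('a, 'g) stack \<Rightarrow> complex" where
  "left_op l h S = (\<Sum>(a, T)\<leftarrow>left_act l S. a * h T)"

definition right_op ::
    "('a, 'g) letter \<Rightarrow> (('a, 'g) stack \<Rightarrow> complex) \<Rightarrow> ('a, 'g) stack \<Rightarrow> complex" where
  "right_op l h S = (\<Sum>(a, T)\<leftarrow>right_act l S. a * h T)"

fun vac :: "('a, 'g) stack \<Rightarrow> complex" where
  "vac (c, []) = state A c"
| "vac (c, x # xs) = 0"

text \<open>Since \<open>left_op\<close> is the transpose of the action on stacks,
  \<open>fold\<close> makes the last letter of the word meet the vacuum stack before all others, as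
  in an operator product.\<close>

definition fock :: "('a, 'g) letter list \<Rightarrow> complex" where
  "fock w = fold left_op w vac (\<one>, [])"

definition wf_stack :: "('a, 'g) stack \<Rightarrow> bool" where
  "wf_stack S \<longleftrightarrow> fst S \<in> carrier A \<and> (\<forall>x\<in>set (snd S). snd x \<in> carrier A)"

fun wf_letter :: "('a, 'g) letter \<Rightarrow> bool" where
  "wf_letter (Const b) \<longleftrightarrow> b \<in> carrier A"
| "wf_letter (Gen g s) \<longleftrightarrow> True"

section \<open>Commuting left and right actions, and the trace property\<close>

lemma ring_A: "ring A"
  by unfold_locales

lemmas times_assoc = monoid.m_assoc[OF ring.is_monoid[OF ring_A]]

lemma left_op_Const: "left_op (Const b) h T = h (b \<otimes> fst T, snd T)"
  by (cases T) (simp add: left_op_def)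

lemma wf_stack_simps [simp]:
  "wf_stack (c, []) \<longleftrightarrow> c \<in> carrier A"
  "wf_stack (c, (t, e) # xs) \<longleftrightarrow> c \<in> carrier A \<and> wf_stack (e, xs)"
  by (auto simp: wf_stack_def)

lemma wf_stack_one: "wf_stack (\<one>, [])"
  by simp

lemma left_act_wf:
  assumes "wf_letter l" "wf_stack S" "(a, T) \<in> set (left_act l S)"
  shows "wf_stack T"
  using assms by (cases "(l, S)" rule: left_act.cases) (auto simp: wf_stack_def split: if_splits)

lemma left_op_cong:
  assumes "wf_letter l" "wf_stack S" "\<And>T. wf_stack T \<Longrightarrow> h T = h' T"
  shows "left_op l h S = left_op l h' S"
  unfolding left_op_def using left_act_wf[OF assms(1,2)] assms(3)
  by (intro arg_cong[where f = sum_list] map_cong) auto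

lemma fold_left_op_cong:
  assumes "list_all wf_letter w" "wf_stack S" "\<And>T. wf_stack T \<Longrightarrow> h T = h' T"
  shows "fold left_op w h S = fold left_op w h' S"
  using assms
proof (induction w arbitrary: h h' S)
  case (Cons l w)
  show ?case using Cons.prems left_op_cong[of l _ h h'] by (auto intro!: Cons.IH)
qed simp

text \<open>The two actions touch opposite ends, so they can interfere only on stacks with at most
  one marker; this dictates the three cases. On a stack without markers either order may contract
  the freshly created marker with the other letter, in both cases with the weight
  \<open>state A c\<close>.\<close>

lemma left_right_commute:
  assumes "wf_letter l" "wf_letter r" "wf_stack S"
  shows "left_op l (right_op r h) S = right_op r (left_op l h) S"
proof -
  obtain c xs where S: "S = (c, xs)" by (cases S)
  consider "xs = []" | x where "xs = [x]" | x ys y where "xs = x # ys @ [y]"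
    by (metis append_butlast_last_id neq_Nil_conv)
  then show ?thesis
  proof cases
    case 1
    then show ?thesis using assms unfolding S
      by (cases l; cases r) (auto simp: left_op_def right_op_def right_act_def times_assoc)
  next
    case (2 x)
    obtain g s e where "x = ((g, s), e)" by (metis surj_pair)
    then have xs: "xs = [((g, s), e)]" using 2 by simp
    have wf: "c \<in> carrier A" "e \<in> carrier A" using assms(3) by (simp_all add: S xs)
    show ?thesis
    proof (cases l)
      case (Const b)
      then show ?thesis unfolding S xs
        by (cases r) (simp_all add: left_op_def right_op_def right_act_def)
    next
      case Gl: (Gen g' s')
      show ?thesis
      proof (cases r)
        case (Const b)
        then show ?thesis unfolding S xs Gl using wf
          by (simp add: left_op_def right_op_def right_act_def)
      next
        case (Gen g'' s'')
        show ?thesis unfolding S xs Gl Gen using wf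
          by (cases "g = g' \<and> s \<noteq> s'"; cases "g = g'' \<and> s \<noteq> s''")
            (simp_all add: left_op_def right_op_def right_act_def del: de_Morgan_conj)
      qed
    qed
  next
    case (3 x ys y)
    obtain g s e where x: "x = ((g, s), e)" by (metis surj_pair)
    obtain g' s' e' where y: "y = ((g', s'), e')" by (metis surj_pair)
    show ?thesis using assms 3 unfolding S x y
      by (cases l; cases r) (auto simp: left_op_def right_op_def right_act_def algebra_simps butlast_append)
  qed
qed

text \<open>For a constant this is the trace property of the state. For a generator both sides
  vanish unless the stack has exactly one marker, of the opposite kind, and then both equal the
  product of the states of its two constants.\<close>

lemma left_right_vac:
  assumes "wf_letter l" "wf_stack S"
  shows "left_op l vac S = right_op l vac S"
proof -
  obtain c xs where S: "S = (c, xs)" by (cases S)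
  consider "xs = []" | x where "xs = [x]" | x z zs where "xs = x # z # zs"
    by (metis neq_Nil_conv)
  then show ?thesis
  proof cases
    case 1
    then show ?thesis using assms unfolding S
      by (cases l) (auto simp: left_op_def right_op_def right_act_def state_trace)
  next
    case (2 x)
    obtain g s e where "x = ((g, s), e)" by (metis surj_pair)
    then show ?thesis using assms 2 unfolding S
      by (cases l) (auto simp: left_op_def right_op_def right_act_def)
  next
    case (3 x z zs)
    obtain g s e where x: "x = ((g, s), e)" by (metis surj_pair)
    have "vac (c, x # ys @ y) = 0" for c ys y and x :: "('b \<times> bool) \<times> 'a" by simp
    then show ?thesis using assms 3 unfolding S x
      by (cases l) (auto simp: left_op_def right_op_def right_act_def)
  qed
qed

lemma fold_left_right_commute:
  assumes "list_all wf_letter w" "wf_letter r" "wf_stack S"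
  shows "fold left_op w (right_op r h) S = right_op r (fold left_op w h) S"
  using assms
proof (induction w arbitrary: h)
  case (Cons l w)
  have "fold left_op w (left_op l (right_op r h)) S = fold left_op w (right_op r (left_op l h)) S"
    using Cons.prems left_right_commute by (intro fold_left_op_cong) auto
  then show ?case using Cons by simp
qed simp

text \<open>At the vacuum functional the letter is exchanged for its right action, which passes
  through all of \<open>w\<close>; at the vacuum stack it is exchanged back. This is the usual
  argument that a vector on which left and right actions agree is a trace vector.\<close>

lemma fock_rotate1:
  assumes "list_all wf_letter w" "wf_letter l"
  shows "fock (l # w) = fock (w @ [l])"
proof -
  have "fold left_op w (left_op l vac) (\<one>, []) = fold left_op w (right_op l vac) (\<one>, [])"
    using assms left_right_vac by (intro fold_left_op_cong) auto
  also have "\<dots> = right_op l (fold left_op w vac) (\<one>, [])"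
    using assms by (intro fold_left_right_commute) auto
  also have "\<dots> = left_op l (fold left_op w vac) (\<one>, [])"
    using assms by (cases l) (auto simp: left_op_def right_op_def right_act_def)
  finally show ?thesis by (simp add: fock_def)
qed

lemma fock_commute:
  assumes "list_all wf_letter u" "list_all wf_letter v"
  shows "fock (u @ v) = fock (v @ u)"
  using assms
proof (induction u arbitrary: v)
  case (Cons l u)
  then show ?case using fock_rotate1[of "u @ v" l] Cons.IH[of "v @ [l]"] by simp
qed simp

lemma fock_Nil [simp]: "fock [] = 1"
  by (simp add: fock_def state_one)

text \<open>The functional \<open>f \<otimes> h\<close>, evaluated on all ways to cut a stack at a marker \<open>m\<close>. The vacuum
  functional followed by a generator has this form, whence the recursion for the state.\<close>

fun stack_splits :: "'g \<times> bool \<Rightarrow> ('a, 'g) stack \<Rightarrow> (('a, 'g) stack \<times> ('a, 'g) stack) list" where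
  "stack_splits m (c, []) = []"
| "stack_splits m (c, (t, e) # xs) =
     (if t = m then [((c, []), (e, xs))] else []) @
     map (\<lambda>((c', ys), T). ((c, (t, c') # ys), T)) (stack_splits m (e, xs))"

definition split_tensor ::
    "'g \<times> bool \<Rightarrow> (('a, 'g) stack \<Rightarrow> complex) \<Rightarrow> (('a, 'g) stack \<Rightarrow> complex) \<Rightarrow>
     ('a, 'g) stack \<Rightarrow> complex" where
  "split_tensor m f h S = (\<Sum>(T, U)\<leftarrow>stack_splits m S. f T * h U)"

section \<open>The recursion for the Fock functional\<close>

lemma left_op_Gen:
  "left_op (Gen g s) h (c, []) = h (\<one>, [((g, s), c)])"
  "left_op (Gen g s) h (c, (t, e) # xs) =
     h (\<one>, ((g, s), c) # (t, e) # xs) + (if t = (g, \<not> s) then state A c else 0) * h (e, xs)"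
  by (cases t; simp add: left_op_def)+

lemma split_tensor_simps:
  "split_tensor m f h (c, []) = 0"
  "split_tensor m f h (c, (t, e) # xs) =
     (if t = m then f (c, []) * h (e, xs) else 0) +
     split_tensor m (\<lambda>(c', ys). f (c, (t, c') # ys)) h (e, xs)"
  by (auto simp: split_tensor_def comp_def case_prod_unfold)

lemma split_tensor_linear:
  "split_tensor m (\<lambda>(c, xs). F c xs + a * G c xs) h S =
     split_tensor m (\<lambda>(c, xs). F c xs) h S + a * split_tensor m (\<lambda>(c, xs). G c xs) h S"
  unfolding split_tensor_def case_prod_unfold sum_list_const_mult[symmetric] sum_list_addf[symmetric]
  by (simp add: algebra_simps)

lemma left_op_linear:
  "left_op l (\<lambda>T. F T + a * G T) = (\<lambda>T. left_op l F T + a * left_op l G T)"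
  unfolding left_op_def case_prod_unfold sum_list_const_mult[symmetric] sum_list_addf[symmetric]
  by (simp add: algebra_simps)

lemma fold_left_op_linear:
  "fold left_op w (\<lambda>T. F T + a * G T) S = fold left_op w F S + a * fold left_op w G S"
proof (induction w arbitrary: F G)
  case (Cons l w)
  then show ?case unfolding fold.simps o_apply left_op_linear by blast
qed simp

text \<open>A letter changes only the top of a stack, hence acts on the upper factor of every cut.
  The one additional cut is at a marker \<open>m\<close> that the letter itself has just pushed;
  above it there is only the vacuum, below it the whole of \<open>S\<close>.\<close>

lemma left_op_split_tensor:
  "left_op l (split_tensor m f h) S =
    split_tensor m (left_op l f) h S + (if l = Gen (fst m) (snd m) then f (\<one>, []) * h S else 0)"
proof -
  obtain c xs where S: "S = (c, xs)" by (cases S)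
  show ?thesis
  proof (cases l)
    case (Const b)
    have "stack_splits m (b \<otimes> c, xs) = map (\<lambda>((c', ys), T). ((b \<otimes> c', ys), T)) (stack_splits m (c, xs))"
    proof (cases xs)
      case (Cons x ys)
      then show ?thesis by (cases x) (auto simp: comp_def case_prod_unfold)
    qed simp
    then show ?thesis
      by (simp add: Const S split_tensor_def left_op_Const comp_def case_prod_unfold)
  next
    case (Gen g s)
    show ?thesis
    proof (cases xs)
      case Nil
      then show ?thesis by (auto simp: Gen S split_tensor_simps left_op_Gen)
    next
      case (Cons x ys)
      obtain t e where x: "x = (t, e)" by (metis surj_pair)
      have 1: "split_tensor m (\<lambda>(c', ys). left_op l f (c, (t, c') # ys)) h (e, ys) =
          split_tensor m (\<lambda>(c', ys). f (\<one>, ((g, s), c) # (t, c') # ys)) h (e, ys) +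
          (if t = (g, \<not> s) then state A c else 0) * split_tensor m (\<lambda>(c', ys). f (c', ys)) h (e, ys)"
        unfolding Gen left_op_Gen by (rule split_tensor_linear)
      show ?thesis unfolding S Cons x split_tensor_simps 1
        unfolding Gen left_op_Gen split_tensor_simps by (auto simp: algebra_simps)
    qed
  qed
qed

text \<open>The cuts are sorted by the letter of \<open>w\<close> that pushed the marker at which
  the stack is cut. The letters to the right of it have acted on \<open>S\<close> and built the
  lower part; those to the left act above the marker as on a vacuum.\<close>

lemma fold_split_tensor:
  "fold left_op w (split_tensor (g, s) f h) S =
    split_tensor (g, s) (fold left_op w f) h S +
    (\<Sum>(u, v)\<leftarrow>splits g s w. fold left_op u f (\<one>, []) * fold left_op v h S)"
  apply (induction w arbitrary: f)
  subgoal by (simp only: fold.simps id_apply splits.simps list.map sum_list.Nil add_0_right)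
  subgoal premises IH for l w f
  proof -
    have "left_op l (split_tensor (g, s) f h) =
      (\<lambda>T. split_tensor (g, s) (left_op l f) h T + (if l = Gen g s then f (\<one>, []) else 0) * h T)"
      by (rule ext) (simp add: left_op_split_tensor)
    then have "fold left_op (l # w) (split_tensor (g, s) f h) S =
        fold left_op w (split_tensor (g, s) (left_op l f) h) S +
        (if l = Gen g s then f (\<one>, []) else 0) * fold left_op w h S"
      using fold_left_op_linear[of w "split_tensor (g, s) (left_op l f) h"
        "if l = Gen g s then f (\<one>, []) else 0" h S] by (simp only: fold.simps o_apply)
    moreover have "(\<Sum>(u, v)\<leftarrow>splits g s (l # w). fold left_op u f (\<one>, []) * fold left_op v h S) =
        (if l = Gen g s then f (\<one>, []) else 0) * fold left_op w h S +
        (\<Sum>(u, v)\<leftarrow>splits g s w. fold left_op u (left_op l f) (\<one>, []) * fold left_op v h S)"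
      by (simp add: comp_def case_prod_unfold)
    ultimately show ?thesis using IH[of "left_op l f"] by simp
  qed
  done

text \<open>Only stacks with the single marker \<open>(g, \<not> s)\<close> survive on either side:
  the vacuum functional in both tensor factors rules out further markers.\<close>

lemma left_op_Gen_vac: "left_op (Gen g s) vac = split_tensor (g, \<not> s) vac vac"
proof (rule ext)
  fix S :: "('a, 'b) stack"
  obtain c xs where S: "S = (c, xs)" by (cases S)
  show "left_op (Gen g s) vac S = split_tensor (g, \<not> s) vac vac S"
  proof (cases xs)
    case Nil
    then show ?thesis by (simp add: S left_op_Gen split_tensor_simps)
  next
    case (Cons x ys)
    obtain t e where x: "x = (t, e)" by (metis surj_pair)
    have "split_tensor (g, \<not> s) (\<lambda>(c', ys). vac (c, (t, c') # ys)) vac (e, ys) = 0"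
      by (simp add: split_tensor_def case_prod_unfold)
    then show ?thesis by (simp add: S Cons x left_op_Gen split_tensor_simps)
  qed
qed

text \<open>The free Schwinger-Dyson equation. The leading letter is paired with an adjoint letter,
  and a stack can contract only in a noncrossing way, so the letters in between decouple from the
  remaining ones.\<close>

lemma fock_Gen:
  "fock (Gen g s # w) = (\<Sum>(u, v)\<leftarrow>splits g (\<not> s) w. fock u * fock v)"
proof -
  have "fock (Gen g s # w) = fold left_op w (split_tensor (g, \<not> s) vac vac) (\<one>, [])"
    unfolding fock_def by (simp add: left_op_Gen_vac)
  also have "\<dots> = (\<Sum>(u, v)\<leftarrow>splits g (\<not> s) w. fock u * fock v)"
    unfolding fold_split_tensor split_tensor_simps fock_def by simp
  finally show ?thesis .
qed

lemma fold_left_op_Const: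
  "fold left_op (map Const bs) h (c, xs) = h (foldr (\<otimes>) bs c, xs)"
  by (induction bs arbitrary: h) (simp_all add: left_op_Const)

lemma fock_Const: "fock (map Const bs) = state A (foldr (\<otimes>) bs \<one>)"
  by (simp add: fock_def fold_left_op_Const)

lemma fock_merge:
  assumes "list_all wf_letter u" "list_all wf_letter v" "b \<in> carrier A" "c \<in> carrier A"
  shows "fock (u @ Const b # Const c # v) = fock (u @ Const (b \<otimes> c) # v)"
  unfolding fock_def fold_append o_def fold.simps using assms
  by (intro fold_left_op_cong) (auto simp: left_op_Const wf_stack_def times_assoc)

lemma fock_one:
  assumes "list_all wf_letter u" "list_all wf_letter v"
  shows "fock (u @ Const \<one> # v) = fock (u @ v)"
  unfolding fock_def fold_append o_def fold.simps using assms
  by (intro fold_left_op_cong) (auto simp: left_op_Const wf_stack_def)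

section \<open>Adjoints, the inner product of stacks and elementary laws\<close>

fun star_letter :: "('a, 'g) letter \<Rightarrow> ('a, 'g) letter" where
  "star_letter (Const b) = Const (involution A b)"
| "star_letter (Gen g s) = Gen g (\<not> s)"

definition star_word :: "('a, 'g) letter list \<Rightarrow> ('a, 'g) letter list" where
  "star_word w = rev (map star_letter w)"

fun ker_list :: "(('g \<times> bool) \<times> 'a) list \<Rightarrow> (('g \<times> bool) \<times> 'a) list \<Rightarrow> complex" where
  "ker_list [] [] = 1"
| "ker_list ((t, b) # xs) ((u, c) # ys) =
     (if t = u then state A (involution A b \<otimes> c) * ker_list xs ys else 0)"
| "ker_list _ _ = 0"

fun stack_ker :: "('a, 'g) stack \<Rightarrow> ('a, 'g) stack \<Rightarrow> complex" where
  "stack_ker (b, xs) (c, ys) = state A (involution A b \<otimes> c) * ker_list xs ys"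

lemma state_zero: "state A \<zero> = 0"
proof -
  have "state A (0 \<odot> \<one>) = 0 * state A \<one>" by (rule state_smult) simp
  moreover have "0 \<odot> \<one> = \<zero>"
    using smult_l_null[of \<one>] by (simp add: class_ring_simps)
  ultimately show ?thesis by simp
qed

lemma involution_one: "involution A \<one> = \<one>"
proof -
  have "involution A \<one> = involution A \<one> \<otimes> involution A (involution A \<one>)"
    by (simp add: involution_involution involution_closed)
  also have "\<dots> = involution A (involution A \<one> \<otimes> \<one>)"
    by (rule involution_mult[symmetric]) (simp_all add: involution_closed)
  also have "\<dots> = \<one>"
    by (simp add: involution_involution involution_closed)
  finally show ?thesis .
qed

lemma times_add_left: "\<lbrakk>x \<in> carrier A; y \<in> carrier A; z \<in> carrier A\<rbrakk> \<Longrightarrow> (x \<oplus> y) \<otimes> z = x \<otimes> z \<oplus> y \<otimes> z"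
  by (rule ring.ring_simprules[OF ring_A])

lemma times_add_right: "\<lbrakk>x \<in> carrier A; y \<in> carrier A; z \<in> carrier A\<rbrakk> \<Longrightarrow> z \<otimes> (x \<oplus> y) = z \<otimes> x \<oplus> z \<otimes> y"
  by (rule ring.ring_simprules[OF ring_A])

lemma times_closed: "\<lbrakk>x \<in> carrier A; y \<in> carrier A\<rbrakk> \<Longrightarrow> x \<otimes> y \<in> carrier A"
  by (rule monoid.m_closed[OF ring.is_monoid[OF ring_A]])

lemma plus_closed: "\<lbrakk>x \<in> carrier A; y \<in> carrier A\<rbrakk> \<Longrightarrow> x \<oplus> y \<in> carrier A"
  by (rule abelian_monoid.a_closed[OF abelian_group.axioms(1)[OF ring.is_abelian_group[OF ring_A]]])

lemma scale_closed: "x \<in> carrier A \<Longrightarrow> a \<odot> x \<in> carrier A"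
  by (rule smult_closed) simp_all

lemma unit_closed: "\<one> \<in> carrier A"
  by (rule monoid.one_closed[OF ring.is_monoid[OF ring_A]])

lemma zero_in: "\<zero> \<in> carrier A"
  by (rule abelian_monoid.zero_closed[OF abelian_group.axioms(1)[OF ring.is_abelian_group[OF ring_A]]])

lemma times_one: "x \<in> carrier A \<Longrightarrow> \<one> \<otimes> x = x" "x \<in> carrier A \<Longrightarrow> x \<otimes> \<one> = x"
  by (rule monoid.l_one[OF ring.is_monoid[OF ring_A]] monoid.r_one[OF ring.is_monoid[OF ring_A]], assumption)+

lemmas alg_closed = times_closed plus_closed scale_closed unit_closed zero_in involution_closed

lemma scale_zero: "a \<odot> \<zero> = \<zero>" "x \<in> carrier A \<Longrightarrow> 0 \<odot> x = \<zero>"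
proof -
  show *: "0 \<odot> x = \<zero>" if "x \<in> carrier A" for x
    using smult_l_null[of x] that by (simp add: class_ring_simps)
  have "a \<odot> (0 \<odot> \<one>) = (a * 0) \<odot> \<one>"
    using smult_assoc1[of a 0 \<one>] unit_closed by (simp add: class_ring_simps)
  then show "a \<odot> \<zero> = \<zero>" using *[OF unit_closed] by simp
qed

lemma plus_zero: "x \<in> carrier A \<Longrightarrow> \<zero> \<oplus> x = x" "x \<in> carrier A \<Longrightarrow> x \<oplus> \<zero> = x"
  by (rule ring.ring_simprules[OF ring_A], assumption)+

text \<open>Compatibility of the state with the involution is not an axiom; it follows by
  polarisation from positivity, which makes the state of \<open>y^* y\<close> real for each
  \<open>y = c \<odot> \<one> \<oplus> x\<close>.\<close>

lemma state_involution:
  assumes x: "x \<in> carrier A"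
  shows "state A (involution A x) = cnj (state A x)"
proof -
  have *: "cnj c * c + cnj c * state A x + c * state A (involution A x) +
      state A (involution A x \<otimes> x) \<in> \<real>" for c
  proof -
    have "involution A (c \<odot> \<one> \<oplus> x) \<otimes> (c \<odot> \<one> \<oplus> x) =
      (cnj c \<odot> \<one> \<oplus> involution A x) \<otimes> (c \<odot> \<one>) \<oplus> (cnj c \<odot> \<one> \<oplus> involution A x) \<otimes> x"
      using x by (simp add: times_add_right alg_closed involution_add involution_smult involution_one)
    also have "\<dots> = (cnj c \<odot> (c \<odot> \<one>) \<oplus> c \<odot> involution A x) \<oplus> (cnj c \<odot> x \<oplus> involution A x \<otimes> x)"
      using x by (simp add: times_add_left alg_closed smult_mult_left smult_mult_right times_one smult_r_distr
          smult_assoc1[symmetric] mult.commute[of c])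
    finally have "state A (involution A (c \<odot> \<one> \<oplus> x) \<otimes> (c \<odot> \<one> \<oplus> x)) =
      cnj c * c + cnj c * state A x + c * state A (involution A x) + state A (involution A x \<otimes> x)"
      using x by (simp add: alg_closed state_add state_smult state_one)
    moreover have "state A (involution A (c \<odot> \<one> \<oplus> x) \<otimes> (c \<odot> \<one> \<oplus> x)) \<in> \<real>"
      using state_positive[of "c \<odot> \<one> \<oplus> x"] x by (auto simp: alg_closed nonneg_Reals_def)
    ultimately show ?thesis by simp
  qed
  \<comment> \<open>The value c = 0 disposes of the quadratic term in \<open>x\<close>; c = 1 then
    compares the imaginary parts and c = \<i> the real parts.\<close>
  have "Im (state A (involution A x \<otimes> x)) = 0" using *[of 0] by (simp add: complex_is_Real_iff)
  then show ?thesis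
    using *[of 1] *[of \<i>] by (simp add: complex_eq_iff complex_is_Real_iff)
qed

end

section \<open>Positivity\<close>

text \<open>Positive semidefiniteness is encoded by an explicit decomposition into rank-one kernels,
  because in this form stability under pointwise products is a computation.\<close>

definition gram :: "'i set \<Rightarrow> ('i \<Rightarrow> 'i \<Rightarrow> complex) \<Rightarrow> bool" where
  "gram I K \<longleftrightarrow> (\<exists>vs. \<forall>i\<in>I. \<forall>j\<in>I. K i j = (\<Sum>v\<leftarrow>vs. cnj (v i) * v j))"

lemma gramI: "(\<And>i j. i \<in> I \<Longrightarrow> j \<in> I \<Longrightarrow> K i j = (\<Sum>v\<leftarrow>vs. cnj (v i) * v j)) \<Longrightarrow> gram I K"
  by (auto simp: gram_def)

lemma gram_cong: "(\<And>i j. i \<in> I \<Longrightarrow> j \<in> I \<Longrightarrow> K i j = L i j) \<Longrightarrow> gram I K \<longleftrightarrow> gram I L"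
  by (auto simp: gram_def)

lemma gram_add:
  assumes "gram I K" "gram I L"
  shows "gram I (\<lambda>i j. K i j + L i j)"
proof -
  obtain vs ws where "\<forall>i\<in>I. \<forall>j\<in>I. K i j = (\<Sum>v\<leftarrow>vs. cnj (v i) * v j)"
    "\<forall>i\<in>I. \<forall>j\<in>I. L i j = (\<Sum>v\<leftarrow>ws. cnj (v i) * v j)"
    using assms by (auto simp: gram_def)
  then show ?thesis by (intro gramI[where vs = "vs @ ws"]) auto
qed

text \<open>The Schur product theorem: the pointwise products of the vectors of the two lists
  represent the product kernel.\<close>

lemma gram_mult:
  assumes "gram I K" "gram I L"
  shows "gram I (\<lambda>i j. K i j * L i j)"
proof -
  obtain vs ws where *: "\<forall>i\<in>I. \<forall>j\<in>I. K i j = (\<Sum>v\<leftarrow>vs. cnj (v i) * v j)"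
    "\<forall>i\<in>I. \<forall>j\<in>I. L i j = (\<Sum>v\<leftarrow>ws. cnj (v i) * v j)"
    using assms by (auto simp: gram_def)
  have "(\<Sum>v\<leftarrow>vs. cnj (v i) * v j) * (\<Sum>v\<leftarrow>ws. cnj (v i) * v j) =
     (\<Sum>v\<leftarrow>concat (map (\<lambda>v. map (\<lambda>w i. v i * w i) ws) vs). cnj (v i) * v j)" for i j
  proof (induction vs)
    case (Cons v vs)
    have "(\<Sum>w\<leftarrow>map (\<lambda>w i. v i * w i) ws. cnj (w i) * w j) = cnj (v i) * v j * (\<Sum>v\<leftarrow>ws. cnj (v i) * v j)"
      by (simp add: comp_def sum_list_const_mult[symmetric] mult_ac)
    then show ?case using Cons by (simp add: distrib_right)
  qed simp
  then show ?thesis using *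
    by (intro gramI[where vs = "concat (map (\<lambda>v. map (\<lambda>w i. v i * w i) ws) vs)"]) auto
qed

text \<open>One indicator vector for each value of \<open>f\<close>. The kernel is used with
  \<open>f\<close> the top marker, where it makes stacks with different markers orthogonal.\<close>

lemma gram_eq:
  assumes "finite I"
  shows "gram I (\<lambda>i j. if f i = f j then 1 else 0)"
proof -
  obtain ys where ys: "set ys = f ` I" "distinct ys"
    using finite_distinct_list[of "f ` I"] assms by auto
  show ?thesis
  proof (rule gramI[where vs = "map (\<lambda>y i. if f i = y then 1 else 0) ys"])
    fix i j assume "i \<in> I" "j \<in> I"
    have "(\<Sum>v\<leftarrow>map (\<lambda>y i. if f i = y then 1 else 0) ys. cnj (v i) * v j) =
        (\<Sum>y\<in>f ` I. if f i = y then (if f i = f j then 1 else 0) else 0 :: complex)"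
      unfolding ys(1)[symmetric] sum_list_distinct_conv_sum_set[OF ys(2), symmetric]
      by (simp add: comp_def if_distrib cong: if_cong) (intro arg_cong[where f = sum_list] map_cong, auto)
    then show "(if f i = f j then 1 else 0) =
        (\<Sum>v\<leftarrow>map (\<lambda>y i. if f i = y then 1 else 0 :: complex) ys. cnj (v i) * v j)"
      using assms \<open>i \<in> I\<close> by simp
  qed
qed

lemma gram_rank_one: "gram I (\<lambda>i j. cnj (v i) * v j)"
  by (rule gramI[where vs = "[v]"]) simp

lemma sum_list_swap:
  "(\<Sum>x\<leftarrow>xs. \<Sum>y\<leftarrow>ys. f x y) = (\<Sum>y\<leftarrow>ys. \<Sum>x\<leftarrow>xs. f x y :: complex)"
  by (induction xs) (simp_all add: sum_list_addf)

text \<open>Each vector \<open>v\<close> contributes the squared modulus of the sum of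
  \<open>a * v i\<close> over \<open>L\<close>. A list is used because the same stack may arise in
  several ways from the words of a polynomial.\<close>

lemma gram_nonneg:
  assumes "gram I K" "snd ` set L \<subseteq> I"
  shows "(\<Sum>(a, i)\<leftarrow>L. \<Sum>(b, j)\<leftarrow>L. cnj a * b * K i j) \<in> \<real>\<^sub>\<ge>\<^sub>0"
proof -
  obtain vs where vs: "\<forall>i\<in>I. \<forall>j\<in>I. K i j = (\<Sum>v\<leftarrow>vs. cnj (v i) * v j)"
    using assms by (auto simp: gram_def)
  have "(\<Sum>(a, i)\<leftarrow>L. \<Sum>(b, j)\<leftarrow>L. cnj a * b * K i j) =
      (\<Sum>p\<leftarrow>L. \<Sum>q\<leftarrow>L. \<Sum>v\<leftarrow>vs. cnj (fst p * v (snd p)) * (fst q * v (snd q)))"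
    using assms(2) vs unfolding case_prod_unfold
    by (intro arg_cong[where f = sum_list] map_cong refl)
      (auto simp: sum_list_const_mult[symmetric] image_subset_iff mult_ac)
  also have "\<dots> = (\<Sum>v\<leftarrow>vs. \<Sum>p\<leftarrow>L. \<Sum>q\<leftarrow>L. cnj (fst p * v (snd p)) * (fst q * v (snd q)))"
    by (simp only: sum_list_swap[of _ vs])
  also have "\<dots> = (\<Sum>v\<leftarrow>vs. cnj (\<Sum>p\<leftarrow>L. fst p * v (snd p)) * (\<Sum>p\<leftarrow>L. fst p * v (snd p)))"
  proof -
    have "cnj (\<Sum>p\<leftarrow>L. f p) = (\<Sum>p\<leftarrow>L. cnj (f p))" for f :: "complex \<times> 'a \<Rightarrow> complex"
      by (induction L) auto
    then show ?thesis by (simp only: sum_list_const_mult sum_list_mult_const)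
  qed
  also have "\<dots> \<in> \<real>\<^sub>\<ge>\<^sub>0"
  proof (induction vs)
    case (Cons v vs)
    have "cnj z * z \<in> \<real>\<^sub>\<ge>\<^sub>0" for z :: complex
      by (metis complex_norm_square mult.commute nonneg_Reals_of_real_iff zero_le_power2)
    then show ?case using Cons by (simp add: nonneg_Reals_add_I)
  qed simp
  finally show ?thesis .
qed

text \<open>Elimination of one index at a time, as in the Cholesky decomposition.\<close>

lemma gram_of_positive:
  fixes K :: "'i \<Rightarrow> 'i \<Rightarrow> complex"
  assumes "finite I" "\<And>i j. i \<in> I \<Longrightarrow> j \<in> I \<Longrightarrow> K j i = cnj (K i j)"
    and "\<And>a. (\<Sum>i\<in>I. \<Sum>j\<in>I. cnj (a i) * a j * K i j) \<in> \<real>\<^sub>\<ge>\<^sub>0"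
  shows "gram I K"
  using assms
proof (induction I arbitrary: K rule: finite_induct)
  case empty
  show ?case by (simp add: gram_def)
next
  case (insert x I)
  have herm: "K j i = cnj (K i j)" if "i \<in> insert x I" "j \<in> insert x I" for i j
    using insert.prems(1) that by blast
  have hx: "K i x = cnj (K x i)" if "i \<in> I" for i
    using herm[of x i] that by blast
  define Q where "Q a = (\<Sum>i\<in>I. \<Sum>j\<in>I. cnj (a i) * a j * K i j)" for a
  define s where "s a = (\<Sum>j\<in>I. a j * K x j)" for a
  \<comment> \<open>The quadratic form at the vector with value \<open>t\<close> at the new index
    and \<open>a\<close> elsewhere, expanded in \<open>t\<close>.\<close>
  have pos: "cnj t * t * K x x + cnj t * s a + t * cnj (s a) + Q a \<in> \<real>\<^sub>\<ge>\<^sub>0" for a t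
  proof -
    let ?a = "a(x := t)"
    have "(\<Sum>i\<in>insert x I. \<Sum>j\<in>insert x I. cnj (?a i) * ?a j * K i j) =
      (cnj t * t * K x x + (\<Sum>j\<in>I. cnj t * ?a j * K x j)) +
      (\<Sum>i\<in>I. cnj (?a i) * t * K i x + (\<Sum>j\<in>I. cnj (?a i) * ?a j * K i j))"
      using insert.hyps by simp
    also have "(\<Sum>j\<in>I. cnj t * ?a j * K x j) = cnj t * s a"
      unfolding s_def sum_distrib_left using insert.hyps by (intro sum.cong) (auto simp: mult_ac)
    also have "(\<Sum>i\<in>I. cnj (?a i) * t * K i x + (\<Sum>j\<in>I. cnj (?a i) * ?a j * K i j)) =
        t * cnj (s a) + Q a"
    proof -
      have "(\<Sum>i\<in>I. cnj (?a i) * t * K i x) = t * cnj (s a)"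
        unfolding s_def cnj_sum sum_distrib_left using insert.hyps
        by (intro sum.cong) (auto simp: hx mult_ac)
      moreover have "(\<Sum>i\<in>I. \<Sum>j\<in>I. cnj (?a i) * ?a j * K i j) = Q a"
        unfolding Q_def using insert.hyps by (intro sum.cong) auto
      ultimately show ?thesis by (simp add: sum.distrib)
    qed
    finally show ?thesis using insert.prems(2)[of ?a] by (simp add: add_ac)
  qed
  have x_nonneg: "K x x \<in> \<real>\<^sub>\<ge>\<^sub>0"
    using pos[of 1 "\<lambda>_. 0"] by (simp add: s_def Q_def)
  then obtain r where r: "K x x = of_real r" "r \<ge> 0"
    by (auto simp: nonneg_Reals_def)
  have null: "K x j = 0" if "K x x = 0" "j \<in> I" for j
  proof (rule ccontr)
    assume nz: "K x j \<noteq> 0"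
    let ?a = "\<lambda>i. if i = j then 1 else 0 :: complex"
    have s: "s ?a = K x j" unfolding s_def using that insert.hyps by (simp add: if_distrib if_distribR sum.delta cong: if_cong)
    \<comment> \<open>With a vanishing diagonal entry the form is affine in the real and imaginary
      parts of \<open>t\<close>. The multiple of \<open>K x j\<close> is chosen so that the linear
      part is \<open>- (Re (Q ?a) + 1)\<close>, which drives the real part of the form to
      -1.\<close>
    define u where "u = of_real (- (Re (Q ?a) + 1) / (2 * (cmod (K x j))\<^sup>2)) * K x j"
    have "Re (cnj u * K x j + u * cnj (K x j)) =
        2 * (- (Re (Q ?a) + 1) / (2 * (cmod (K x j))\<^sup>2)) * (cmod (K x j))\<^sup>2"
      unfolding u_def cmod_power2 by (simp add: power2_eq_square algebra_simps)
    also have "\<dots> = - (Re (Q ?a) + 1)"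
      using nz by simp
    finally have "Re (cnj u * K x j + u * cnj (K x j) + Q ?a) = - 1" by simp
    moreover have "cnj u * K x j + u * cnj (K x j) + Q ?a \<in> \<real>\<^sub>\<ge>\<^sub>0"
      using pos[of u ?a] that(1) s by simp
    ultimately show False unfolding complex_nonneg_Reals_iff by linarith
  qed
  \<comment> \<open>The Schur complement of the entry at \<open>x\<close>. If that entry is 0,
    division by zero gives 0 and \<open>L\<close> coincides with \<open>K\<close>.\<close>
  define L where "L i j = K i j - K i x * K x j / K x x" for i j
  have "gram I L"
  proof (rule insert.IH)
    fix i j assume "i \<in> I" "j \<in> I"
    then show "L j i = cnj (L i j)"
      using herm[of i j] hx[of i] hx[of j] r by (simp add: L_def mult_ac)
  next
    fix a
    have "(\<Sum>i\<in>I. \<Sum>j\<in>I. cnj (a i) * a j * L i j) = Q a - cnj (s a) * s a / K x x"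
    proof -
      have "(\<Sum>i\<in>I. \<Sum>j\<in>I. cnj (a i) * a j * L i j) =
          Q a - (\<Sum>i\<in>I. \<Sum>j\<in>I. cnj (a i) * K i x * (a j * K x j) / K x x)"
        by (simp add: Q_def L_def algebra_simps sum_subtractf)
      also have "(\<Sum>i\<in>I. \<Sum>j\<in>I. cnj (a i) * K i x * (a j * K x j) / K x x) =
          (\<Sum>i\<in>I. cnj (a i) * K i x) * s a / K x x"
        by (simp add: s_def sum_product sum_divide_distrib)
      also have "(\<Sum>i\<in>I. cnj (a i) * K i x) = cnj (s a)"
        unfolding s_def cnj_sum by (intro sum.cong) (auto simp: hx)
      finally show ?thesis .
    qed
    also have "\<dots> \<in> \<real>\<^sub>\<ge>\<^sub>0"
    proof (cases "r = 0")
      case True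
      then show ?thesis using pos[of 0 a] r by simp
    next
      case False
      \<comment> \<open>The value of \<open>t\<close> that minimises the form in \<open>pos\<close>
        is \<open>- (s a / K x x)\<close>, and the minimum is the form of the Schur
        complement.\<close>
      have "cnj (- (s a / K x x)) * (- (s a / K x x)) * K x x + cnj (- (s a / K x x)) * s a +
          - (s a / K x x) * cnj (s a) + Q a = Q a - cnj (s a) * s a / K x x"
        unfolding r(1) using False by (simp add: divide_simps)
      then show ?thesis using pos[of "- (s a / K x x)" a] by (simp only:)
    qed
    finally show "(\<Sum>i\<in>I. \<Sum>j\<in>I. cnj (a i) * a j * L i j) \<in> \<real>\<^sub>\<ge>\<^sub>0" .
  qed
  then obtain vs where vs: "\<forall>i\<in>I. \<forall>j\<in>I. L i j = (\<Sum>v\<leftarrow>vs. cnj (v i) * v j)"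
    by (auto simp: gram_def)
  \<comment> \<open>For \<open>r = 0\<close> division by zero makes this the zero vector, in
    accordance with \<open>null\<close>.\<close>
  define w where "w j = K x j / of_real (sqrt r)" for j
  let ?vs = "w # map (\<lambda>v i. if i = x then 0 else v i) vs"
  show ?case
  proof (rule gramI[where vs = ?vs])
    fix i j assume ij: "i \<in> insert x I" "j \<in> insert x I"
    have w: "cnj (w i) * w j = K i x * K x j / K x x"
    proof -
      have "K i x = cnj (K x i)" using hx[of i] r(1) ij by (cases "i = x") auto
      moreover have "of_real (sqrt r) * of_real (sqrt r) = (of_real r :: complex)"
        using r(2) by (simp flip: of_real_mult)
      ultimately show ?thesis by (simp add: w_def r(1))
    qed
    have "(\<Sum>v\<leftarrow>map (\<lambda>v i. if i = x then 0 else v i) vs. cnj (v i) * v j) = L i j"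
    proof (cases "i = x \<or> j = x")
      case True
      have "K i x * K x j / K x x = K i j"
      proof (cases "K x x = 0")
        case T: True
        then have "K x i = 0" "K x j = 0" using null ij by auto
        then show ?thesis using True hx[of i] ij T by (cases "i = x"; cases "j = x") auto
      qed (use True in auto)
      then show ?thesis using True by (auto simp: L_def comp_def)
    next
      case False
      then show ?thesis using ij vs by (auto simp: comp_def)
    qed
    then show "K i j = (\<Sum>v\<leftarrow>?vs. cnj (v i) * v j)"
      using w by (simp add: L_def)
  qed
qed

section \<open>Positivity of the Fock functional and linearity in the constants\<close>

context tracial_star_prob_space
begin

text \<open>The letters act as adjoints of each other for the inner product: creation of
  \<open>(g, s)\<close> on one side matches annihilation of the same marker on the other side. The
  conjugated state that appears there is resolved by \<open>state_involution\<close>.\<close>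

lemma left_op_stack_ker:
  assumes "wf_letter l" "wf_stack S" "wf_stack T"
  shows "left_op l (stack_ker S) T = (\<Sum>(a, S')\<leftarrow>left_act (star_letter l) S. cnj a * stack_ker S' T)"
proof -
  obtain b xs where S: "S = (b, xs)" by (cases S)
  obtain c ys where T: "T = (c, ys)" by (cases T)
  have bc: "b \<in> carrier A" "c \<in> carrier A" using assms by (auto simp: S T wf_stack_def)
  show ?thesis
  proof (cases l)
    case (Const e)
    then show ?thesis using assms bc
      by (simp add: S T left_op_Const involution_mult involution_involution involution_closed times_assoc alg_closed)
  next
    case (Gen g s)
    have 1: "(\<Sum>(a, S')\<leftarrow>left_act (star_letter l) S. cnj a * stack_ker S' T) =
      stack_ker (\<one>, ((g, \<not> s), b) # xs) T +
      (case xs of [] \<Rightarrow> 0 | (t, e) # zs \<Rightarrow> (if t = (g, s) then cnj (state A b) else 0) * stack_ker (e, zs) T)"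
    proof (cases xs)
      case (Cons x zs)
      obtain h t e where "x = ((h, t), e)" by (metis surj_pair)
      then show ?thesis by (simp add: Gen S Cons)
    qed (simp add: Gen S)
    have 2: "left_op l (stack_ker S) T = stack_ker S (\<one>, ((g, s), c) # ys) +
      (case ys of [] \<Rightarrow> 0 | (t, e) # zs \<Rightarrow> (if t = (g, \<not> s) then state A c else 0) * stack_ker S (e, zs))"
    proof (cases ys)
      case (Cons x zs)
      obtain t e where x: "x = (t, e)" by (metis surj_pair)
      show ?thesis unfolding T Gen Cons x left_op_Gen by simp
    qed (simp add: Gen T left_op_Gen)
    have 3: "stack_ker S (\<one>, ((g, s), c) # ys) =
      (case xs of [] \<Rightarrow> 0 | (t, e) # zs \<Rightarrow> (if t = (g, s) then cnj (state A b) else 0) * stack_ker (e, zs) T)"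
    proof (cases xs)
      case (Cons x zs)
      obtain t e where x: "x = (t, e)" by (metis surj_pair)
      then show ?thesis using bc
        by (simp add: S T Cons x state_involution times_one involution_closed)
    qed (simp add: S)
    have 4: "stack_ker (\<one>, ((g, \<not> s), b) # xs) T =
      (case ys of [] \<Rightarrow> 0 | (t, e) # zs \<Rightarrow> (if t = (g, \<not> s) then state A c else 0) * stack_ker S (e, zs))"
    proof (cases ys)
      case (Cons x zs)
      obtain t e where x: "x = (t, e)" by (metis surj_pair)
      then show ?thesis using bc
        by (simp add: S T Cons x involution_one times_one)
    qed (simp add: T)
    show ?thesis unfolding 1 2 3 4 by simp
  qed
qed

text \<open>The vector obtained by applying a word to a stack, as a list of weighted stacks with
  possible repetitions. It is the object dual to \<open>fold left_op\<close>.\<close>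

fun vec_from :: "('a, 'g) letter list \<Rightarrow> ('a, 'g) stack \<Rightarrow> (complex \<times> ('a, 'g) stack) list" where
  "vec_from [] S = [(1, S)]"
| "vec_from (l # w) S =
     concat (map (\<lambda>(a, T). map (\<lambda>(b, U). (a * b, U)) (left_act l T)) (vec_from w S))"

lemma sum_list_concat_map: "(\<Sum>x\<leftarrow>concat xss. f x) = (\<Sum>xs\<leftarrow>xss. \<Sum>x\<leftarrow>xs. f x :: complex)"
  by (induction xss) auto

lemma fold_left_op_vec:
  "fold left_op w h S = (\<Sum>(a, T)\<leftarrow>vec_from w S. a * h T)"
proof (induction w arbitrary: h)
  case (Cons l w)
  show ?case
    unfolding fold.simps o_apply Cons.IH vec_from.simps sum_list_concat_map
    by (simp add: left_op_def comp_def case_prod_unfold sum_list_const_mult[symmetric] mult.assoc)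
qed simp

lemma vec_from_wf:
  assumes "list_all wf_letter w" "wf_stack S" "(a, T) \<in> set (vec_from w S)"
  shows "wf_stack T"
  using assms
proof (induction w arbitrary: a T)
  case (Cons l w)
  obtain b U c where "(b, U) \<in> set (vec_from w S)" "(c, T) \<in> set (left_act l U)"
    using Cons.prems(3) by auto
  then show ?case using Cons.IH[of b U] Cons.prems(1,2) left_act_wf[of l U c T] by simp
qed simp

lemma star_letter_wf: "wf_letter l \<Longrightarrow> wf_letter (star_letter l)"
  by (cases l) (auto simp: involution_closed)

lemma star_letter_star: "wf_letter l \<Longrightarrow> star_letter (star_letter l) = l"
  by (cases l) (auto simp: involution_involution)

lemma star_word_wf: "list_all wf_letter w \<Longrightarrow> list_all wf_letter (star_word w)"
  by (auto simp: star_word_def list_all_iff star_letter_wf)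

lemma vac_eq_stack_ker: "wf_stack T \<Longrightarrow> vac T = stack_ker (\<one>, []) T"
  by (cases T rule: vac.cases) (auto simp: wf_stack_def involution_one times_one)

lemma left_op_sum_list:
  "left_op l (\<lambda>T. \<Sum>x\<leftarrow>L. f x * F x T) T = (\<Sum>x\<leftarrow>L. f x * left_op l (F x) T)"
proof -
  have *: "a * (\<Sum>x\<leftarrow>L. f x * F x U) = (\<Sum>x\<leftarrow>L. f x * (a * F x U))" for a U
    by (simp add: sum_list_const_mult[symmetric] mult_ac)
  show ?thesis
    unfolding left_op_def case_prod_unfold * sum_list_const_mult[symmetric] mult.left_commute[of "fst _"]
    by (rule sum_list_swap)
qed

lemma fold_left_op_star_word:
  assumes "list_all wf_letter w" "wf_stack T"
  shows "fold left_op (star_word w) vac T = (\<Sum>(a, S)\<leftarrow>vec_from w (\<one>, []). cnj a * stack_ker S T)"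
  using assms
proof (induction w arbitrary: T)
  case Nil
  then show ?case by (simp add: star_word_def vac_eq_stack_ker)
next
  case (Cons l w)
  have l: "wf_letter (star_letter l)" using Cons.prems star_letter_wf by auto
  have "fold left_op (star_word (l # w)) vac T = left_op (star_letter l) (fold left_op (star_word w) vac) T"
    by (simp add: star_word_def)
  also have "\<dots> = left_op (star_letter l) (\<lambda>T. \<Sum>p\<leftarrow>vec_from w (\<one>, []). cnj (fst p) * stack_ker (snd p) T) T"
    using Cons l by (intro left_op_cong) (auto simp: case_prod_unfold)
  also have "\<dots> = (\<Sum>p\<leftarrow>vec_from w (\<one>, []). cnj (fst p) * left_op (star_letter l) (stack_ker (snd p)) T)"
    by (rule left_op_sum_list)
  also have "\<dots> = (\<Sum>p\<leftarrow>vec_from w (\<one>, []). cnj (fst p) *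
      (\<Sum>(a, S')\<leftarrow>left_act l (snd p). cnj a * stack_ker S' T))"
    using Cons.prems l vec_from_wf[of w "(\<one>, [])"] star_letter_star[of l]
    by (intro arg_cong[where f = sum_list] map_cong refl)
      (simp add: left_op_stack_ker unit_closed split_paired_all)
  also have "\<dots> = (\<Sum>(a, S)\<leftarrow>vec_from (l # w) (\<one>, []). cnj a * stack_ker S T)"
    unfolding vec_from.simps sum_list_concat_map
    by (simp add: comp_def case_prod_unfold sum_list_const_mult[symmetric] mult.assoc)
  finally show ?case .
qed

text \<open>By the adjoint relation the starred word moves to the other argument of the inner
  product; this is the GNS form of the functional, from which positivity is read off.\<close>

lemma fock_star_append:
  assumes "list_all wf_letter u" "list_all wf_letter v"
  shows "fock (star_word u @ v) =
    (\<Sum>(a, S)\<leftarrow>vec_from u (\<one>, []). \<Sum>(b, T)\<leftarrow>vec_from v (\<one>, []). cnj a * b * stack_ker S T)"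
proof -
  have "fock (star_word u @ v) =
      (\<Sum>(b, T)\<leftarrow>vec_from v (\<one>, []). b * fold left_op (star_word u) vac T)"
    by (simp add: fock_def fold_left_op_vec[symmetric])
  also have "\<dots> = (\<Sum>q\<leftarrow>vec_from v (\<one>, []). \<Sum>p\<leftarrow>vec_from u (\<one>, []).
      cnj (fst p) * fst q * stack_ker (snd p) (snd q))"
    using assms vec_from_wf[of v "(\<one>, [])"]
    by (intro arg_cong[where f = sum_list] map_cong refl)
      (auto simp: fold_left_op_star_word unit_closed case_prod_unfold sum_list_const_mult[symmetric] mult_ac)
  also have "\<dots> = (\<Sum>p\<leftarrow>vec_from u (\<one>, []). \<Sum>q\<leftarrow>vec_from v (\<one>, []).
      cnj (fst p) * fst q * stack_ker (snd p) (snd q))"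
    by (rule sum_list_swap)
  finally show ?thesis by (simp add: case_prod_unfold)
qed

lemma linear_comb_closed:
  assumes "finite I" "\<And>i. i \<in> I \<Longrightarrow> x i \<in> carrier A"
  shows "(\<Oplus>i\<in>I. a i \<odot> x i) \<in> carrier A"
  using assms by (intro abelian_monoid.finsum_closed[OF abelian_group.axioms(1)[OF ring.is_abelian_group[OF ring_A]]])
    (auto simp: alg_closed)

lemma linear_comb_insert:
  assumes "finite I" "i \<notin> I" "\<And>j. j \<in> insert i I \<Longrightarrow> x j \<in> carrier A"
  shows "(\<Oplus>j\<in>insert i I. a j \<odot> x j) = a i \<odot> x i \<oplus> (\<Oplus>j\<in>I. a j \<odot> x j)"
  using assms
  by (intro abelian_monoid.finsum_insert[OF abelian_group.axioms(1)[OF ring.is_abelian_group[OF ring_A]]])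
    (auto simp: alg_closed)

lemma linear_comb_empty: "(\<Oplus>j\<in>{}. a j \<odot> x j) = \<zero>"
  by (rule abelian_monoid.finsum_empty[OF abelian_group.axioms(1)[OF ring.is_abelian_group[OF ring_A]]])

lemma times_zero: "x \<in> carrier A \<Longrightarrow> x \<otimes> \<zero> = \<zero>" "x \<in> carrier A \<Longrightarrow> \<zero> \<otimes> x = \<zero>"
  by (rule ring.ring_simprules[OF ring_A], assumption)+

lemma state_times_linear_comb:
  assumes "finite I" "\<And>i. i \<in> I \<Longrightarrow> x i \<in> carrier A" "y \<in> carrier A"
  shows "state A (y \<otimes> (\<Oplus>i\<in>I. a i \<odot> x i)) = (\<Sum>i\<in>I. a i * state A (y \<otimes> x i))"
  using assms
proof (induction I rule: finite_induct)
  case empty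
  then show ?case by (simp add: linear_comb_empty times_zero state_zero)
next
  case (insert i I)
  have "y \<otimes> (\<Oplus>j\<in>insert i I. a j \<odot> x j) = a i \<odot> (y \<otimes> x i) \<oplus> y \<otimes> (\<Oplus>j\<in>I. a j \<odot> x j)"
    using insert by (simp add: linear_comb_insert linear_comb_closed times_add_right alg_closed smult_mult_right)
  then show ?case using insert by (simp add: linear_comb_closed alg_closed state_add state_smult)
qed

lemma times_linear_comb:
  assumes "finite I" "\<And>i. i \<in> I \<Longrightarrow> x i \<in> carrier A" "y \<in> carrier A"
  shows "y \<otimes> (\<Oplus>i\<in>I. a i \<odot> x i) = (\<Oplus>i\<in>I. a i \<odot> (y \<otimes> x i))"
  using assms
proof (induction I rule: finite_induct)
  case empty
  then show ?case by (simp add: linear_comb_empty times_zero)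
next
  case (insert i I)
  then show ?case
    by (simp add: linear_comb_insert linear_comb_closed times_add_right smult_mult_right alg_closed)
qed

lemma linear_comb_single:
  assumes "finite I" "i \<in> I" "\<And>j. j \<in> I \<Longrightarrow> j \<noteq> i \<Longrightarrow> a j \<odot> x j = \<zero>" "\<And>j. j \<in> I \<Longrightarrow> x j \<in> carrier A"
  shows "(\<Oplus>j\<in>I. a j \<odot> x j) = a i \<odot> x i"
proof -
  have "(\<Oplus>j\<in>J. a j \<odot> x j) = \<zero>" if "finite J" "J \<subseteq> I - {i}" for J
    using that
  proof (induction J rule: finite_induct)
    case empty
    show ?case by (rule linear_comb_empty)
  next
    case (insert j J)
    then have "(\<Oplus>j\<in>insert j J. a j \<odot> x j) = a j \<odot> x j \<oplus> (\<Oplus>j\<in>J. a j \<odot> x j)"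
      using assms(4) by (intro linear_comb_insert) auto
    then show ?case using insert assms(3)[of j] by (simp add: plus_zero zero_in)
  qed
  from this[of "I - {i}"] have "(\<Oplus>j\<in>I - {i}. a j \<odot> x j) = \<zero>" using assms(1) by simp
  moreover have "(\<Oplus>j\<in>insert i (I - {i}). a j \<odot> x j) = a i \<odot> x i \<oplus> (\<Oplus>j\<in>I - {i}. a j \<odot> x j)"
    using assms by (intro linear_comb_insert) auto
  ultimately show ?thesis using assms by (simp add: insert_absorb plus_zero alg_closed)
qed

lemma gram_state:
  assumes "finite I" "\<And>i. i \<in> I \<Longrightarrow> x i \<in> carrier A"
  shows "gram I (\<lambda>i j. state A (involution A (x i) \<otimes> x j))"
proof (rule gram_of_positive[OF assms(1)])
  fix i j assume "i \<in> I" "j \<in> I"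
  then have ij: "x i \<in> carrier A" "x j \<in> carrier A" using assms by auto
  have "involution A (involution A (x i) \<otimes> x j) = involution A (x j) \<otimes> x i"
    using ij by (simp add: involution_mult involution_involution involution_closed)
  then show "state A (involution A (x j) \<otimes> x i) = cnj (state A (involution A (x i) \<otimes> x j))"
    using state_involution[of "involution A (x i) \<otimes> x j"] ij by (simp add: alg_closed)
next
  fix a :: "'b \<Rightarrow> complex"
  let ?y = "\<Oplus>i\<in>I. a i \<odot> x i"
  have y: "?y \<in> carrier A" using assms by (intro linear_comb_closed) auto
  have "state A (involution A ?y \<otimes> z) = (\<Sum>i\<in>I. cnj (a i) * state A (involution A (x i) \<otimes> z))"
    if z: "z \<in> carrier A" for z
  proof -
    have "involution A ?y \<otimes> z = involution A (involution A z \<otimes> ?y)"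
      using y z by (simp add: involution_mult involution_involution alg_closed)
    then have "state A (involution A ?y \<otimes> z) = cnj (state A (involution A z \<otimes> ?y))"
      using y z by (simp add: state_involution alg_closed)
    also have "\<dots> = (\<Sum>i\<in>I. cnj (a i) * cnj (state A (involution A z \<otimes> x i)))"
      using assms z by (simp add: state_times_linear_comb alg_closed)
    also have "\<dots> = (\<Sum>i\<in>I. cnj (a i) * state A (involution A (involution A z \<otimes> x i)))"
      using assms z by (simp add: state_involution alg_closed)
    also have "\<dots> = (\<Sum>i\<in>I. cnj (a i) * state A (involution A (x i) \<otimes> z))"
      using assms z by (simp add: involution_mult involution_involution alg_closed)
    finally show ?thesis .
  qed
  from this[OF y] have "state A (involution A ?y \<otimes> ?y) =
      (\<Sum>i\<in>I. \<Sum>j\<in>I. cnj (a i) * a j * state A (involution A (x i) \<otimes> x j))"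
    using assms y by (simp add: state_times_linear_comb alg_closed sum_distrib_left mult.assoc)
  then show "(\<Sum>i\<in>I. \<Sum>j\<in>I. cnj (a i) * a j * state A (involution A (x i) \<otimes> x j)) \<in> \<real>\<^sub>\<ge>\<^sub>0"
    using state_positive[OF y] by simp
qed

text \<open>Peeling off the top entries: the kernel is a rank-one kernel supported on the empty
  lists plus, on the nonempty ones, the product of three kernels, which compare the markers, pair
  the top constants and pair the tails.\<close>

lemma gram_ker_list:
  assumes "finite I" "\<And>i. i \<in> I \<Longrightarrow> \<forall>x\<in>set (xs i). snd x \<in> carrier A" "\<And>i. i \<in> I \<Longrightarrow> length (xs i) \<le> m"
  shows "gram I (\<lambda>i j. ker_list (xs i) (xs j))"
  using assms(2,3)
proof (induction m arbitrary: xs)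
  case 0
  have "gram I (\<lambda>i j. cnj 1 * 1)" by (rule gram_rank_one)
  then show ?case using 0 by (subst gram_cong[where L = "\<lambda>i j. cnj 1 * 1"]) auto
next
  case (Suc m)
  \<comment> \<open>The value \<one> for an empty list is a placeholder; the factor \<open>c\<close>
    below vanishes there.\<close>
  define e where "e i = (if xs i = [] then \<one> else snd (hd (xs i)))" for i
  have e: "e i \<in> carrier A" if "i \<in> I" for i
    using Suc.prems(1)[OF that] by (cases "xs i") (auto simp: e_def unit_closed)
  have IH: "gram I (\<lambda>i j. ker_list (tl (xs i)) (tl (xs j)))"
  proof (rule Suc.IH)
    show "\<forall>x\<in>set (tl (xs i)). snd x \<in> carrier A" if "i \<in> I" for i
      using Suc.prems(1)[OF that] list.set_sel(2)[of "xs i"] by (cases "xs i") auto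
    show "length (tl (xs i)) \<le> m" if "i \<in> I" for i
      using Suc.prems(2)[OF that] by simp
  qed
  define t where "t i = (if xs i = [] then None else Some (fst (hd (xs i))))" for i
  define n c :: "_ \<Rightarrow> complex" where "n i = (if xs i = [] then 1 else 0)" and "c i = 1 - n i" for i
  have eq: "ker_list (xs i) (xs j) = cnj (n i) * n j + cnj (c i) * c j *
      ((if t i = t j then 1 else 0) * (state A (involution A (e i) \<otimes> e j) * ker_list (tl (xs i)) (tl (xs j))))"
    for i j
    by (cases "(xs i, xs j)" rule: ker_list.cases) (auto simp: n_def c_def t_def e_def)
  have "gram I (\<lambda>i j. cnj (n i) * n j + cnj (c i) * c j *
      ((if t i = t j then 1 else 0) * (state A (involution A (e i) \<otimes> e j) * ker_list (tl (xs i)) (tl (xs j)))))"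
    using assms(1) e IH
    by (intro gram_add gram_mult gram_rank_one gram_eq gram_state) auto
  then show ?case unfolding eq .
qed

lemma gram_stack_ker:
  assumes "finite I" "\<And>S. S \<in> I \<Longrightarrow> wf_stack S"
  shows "gram I stack_ker"
proof -
  have eq: "stack_ker S T = state A (involution A (fst S) \<otimes> fst T) * ker_list (snd S) (snd T)"
    for S T :: "('a, 'b) stack" by (cases S; cases T) simp
  have "length (snd S) \<le> (\<Sum>S\<in>I. length (snd S))" if "S \<in> I" for S
    using assms(1) that by (intro member_le_sum) auto
  then have "gram I (\<lambda>S T. state A (involution A (fst S) \<otimes> fst T) * ker_list (snd S) (snd T))"
    using assms by (intro gram_mult gram_state gram_ker_list[where m = "\<Sum>S\<in>I. length (snd S)"])
      (auto simp: wf_stack_def)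
  then show ?thesis by (subst gram_cong[OF eq])
qed

lemma fock_positive:
  assumes "finite W" "\<And>w. w \<in> W \<Longrightarrow> list_all wf_letter (h w)"
  shows "(\<Sum>u\<in>W. \<Sum>v\<in>W. cnj (a u) * a v * fock (star_word (h u) @ h v)) \<in> \<real>\<^sub>\<ge>\<^sub>0"
proof -
  obtain ws where ws: "set ws = W" "distinct ws"
    using finite_distinct_list[OF assms(1)] by auto
  \<comment> \<open>All words are expanded into one list of weighted stacks, which turns the double
    sum over words into the quadratic form of \<open>stack_ker\<close>.\<close>
  define L where "L = concat (map (\<lambda>w. map (\<lambda>(b, S). (a w * b, S)) (vec_from (h w) (\<one>, []))) ws)"
  have "wf_stack S" if "S \<in> snd ` set L" for S
    using that assms(2) ws(1) vec_from_wf[of _ "(\<one>, [])"] by (fastforce simp: L_def unit_closed)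
  then have "gram (snd ` set L) stack_ker" by (intro gram_stack_ker) auto
  from gram_nonneg[OF this]
  have "(\<Sum>(b, S)\<leftarrow>L. \<Sum>(c, T)\<leftarrow>L. cnj b * c * stack_ker S T) \<in> \<real>\<^sub>\<ge>\<^sub>0"
    by simp
  also have "(\<Sum>(b, S)\<leftarrow>L. \<Sum>(c, T)\<leftarrow>L. cnj b * c * stack_ker S T) =
      (\<Sum>u\<leftarrow>ws. \<Sum>p\<leftarrow>vec_from (h u) (\<one>, []). \<Sum>v\<leftarrow>ws. \<Sum>q\<leftarrow>vec_from (h v) (\<one>, []).
        cnj (a u * fst p) * (a v * fst q) * stack_ker (snd p) (snd q))"
    by (simp add: L_def sum_list_concat_map comp_def case_prod_unfold)
  also have "\<dots> = (\<Sum>u\<leftarrow>ws. \<Sum>v\<leftarrow>ws. \<Sum>p\<leftarrow>vec_from (h u) (\<one>, []). \<Sum>q\<leftarrow>vec_from (h v) (\<one>, []).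
        cnj (a u * fst p) * (a v * fst q) * stack_ker (snd p) (snd q))"
    by (simp only: sum_list_swap[of _ "vec_from (h _) (\<one>, [])" ws])
  also have "\<dots> = (\<Sum>u\<leftarrow>ws. \<Sum>v\<leftarrow>ws. cnj (a u) * a v * fock (star_word (h u) @ h v))"
  proof (intro arg_cong[where f = sum_list] map_cong refl)
    fix u v assume "u \<in> set ws" "v \<in> set ws"
    then have "fock (star_word (h u) @ h v) = (\<Sum>p\<leftarrow>vec_from (h u) (\<one>, []). \<Sum>q\<leftarrow>vec_from (h v) (\<one>, []).
        cnj (fst p) * fst q * stack_ker (snd p) (snd q))"
      using assms(2) ws(1) by (simp add: fock_star_append case_prod_unfold)
    then show "(\<Sum>p\<leftarrow>vec_from (h u) (\<one>, []). \<Sum>q\<leftarrow>vec_from (h v) (\<one>, []).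
        cnj (a u * fst p) * (a v * fst q) * stack_ker (snd p) (snd q)) =
        cnj (a u) * a v * fock (star_word (h u) @ h v)"
      by (simp add: sum_list_const_mult[symmetric] mult_ac)
  qed
  also have "\<dots> = (\<Sum>u\<in>W. \<Sum>v\<in>W. cnj (a u) * a v * fock (star_word (h u) @ h v))"
    using ws by (simp add: sum_list_distinct_conv_sum_set)
  finally show ?thesis .
qed

lemma star_word_star_word: "list_all wf_letter w \<Longrightarrow> star_word (star_word w) = w"
  by (induction w) (auto simp: star_word_def star_letter_star rev_map)

text \<open>Stacks enter all functionals only through inner products, hence linearly.\<close>

lemma fold_left_op_head_null:
  assumes w: "list_all wf_letter w" and xs: "\<And>x. x \<in> set xs \<Longrightarrow> snd x \<in> carrier A"
    and L: "\<And>a x. (a, x) \<in> set L \<Longrightarrow> x \<in> carrier A"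
    and null: "\<And>y. y \<in> carrier A \<Longrightarrow> (\<Sum>(a, x)\<leftarrow>L. a * state A (y \<otimes> x)) = 0"
  shows "(\<Sum>(a, x)\<leftarrow>L. a * fold left_op w vac (x, xs)) = 0"
proof -
  define v where "v = star_word w"
  have v: "list_all wf_letter v" "w = star_word v"
    using star_word_wf[OF w] star_word_star_word[OF w] by (simp_all add: v_def)
  have "(\<Sum>p\<leftarrow>L. fst p * fold left_op w vac (snd p, xs)) =
      (\<Sum>p\<leftarrow>L. \<Sum>q\<leftarrow>vec_from v (\<one>, []). fst p * (cnj (fst q) * stack_ker (snd q) (snd p, xs)))"
  proof (intro arg_cong[where f = sum_list] map_cong refl)
    fix p assume "p \<in> set L"
    then have "wf_stack (snd p, xs)" using L[of "fst p" "snd p"] xs by (auto simp: wf_stack_def)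
    from fold_left_op_star_word[OF v(1) this]
    show "fst p * fold left_op w vac (snd p, xs) =
        (\<Sum>q\<leftarrow>vec_from v (\<one>, []). fst p * (cnj (fst q) * stack_ker (snd q) (snd p, xs)))"
      by (simp add: v(2) case_prod_unfold sum_list_const_mult)
  qed
  also have "\<dots> = (\<Sum>q\<leftarrow>vec_from v (\<one>, []). \<Sum>p\<leftarrow>L. fst p * (cnj (fst q) * stack_ker (snd q) (snd p, xs)))"
    by (rule sum_list_swap)
  also have "\<dots> = (\<Sum>q\<leftarrow>vec_from v (\<one>, []). 0)"
  proof (intro arg_cong[where f = sum_list] map_cong refl)
    fix q assume "q \<in> set (vec_from v (\<one>, []))"
    then have "wf_stack (snd q)" using vec_from_wf[OF v(1) wf_stack_one, of "fst q" "snd q"] by simp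
    then obtain b ys where q: "snd q = (b, ys)" "b \<in> carrier A" by (cases "snd q") (auto simp: wf_stack_def)
    have "(\<Sum>p\<leftarrow>L. fst p * (cnj (fst q) * stack_ker (snd q) (snd p, xs))) =
      cnj (fst q) * ker_list ys xs * (\<Sum>(a, x)\<leftarrow>L. a * state A (involution A b \<otimes> x))"
      by (simp add: q case_prod_unfold sum_list_const_mult[symmetric] mult_ac)
    then show "(\<Sum>p\<leftarrow>L. fst p * (cnj (fst q) * stack_ker (snd q) (snd p, xs))) = 0"
      using null[of "involution A b"] q(2) by (simp add: involution_closed)
  qed
  finally show ?thesis by (simp add: case_prod_unfold)
qed

text \<open>The constant is rotated to the end of the word, where it meets the vacuum and becomes
  the top constant of the stack. In this way a relation that holds in the inner products of
  \<open>A\<close> passes to words, although \<open>Const\<close> is only a symbol.\<close>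

lemma fock_linear:
  assumes w: "list_all wf_letter w" and L: "\<And>a x. (a, x) \<in> set L \<Longrightarrow> x \<in> carrier A"
    and null: "\<And>y. y \<in> carrier A \<Longrightarrow> (\<Sum>(a, x)\<leftarrow>L. a * state A (y \<otimes> x)) = 0"
  shows "(\<Sum>(a, x)\<leftarrow>L. a * fock (Const x # w)) = 0"
proof -
  have "fock (Const (snd p) # w) = fold left_op w vac (snd p, [])" if "p \<in> set L" for p
  proof -
    have x: "snd p \<in> carrier A" using L[of "fst p" "snd p"] that by simp
    have "fock (Const (snd p) # w) = fock (w @ [Const (snd p)])"
      using w x by (intro fock_rotate1) auto
    then show ?thesis using x by (simp add: fock_def left_op_Const times_one)
  qed
  then have "(\<Sum>p\<leftarrow>L. fst p * fock (Const (snd p) # w)) = (\<Sum>p\<leftarrow>L. fst p * fold left_op w vac (snd p, []))"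
    by (intro arg_cong[where f = sum_list] map_cong refl) simp
  also have "\<dots> = 0"
    using fold_left_op_head_null[OF w _ L null, of "[]"] by (simp add: case_prod_unfold)
  finally show ?thesis by (simp add: case_prod_unfold)
qed

text \<open>Both values are inner products of the vacuum with the vector of \<open>w\<close>, in
  opposite orders. Hermitian symmetry is read off a Gram representation on just the two stacks
  involved.\<close>

lemma fock_star:
  assumes "list_all wf_letter w"
  shows "fock (star_word w) = cnj (fock w)"
proof -
  have S: "wf_stack (snd p)" if "p \<in> set (vec_from w (\<one>, []))" for p
    using vec_from_wf[OF assms wf_stack_one, of "fst p" "snd p"] that by simp
  have herm: "stack_ker S (\<one>, []) = cnj (stack_ker (\<one>, []) S)" if "wf_stack S" for S :: "('a, 'b) stack"
  proof -
    have "gram {S, (\<one>, [])} stack_ker" using that by (intro gram_stack_ker) auto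
    then obtain vs where "\<forall>i\<in>{S, (\<one>, [])}. \<forall>j\<in>{S, (\<one>, [])}. stack_ker i j = (\<Sum>v\<leftarrow>vs. cnj (v i) * v j)"
      by (auto simp: gram_def)
    then have "stack_ker S (\<one>, []) = (\<Sum>v\<leftarrow>vs. cnj (v S) * v (\<one>, []))"
      "stack_ker (\<one>, []) S = (\<Sum>v\<leftarrow>vs. cnj (v (\<one>, [])) * v S)" by blast+
    moreover have "cnj (\<Sum>v\<leftarrow>vs. cnj (v (\<one>, [])) * v S) = (\<Sum>v\<leftarrow>vs. cnj (v S) * v (\<one>, []))"
      by (induction vs) (simp_all add: mult.commute)
    ultimately show ?thesis by simp
  qed
  have cnj_sum: "cnj (\<Sum>x\<leftarrow>L. f x) = (\<Sum>x\<leftarrow>L. cnj (f x))" for L :: "(complex \<times> ('a, 'b) stack) list" and f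
    by (induction L) simp_all
  have "fock (star_word w) = (\<Sum>p\<leftarrow>vec_from w (\<one>, []). cnj (fst p) * stack_ker (snd p) (\<one>, []))"
    unfolding fock_def using fold_left_op_star_word[OF assms wf_stack_one] by (simp add: case_prod_unfold)
  also have "\<dots> = (\<Sum>p\<leftarrow>vec_from w (\<one>, []). cnj (fst p * vac (snd p)))"
    using S by (intro arg_cong[where f = sum_list] map_cong refl) (simp only: herm vac_eq_stack_ker complex_cnj_mult)
  also have "\<dots> = cnj (fock w)"
    by (simp add: cnj_sum fock_def fold_left_op_vec case_prod_unfold)
  finally show ?thesis .
qed

end

section \<open>Freeness over a subalgebra\<close>

text \<open>The last assumption is a form of faithfulness on \<open>D\<close>: what is invisible to
  \<open>D\<close> inside \<open>D\<close> is invisible to the whole algebra. Linear combinations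
  are kept as lists, since \<open>D\<close> is only assumed to be closed under
  multiplication.\<close>

locale amalg = tracial_star_prob_space A
  for A :: "('a, 'm) star_prob_space_scheme" (structure) +
  fixes D :: "'a set"
  assumes D_carrier: "D \<subseteq> carrier A" and D_one: "\<one> \<in> D"
    and D_mult: "\<lbrakk>x \<in> D; y \<in> D\<rbrakk> \<Longrightarrow> x \<otimes> y \<in> D"
    and D_nondegenerate: "\<lbrakk>\<And>a x. (a, x) \<in> set L \<Longrightarrow> x \<in> D;
      \<And>e. e \<in> D \<Longrightarrow> (\<Sum>(a, x)\<leftarrow>L. a * state A (e \<otimes> x)) = 0; y \<in> carrier A\<rbrakk>
      \<Longrightarrow> (\<Sum>(a, x)\<leftarrow>L. a * state A (y \<otimes> x)) = 0"
begin

definition comb_op ::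
    "(complex \<times> ('a, 'g) letter list) list \<Rightarrow> (('a, 'g) stack \<Rightarrow> complex) \<Rightarrow> ('a, 'g) stack \<Rightarrow> complex" where
  "comb_op X h S = (\<Sum>(a, w)\<leftarrow>X. a * fold left_op w h S)"

definition comb_mult ::
    "(complex \<times> ('a, 'g) letter list) list \<Rightarrow> (complex \<times> ('a, 'g) letter list) list \<Rightarrow>
     (complex \<times> ('a, 'g) letter list) list" where
  "comb_mult X Y = concat (map (\<lambda>(a, u). map (\<lambda>(b, v). (a * b, u @ v)) Y) X)"

definition wf_comb :: "(complex \<times> ('a, 'g) letter list) list \<Rightarrow> bool" where
  "wf_comb X \<longleftrightarrow> (\<forall>(a, w)\<in>set X. list_all wf_letter w)"

lemma fold_left_op_sum_list:
  "fold left_op w (\<lambda>S. \<Sum>x\<leftarrow>L. f x * F x S) S = (\<Sum>x\<leftarrow>L. f x * fold left_op w (F x) S)"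
proof (induction w arbitrary: F)
  case (Cons l w)
  have "left_op l (\<lambda>S. \<Sum>x\<leftarrow>L. f x * F x S) = (\<lambda>S. \<Sum>x\<leftarrow>L. f x * left_op l (F x) S)"
    by (rule ext) (rule left_op_sum_list)
  then show ?case unfolding fold.simps o_apply by (simp only: Cons)
qed simp

text \<open>Functionals are acted upon contravariantly: in the product, the left factor is the one
  that meets \<open>h\<close>.\<close>

lemma comb_op_mult: "comb_op (comb_mult X Y) h S = comb_op Y (comb_op X h) S"
proof -
  have "comb_op Y (comb_op X h) S =
      (\<Sum>q\<leftarrow>Y. fst q * fold left_op (snd q) (\<lambda>S. \<Sum>p\<leftarrow>X. fst p * fold left_op (snd p) h S) S)"
    by (simp add: comb_op_def[abs_def] case_prod_unfold)
  also have "\<dots> = (\<Sum>q\<leftarrow>Y. \<Sum>p\<leftarrow>X. fst p * fst q * fold left_op (snd p @ snd q) h S)"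
    unfolding fold_left_op_sum_list by (simp add: sum_list_const_mult[symmetric] mult_ac)
  also have "\<dots> = (\<Sum>p\<leftarrow>X. \<Sum>q\<leftarrow>Y. fst p * fst q * fold left_op (snd p @ snd q) h S)"
    by (rule sum_list_swap)
  also have "\<dots> = comb_op (comb_mult X Y) h S"
    by (simp add: comb_op_def comb_mult_def sum_list_concat_map comp_def case_prod_unfold)
  finally show ?thesis by simp
qed

lemma comb_mult_wf: "wf_comb X \<Longrightarrow> wf_comb Y \<Longrightarrow> wf_comb (comb_mult X Y)"
  by (fastforce simp: wf_comb_def comb_mult_def)

lemma comb_op_head_null:
  assumes X: "wf_comb X" and xs: "\<And>x. x \<in> set xs \<Longrightarrow> snd x \<in> carrier A"
    and L: "\<And>a x. (a, x) \<in> set L \<Longrightarrow> x \<in> carrier A"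
    and null: "\<And>y. y \<in> carrier A \<Longrightarrow> (\<Sum>(a, x)\<leftarrow>L. a * state A (y \<otimes> x)) = 0"
  shows "(\<Sum>(a, x)\<leftarrow>L. a * comb_op X vac (x, xs)) = 0"
proof -
  have "(\<Sum>p\<leftarrow>L. fst p * comb_op X vac (snd p, xs)) =
      (\<Sum>p\<leftarrow>L. \<Sum>q\<leftarrow>X. fst q * (fst p * fold left_op (snd q) vac (snd p, xs)))"
    by (simp add: comb_op_def case_prod_unfold sum_list_const_mult[symmetric] mult_ac)
  also have "\<dots> = (\<Sum>q\<leftarrow>X. \<Sum>p\<leftarrow>L. fst q * (fst p * fold left_op (snd q) vac (snd p, xs)))"
    by (rule sum_list_swap)
  also have "\<dots> = (\<Sum>q\<leftarrow>X. fst q * (\<Sum>(a, x)\<leftarrow>L. a * fold left_op (snd q) vac (x, xs)))"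
    by (simp add: case_prod_unfold sum_list_const_mult)
  also have "\<dots> = (\<Sum>q\<leftarrow>X. 0)"
  proof (intro arg_cong[where f = sum_list] map_cong refl)
    fix q assume "q \<in> set X"
    then have "list_all wf_letter (snd q)" using X by (auto simp: wf_comb_def)
    from fold_left_op_head_null[OF this xs L null]
    show "fst q * (\<Sum>(a, x)\<leftarrow>L. a * fold left_op (snd q) vac (x, xs)) = 0" by simp
  qed
  finally show ?thesis by (simp add: case_prod_unfold)
qed

text \<open>Constants, unlike stacks, can be added in \<open>A\<close>. A formal combination of them
  may thus be traded for a single element with the same inner products.\<close>

lemma ex_linear_comb:
  assumes "\<And>a x. (a, x) \<in> set L \<Longrightarrow> x \<in> carrier A"
  shows "\<exists>e\<in>carrier A. \<forall>y\<in>carrier A. state A (y \<otimes> e) = (\<Sum>(a, x)\<leftarrow>L. a * state A (y \<otimes> x))"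
  using assms
proof (induction L)
  case Nil
  then show ?case by (intro bexI[of _ \<zero>]) (auto simp: times_zero state_zero zero_in)
next
  case (Cons p L)
  obtain a x where p: "p = (a, x)" by (cases p)
  then have x: "x \<in> carrier A" using Cons.prems by auto
  obtain e where e: "e \<in> carrier A" "\<forall>y\<in>carrier A. state A (y \<otimes> e) = (\<Sum>(a, x)\<leftarrow>L. a * state A (y \<otimes> x))"
    using Cons by auto
  show ?case using x e
    by (intro bexI[of _ "a \<odot> x \<oplus> e"])
      (auto simp: p times_add_right smult_mult_right state_add state_smult alg_closed)
qed

text \<open>\<open>None\<close> stands for the algebra of the constants, \<open>Some g\<close> for the algebra generated by
  the generator \<open>g\<close> and \<open>D\<close>.\<close>

fun type_stack :: "'g option \<Rightarrow> ('a, 'g) stack \<Rightarrow> bool" where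
  "type_stack None S \<longleftrightarrow> wf_stack S \<and> (\<forall>e\<in>D. state A (e \<otimes> fst S) = 0)"
| "type_stack (Some g) S \<longleftrightarrow> wf_stack S \<and> fst S \<in> D \<and> snd S \<noteq> [] \<and> fst (fst (hd (snd S))) = g"

fun type_letter :: "'g option \<Rightarrow> ('a, 'g) letter \<Rightarrow> bool" where
  "type_letter None (Const b) \<longleftrightarrow> b \<in> carrier A"
| "type_letter None (Gen g s) \<longleftrightarrow> False"
| "type_letter (Some h) (Const b) \<longleftrightarrow> b \<in> D"
| "type_letter (Some h) (Gen g s) \<longleftrightarrow> g = h"

lemma type_letter_wf: "type_letter t l \<Longrightarrow> wf_letter l"
  using D_carrier by (cases "(t, l)" rule: type_letter.cases) auto

text \<open>Vanishing of the conditional expectation onto \<open>D\<close>, expressed by the state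
  alone: the locale provides no expectation.\<close>

definition centered :: "(complex \<times> ('a, 'g) letter list) list \<Rightarrow> bool" where
  "centered X \<longleftrightarrow> (\<forall>e\<in>D. (\<Sum>(a, w)\<leftarrow>X. a * fock (Const e # w)) = 0)"

definition type_comb :: "'g option \<Rightarrow> (complex \<times> ('a, 'g) letter list) list \<Rightarrow> bool" where
  "type_comb t X \<longleftrightarrow> (\<forall>(a, w)\<in>set X. list_all (type_letter t) w)"

lemma type_comb_wf: "type_comb t X \<Longrightarrow> wf_comb X"
  using type_letter_wf by (fastforce simp: type_comb_def wf_comb_def list_all_iff)

lemma foldr_times:
  assumes "set bs \<subseteq> carrier A" "c \<in> carrier A"
  shows "foldr (\<otimes>) bs c = foldr (\<otimes>) bs \<one> \<otimes> c" "foldr (\<otimes>) bs \<one> \<in> carrier A"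
proof -
  show cl: "foldr (\<otimes>) bs \<one> \<in> carrier A"
    using assms(1) by (induction bs) (auto simp: alg_closed)
  show "foldr (\<otimes>) bs c = foldr (\<otimes>) bs \<one> \<otimes> c"
    using assms
  proof (induction bs)
    case (Cons b bs)
    have "foldr (\<otimes>) bs \<one> \<in> carrier A"
      using Cons.prems(1) by (induction bs) (auto simp: alg_closed)
    then show ?case using Cons by (simp add: times_assoc)
  qed (simp add: times_one)
qed

text \<open>All words of \<open>X\<close> consist of constants, so applying \<open>X\<close> changes
  only the top constant \<open>c\<close>. The resulting combination of tops is as good as one
  element \<open>e\<close>, and centeredness makes \<open>e\<close> orthogonal to \<open>D\<close>,
  so that \<open>(e, us)\<close> is a stack of type \<open>None\<close>, where \<open>P\<close>
  vanishes.\<close>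

lemma comb_op_None:
  fixes X P :: "(complex \<times> ('a, 'g) letter list) list"
  assumes P: "wf_comb P" and van: "\<And>S. type_stack None S \<Longrightarrow> comb_op P vac S = 0"
    and X: "type_comb None X" "centered X"
    and S: "wf_stack (c, us)" "c \<in> D"
  shows "comb_op X (comb_op P vac) (c, us) = 0"
proof -
  have c: "c \<in> carrier A" using S D_carrier by auto
  have us: "\<And>x. x \<in> set us \<Longrightarrow> snd x \<in> carrier A" using S by (auto simp: wf_stack_def)
  \<comment> \<open>Reads the constants off a word. The value at a generator is a placeholder, as
    words of type \<open>None\<close> contain no generators.\<close>
  define B where "B = map (\<lambda>l. case l of Const b \<Rightarrow> b | Gen (g :: 'g) s \<Rightarrow> \<one>)"
  have B: "w = map Const (B w) \<and> set (B w) \<subseteq> carrier A" if "(a, w) \<in> set X" for a w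
  proof -
    have "list_all (type_letter None) w" using X(1) that by (auto simp: type_comb_def)
    then show ?thesis
    proof (induction w)
      case (Cons l w)
      then show ?case by (cases l) (simp_all add: B_def)
    qed (simp add: B_def)
  qed
  define b where "b w = foldr (\<otimes>) (B w) \<one>" for w
  have b: "b w \<in> carrier A" if "(a, w) \<in> set X" for a w
    using B[OF that] foldr_times(2)[of "B w", OF _ unit_closed] by (simp add: b_def)
  define L where "L = map (\<lambda>(a, w). (a, b w \<otimes> c)) X"
  have L: "x \<in> carrier A" if "(a, x) \<in> set L" for a x
    using that b c by (auto simp: L_def times_closed)
  obtain e where e: "e \<in> carrier A"
    "\<And>y. y \<in> carrier A \<Longrightarrow> state A (y \<otimes> e) = (\<Sum>(a, x)\<leftarrow>L. a * state A (y \<otimes> x))"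
    using ex_linear_comb[of L] L by blast
  have "comb_op X (comb_op P vac) (c, us) = (\<Sum>(a, x)\<leftarrow>L. a * comb_op P vac (x, us))"
  proof -
    have *: "fold left_op w (comb_op P vac) (c, us) = comb_op P vac (b w \<otimes> c, us)"
      if "(a, w) \<in> set X" for a w
      using fold_left_op_Const[of "B w" "comb_op P vac" c us] B[OF that] foldr_times(1)[of "B w" c] c
      by (simp add: b_def)
    show ?thesis unfolding comb_op_def[of X] L_def map_map
    proof (intro arg_cong[where f = sum_list] map_cong refl)
      fix p assume "p \<in> set X"
      then show "(case p of (a, w) \<Rightarrow> a * fold left_op w (comb_op P vac) (c, us)) =
          ((\<lambda>(a, x). a * comb_op P vac (x, us)) \<circ> (\<lambda>(a, w). (a, b w \<otimes> c))) p"
        using *[of "fst p" "snd p"] by (simp add: case_prod_unfold)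
    qed
  qed
  also have "\<dots> = comb_op P vac (e, us)"
  proof -
    \<comment> \<open>Equality of the two values is phrased as the vanishing of one combination,
      with coefficient -1 at \<open>e\<close>, to match \<open>comb_op_head_null\<close>.\<close>
    have "(\<Sum>(a, x)\<leftarrow>(- 1, e) # L. a * comb_op P vac (x, us)) = 0"
    proof (rule comb_op_head_null[OF P us])
      show "x \<in> carrier A" if "(a, x) \<in> set ((- 1, e) # L)" for a x
        using that L e(1) by auto
      show "(\<Sum>(a, x)\<leftarrow>(- 1, e) # L. a * state A (y \<otimes> x)) = 0" if "y \<in> carrier A" for y
        using e(2)[OF that] by simp
    qed
    then show ?thesis by simp
  qed
  also have "\<dots> = 0"
  proof (rule van)
    have "state A (y \<otimes> e) = 0" if y: "y \<in> D" for y
    proof -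
      have yc: "y \<in> carrier A" using y D_carrier by auto
      \<comment> \<open>The trace property brings \<open>c\<close> in front of \<open>y\<close>, and
        \<open>c \<otimes> y\<close> is again an element of \<open>D\<close>, against which
        \<open>X\<close> is centered.\<close>
      have "state A (y \<otimes> (b w \<otimes> c)) = fock (Const (c \<otimes> y) # w)" if "(a, w) \<in> set X" for a w
      proof -
        have "Const (c \<otimes> y) # w = map Const ((c \<otimes> y) # B w)"
          using B[OF that] by simp
        then have "fock (Const (c \<otimes> y) # w) = fock (map Const ((c \<otimes> y) # B w) :: ('a, 'g) letter list)"
          by (simp only:)
        also have "\<dots> = state A (c \<otimes> y \<otimes> b w)"
          by (simp only: fock_Const b_def foldr_Cons o_apply)
        also have "\<dots> = state A (c \<otimes> (y \<otimes> b w))"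
          using c yc b[OF that] by (simp add: times_assoc)
        also have "\<dots> = state A (y \<otimes> b w \<otimes> c)"
          using c yc b[OF that] by (simp add: state_trace times_closed)
        also have "\<dots> = state A (y \<otimes> (b w \<otimes> c))"
          using c yc b[OF that] by (simp add: times_assoc)
        finally show ?thesis ..
      qed
      then have "(\<Sum>(a, x)\<leftarrow>L. a * state A (y \<otimes> x)) = (\<Sum>(a, w)\<leftarrow>X. a * fock (Const (c \<otimes> y) # w))"
        unfolding L_def map_map by (intro arg_cong[where f = sum_list] map_cong refl) auto
      also have "\<dots> = 0" using X(2) D_mult[OF S(2) y] by (auto simp: centered_def)
      finally show ?thesis using e(2)[OF yc] by simp
    qed
    then show "type_stack None (e, us)" using e(1) S(1) by (auto simp: wf_stack_def)
  qed
  finally show ?thesis .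
qed

text \<open>Concatenation of stacks, with the two constants at the seam multiplied. It allows the
  action of an algebra on a stack to be computed on the vacuum instead.\<close>

fun glue :: "('a, 'g) stack \<Rightarrow> ('a, 'g) stack \<Rightarrow> ('a, 'g) stack" where
  "glue (b, []) S = (b \<otimes> fst S, snd S)"
| "glue (b, (m, e) # xs) S = (b, (m, fst (glue (e, xs) S)) # snd (glue (e, xs) S))"

text \<open>The shape of the stacks that words in \<open>g\<close> and \<open>D\<close> produce from
  the vacuum.\<close>

definition D_stack :: "'g \<Rightarrow> ('a, 'g) stack \<Rightarrow> bool" where
  "D_stack g S \<longleftrightarrow> fst S \<in> D \<and> (\<forall>x\<in>set (snd S). snd x \<in> D \<and> fst (fst x) = g)"

text \<open>The three ways in which a stack can fail to contract with the generator
  \<open>g\<close>: there is no marker, the top marker belongs to another generator, or the weight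
  of the contraction across the top constant is zero even after multiplication by an element of
  \<open>D\<close>.\<close>

definition inert :: "'g \<Rightarrow> ('a, 'g) stack \<Rightarrow> bool" where
  "inert g S \<longleftrightarrow> wf_stack S \<and>
    (snd S = [] \<or> fst (fst (hd (snd S))) \<noteq> g \<or> (\<forall>e\<in>D. state A (e \<otimes> fst S) = 0))"

lemma glue_wf: "wf_stack T \<Longrightarrow> wf_stack S \<Longrightarrow> wf_stack (glue T S)"
proof (induction T S rule: glue.induct)
  case (1 b S)
  then have "b \<otimes> fst S \<in> carrier A" by (intro times_closed) (simp_all add: wf_stack_def)
  then show ?case using 1(2) by (simp add: wf_stack_def)
next
  case (2 b m e xs S)
  then show ?case by simp
qed

lemma D_stack_wf: "D_stack g S \<Longrightarrow> wf_stack S"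
  using D_carrier by (auto simp: D_stack_def wf_stack_def)

lemma D_stack_left_act:
  assumes "type_letter (Some g) l" "D_stack g S" "(a, T) \<in> set (left_act l S)"
  shows "D_stack g T"
  using assms D_one D_mult
  by (cases "(l, S)" rule: left_act.cases) (auto simp: D_stack_def split: if_splits)

text \<open>The two sides could differ only by a contraction across the seam. Its weight is
  \<open>state A (b \<otimes> c)\<close> with \<open>b\<close> in \<open>D\<close>, and inertness of
  \<open>S\<close> excludes the marker or annihilates this weight.\<close>

lemma left_op_glue:
  assumes l: "type_letter (Some g) l" and T: "D_stack g T" and S: "inert g S"
  shows "left_op l h (glue T S) = left_op l (\<lambda>T. h (glue T S)) T"
proof -
  obtain b xs where T_eq: "T = (b, xs)" by (cases T)
  obtain c us where S_eq: "S = (c, us)" by (cases S)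
  have bc: "b \<in> carrier A" "c \<in> carrier A" and b: "b \<in> D"
    using T S D_carrier by (auto simp: D_stack_def inert_def T_eq S_eq wf_stack_def)
  show ?thesis
  proof (cases l)
    case (Const d)
    then have "d \<in> carrier A" using l D_carrier by auto
    then show ?thesis using bc
      by (cases xs) (auto simp: Const T_eq S_eq left_op_Const times_assoc)
  next
    case (Gen g' s)
    then have g': "g' = g" using l by simp
    show ?thesis
    proof (cases xs)
      case (Cons x ys)
      obtain m e where x: "x = (m, e)" by (cases x)
      show ?thesis unfolding Gen T_eq Cons x glue.simps left_op_Gen by simp
    next
      case Nil
      show ?thesis
      proof (cases us)
        case us: Nil
        then show ?thesis by (simp add: Gen T_eq S_eq Nil left_op_Gen)
      next
        case us: (Cons y vs)
        obtain m e where y: "y = (m, e)" by (cases y)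
        have "(if m = (g, \<not> s) then state A (b \<otimes> c) else 0) = 0"
          using S b by (auto simp: inert_def S_eq us y)
        then show ?thesis by (simp add: Gen g' T_eq S_eq Nil us y left_op_Gen)
      qed
    qed
  qed
qed

lemma fold_left_op_cong_D_stack:
  assumes "list_all (type_letter (Some g)) w" "D_stack g T" "\<And>T. D_stack g T \<Longrightarrow> f T = f' T"
  shows "fold left_op w f T = fold left_op w f' T"
  using assms
proof (induction w arbitrary: f f' T)
  case (Cons l w)
  have eq: "left_op l f T = left_op l f' T" if "D_stack g T" for T
    unfolding left_op_def
  proof (intro arg_cong[where f = sum_list] map_cong refl)
    fix p assume p: "p \<in> set (left_act l T)"
    have "D_stack g (snd p)"
      using D_stack_left_act[of g l T "fst p" "snd p"] that p Cons.prems(1) by simp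
    then show "(case p of (a, T) \<Rightarrow> a * f T) = (case p of (a, T) \<Rightarrow> a * f' T)"
      using Cons.prems(3) by (simp add: case_prod_unfold)
  qed
  have "fold left_op w (left_op l f) T = fold left_op w (left_op l f') T"
    by (rule Cons.IH) (use Cons.prems(1,2) eq in auto)
  then show ?case by simp
qed (simp only: fold.simps id_apply)

lemma fold_left_op_glue:
  assumes "list_all (type_letter (Some g)) w" "D_stack g T" "inert g S"
  shows "fold left_op w h (glue T S) = fold left_op w (\<lambda>T. h (glue T S)) T"
  using assms(1,2)
proof (induction w arbitrary: h T)
  case (Cons l w)
  have "fold left_op (l # w) h (glue T S) = fold left_op w (\<lambda>T. left_op l h (glue T S)) T"
    unfolding fold.simps o_apply by (rule Cons.IH) (use Cons.prems in simp_all)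
  also have "\<dots> = fold left_op w (left_op l (\<lambda>T. h (glue T S))) T"
  proof (rule fold_left_op_cong_D_stack)
    show "left_op l h (glue T S) = left_op l (\<lambda>T. h (glue T S)) T" if "D_stack g T" for T
      using Cons.prems(1) that by (intro left_op_glue[OF _ _ assms(3)]) auto
  qed (use Cons.prems in auto)
  finally show ?case by (simp only: fold.simps o_apply)
qed (simp only: fold.simps id_apply)

lemma vec_from_D_stack:
  assumes "list_all (type_letter (Some g)) w" "(a, T) \<in> set (vec_from w (\<one>, []))"
  shows "D_stack g T"
  using assms
proof (induction w arbitrary: a T)
  case Nil
  then show ?case by (simp add: D_stack_def D_one)
next
  case (Cons l w)
  obtain b U c where "(b, U) \<in> set (vec_from w (\<one>, []))" "(c, T) \<in> set (left_act l U)"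
    using Cons.prems(2) by auto
  then show ?case using Cons.IH[of b U] Cons.prems(1) D_stack_left_act[of g l U c T] by simp
qed

text \<open>\<open>X\<close> is applied to the vacuum and the result \<open>Z\<close> glued onto the
  inert stack. The members of \<open>Z\<close> with a marker become stacks of type
  \<open>Some g\<close>, where \<open>P\<close> vanishes. The others carry only a constant in
  \<open>D\<close>; by centeredness and nondegeneracy their combination is null.\<close>

lemma comb_op_Some:
  assumes P: "wf_comb P" and van: "\<And>S. type_stack (Some g) S \<Longrightarrow> comb_op P vac S = 0"
    and X: "type_comb (Some g) X" "centered X" and S: "inert g (c, us)"
  shows "comb_op X (comb_op P vac) (c, us) = 0"
proof -
  have c: "c \<in> carrier A" and us: "\<And>x. x \<in> set us \<Longrightarrow> snd x \<in> carrier A"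
    using S by (auto simp: inert_def wf_stack_def)
  define Z where "Z = concat (map (\<lambda>(a, w). map (\<lambda>(b, T). (a * b, T)) (vec_from w (\<one>, []))) X)"
  have tl: "list_all (type_letter (Some g)) w" if "(a, w) \<in> set X" for a w
    using X(1) that by (auto simp: type_comb_def)
  have Z_op: "comb_op X f (\<one>, []) = (\<Sum>(a, T)\<leftarrow>Z. a * f T)" for f
    by (simp add: comb_op_def Z_def fold_left_op_vec sum_list_concat_map comp_def case_prod_unfold
        sum_list_const_mult[symmetric] mult.assoc)
  have Z_D: "D_stack g T" if "(a, T) \<in> set Z" for a T
    using that tl vec_from_D_stack[of g] by (fastforce simp: Z_def)
  let ?h = "comb_op P vac"
  let ?L = "map (\<lambda>(a, T). (a, fst T)) (filter (\<lambda>(a, T). snd T = []) Z)"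
  \<comment> \<open>Testing with \<open>Const e\<close> singles out the stacks of \<open>Z\<close>
    without markers, because the vacuum functional is zero on all others.\<close>
  have null: "(\<Sum>(a, x)\<leftarrow>?L. a * state A (y \<otimes> x)) = 0" if "y \<in> carrier A" for y
  proof (rule D_nondegenerate[OF _ _ that])
    show "x \<in> D" if "(a, x) \<in> set ?L" for a x
      using that Z_D by (auto simp: D_stack_def)
    show "(\<Sum>(a, x)\<leftarrow>?L. a * state A (e \<otimes> x)) = 0" if "e \<in> D" for e
    proof -
      have "(\<Sum>(a, x)\<leftarrow>?L. a * state A (e \<otimes> x)) = (\<Sum>(a, T)\<leftarrow>Z. a * left_op (Const e) vac T)"
      proof (induction Z)
        case (Cons p Z)
        obtain a b xs where p: "p = (a, (b, xs))" by (metis surj_pair)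
        show ?case using Cons by (cases xs) (auto simp: p left_op_Const)
      qed simp
      also have "\<dots> = (\<Sum>(a, w)\<leftarrow>X. a * fock (Const e # w))"
        unfolding Z_op[symmetric] by (simp add: comb_op_def fock_def)
      finally show ?thesis using X(2) that by (auto simp: centered_def)
    qed
  qed
  have "comb_op X ?h (c, us) = comb_op X (\<lambda>T. ?h (glue T (c, us))) (\<one>, [])"
    unfolding comb_op_def[of X]
  proof (intro arg_cong[where f = sum_list] map_cong refl)
    fix p assume p: "p \<in> set X"
    obtain a w where p_eq: "p = (a, w)" by (cases p)
    have "fold left_op w ?h (glue (\<one>, []) (c, us)) = fold left_op w (\<lambda>T. ?h (glue T (c, us))) (\<one>, [])"
      using tl p S by (intro fold_left_op_glue) (auto simp: p_eq D_stack_def D_one)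
    then show "(case p of (a, w) \<Rightarrow> a * fold left_op w ?h (c, us)) =
        (case p of (a, w) \<Rightarrow> a * fold left_op w (\<lambda>T. ?h (glue T (c, us))) (\<one>, []))"
      using c by (simp add: p_eq times_one)
  qed
  also have "\<dots> = (\<Sum>(a, T)\<leftarrow>Z. a * ?h (glue T (c, us)))" by (rule Z_op)
  also have "\<dots> = (\<Sum>(a, x)\<leftarrow>map (\<lambda>(a, x). (a, x \<otimes> c)) ?L. a * ?h (x, us))"
    using Z_D
  proof (induction Z)
    case (Cons p Z)
    obtain a b xs where p: "p = (a, (b, xs))" by (metis surj_pair)
    have T: "D_stack g (b, xs)" using Cons.prems[of a "(b, xs)"] by (simp add: p)
    have "D_stack g T" if "(a, T) \<in> set Z" for a T
      using Cons.prems[of a T] that by simp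
    note IH = Cons.IH[OF this]
    show ?case
    proof (cases xs)
      case Nil
      then show ?thesis using IH by (simp add: p)
    next
      case xs: (Cons x ys)
      obtain m e where x: "x = (m, e)" by (cases x)
      have "wf_stack (glue (b, xs) (c, us))"
        using D_stack_wf[OF T] S by (intro glue_wf) (auto simp: inert_def)
      then have "type_stack (Some g) (glue (b, xs) (c, us))"
        using T by (simp add: xs x D_stack_def)
      then have "?h (glue (b, xs) (c, us)) = 0" by (rule van)
      then show ?thesis using IH by (simp add: p xs)
    qed
  qed simp
  also have "\<dots> = 0"
  proof (rule comb_op_head_null[OF P us])
    have L: "x \<in> carrier A" if "(a, x) \<in> set ?L" for a x
      using that Z_D D_carrier by (auto simp: D_stack_def)
    have Zc: "b \<in> carrier A" if "(a, b, xs) \<in> set Z" for a b xs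
      using Z_D[OF that] D_carrier by (auto simp: D_stack_def)
    show "x \<in> carrier A" if "(a, x) \<in> set (map (\<lambda>(a, x). (a, x \<otimes> c)) ?L)" for a x
      using that c Zc by (auto intro!: times_closed)
    show "(\<Sum>(a, x)\<leftarrow>map (\<lambda>(a, x). (a, x \<otimes> c)) ?L. a * state A (y \<otimes> x)) = 0" if y: "y \<in> carrier A" for y
    proof -
      \<comment> \<open>The top constant \<open>c\<close> of the given stack is absorbed into the
        test element by the trace property; this is why nullity against all of \<open>A\<close>, and
        not only against \<open>D\<close>, is required.\<close>
      have "state A (y \<otimes> (x \<otimes> c)) = state A (c \<otimes> y \<otimes> x)" if "x \<in> carrier A" for x
      proof -
        have "state A (y \<otimes> (x \<otimes> c)) = state A ((y \<otimes> x) \<otimes> c)" using that c y by (simp add: times_assoc)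
        also have "\<dots> = state A (c \<otimes> (y \<otimes> x))" using that c y by (intro state_trace) (simp_all add: times_closed)
        finally show ?thesis using that c y by (simp add: times_assoc)
      qed
      then have swap: "state A (y \<otimes> (snd p \<otimes> c)) = state A (c \<otimes> y \<otimes> snd p)" if "p \<in> set ?L" for p
        using L[of "fst p" "snd p"] that by simp
      have "(\<Sum>(a, x)\<leftarrow>map (\<lambda>(a, x). (a, x \<otimes> c)) ?L. a * state A (y \<otimes> x)) =
          (\<Sum>p\<leftarrow>?L. fst p * state A (y \<otimes> (snd p \<otimes> c)))"
        unfolding map_map[of _ _ ?L] by (simp add: comp_def case_prod_unfold)
      also have "\<dots> = (\<Sum>(a, x)\<leftarrow>?L. a * state A ((c \<otimes> y) \<otimes> x))"
        by (intro arg_cong[where f = sum_list] map_cong refl) (simp only: swap case_prod_unfold)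
      finally have "(\<Sum>(a, x)\<leftarrow>map (\<lambda>(a, x). (a, x \<otimes> c)) ?L. a * state A (y \<otimes> x)) =
          (\<Sum>(a, x)\<leftarrow>?L. a * state A ((c \<otimes> y) \<otimes> x))" .
      then show ?thesis using null[of "c \<otimes> y"] c y by (simp add: times_closed)
    qed
  qed
  finally show ?thesis .
qed

text \<open>The vacuum and the stacks of other types satisfy what the two preceding results ask of a
  stack. For \<open>t = None\<close> their top constant lies in \<open>D\<close>; for
  \<open>t = Some g\<close> they are inert, either through a different top marker or through a top
  constant orthogonal to \<open>D\<close>.\<close>

lemma comb_op_type:
  assumes P: "wf_comb P" and van: "\<And>S. type_stack t S \<Longrightarrow> comb_op P vac S = 0"
    and X: "type_comb t X" "centered X"
  shows "comb_op X (comb_op P vac) (\<one>, []) = 0"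
    and "\<And>S t'. t' \<noteq> t \<Longrightarrow> type_stack t' S \<Longrightarrow> comb_op X (comb_op P vac) S = 0"
proof -
  show "comb_op X (comb_op P vac) (\<one>, []) = 0"
  proof (cases t)
    case None
    then show ?thesis using comb_op_None[OF P _ _ X(2), of \<one> "[]"] van X(1) D_one
      by (simp add: unit_closed)
  next
    case (Some g)
    then show ?thesis using comb_op_Some[OF P _ _ X(2), of g \<one> "[]"] van X(1)
      by (simp add: unit_closed inert_def)
  qed
  fix S t' assume t': "t' \<noteq> t" "type_stack t' S"
  obtain c us where S: "S = (c, us)" by (cases S)
  show "comb_op X (comb_op P vac) S = 0"
  proof (cases t)
    case None
    then have "wf_stack (c, us)" "c \<in> D" using t' S by (cases t'; simp)+
    then show ?thesis unfolding S using comb_op_None[OF P _ _ X(2), of c us] van X(1) None by blast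
  next
    case (Some g)
    then have "inert g (c, us)" using t' S by (cases t') (auto simp: inert_def)
    then show ?thesis unfolding S using comb_op_Some[OF P _ _ X(2), of g c us] van X(1) Some by blast
  qed
qed

text \<open>Factors are appended on the right, next to the vacuum vector. The invariant is that the
  functional built so far vanishes on all stacks whose type differs from that of the last factor; as
  consecutive types differ, it vanishes on the type of the next one. The leading
  \<open>Const e\<close> tests the product against \<open>D\<close>.\<close>

theorem fock_free:
  assumes "Xs \<noteq> []" "distinct_adj (map fst Xs)" "\<And>t X. (t, X) \<in> set Xs \<Longrightarrow> type_comb t X \<and> centered X"
    and "e \<in> D"
  shows "comb_op (foldl comb_mult [(1, [Const e])] (map snd Xs)) vac (\<one>, []) = 0"
proof -
  let ?P = "\<lambda>Xs. foldl comb_mult [(1, [Const e])] (map snd Xs)"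
  have e: "e \<in> carrier A" using assms(4) D_carrier by auto
  have *: "wf_comb (?P Xs) \<and> (\<forall>t S. (Xs = [] \<or> t \<noteq> fst (last Xs)) \<longrightarrow> type_stack t S \<longrightarrow> comb_op (?P Xs) vac S = 0) \<and>
      (Xs \<noteq> [] \<longrightarrow> comb_op (?P Xs) vac (\<one>, []) = 0)"
    using assms(2,3)
  proof (induction Xs rule: rev_induct)
    case Nil
    have "left_op (Const e) vac S = 0" if "type_stack t S" for t S
      using that assms(4) by (cases t; cases S rule: vac.cases) (auto simp: left_op_Const)
    then show ?case using e by (auto simp: wf_comb_def comb_op_def)
  next
    case (snoc q Xs)
    obtain t X where q: "q = (t, X)" by (cases q)
    have X: "type_comb t X" "centered X" using snoc.prems(2)[of t X] q by auto
    have adj: "distinct_adj (map fst Xs)" "Xs = [] \<or> t \<noteq> fst (last Xs)"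
      using snoc.prems(1) by (auto simp: q distinct_adj_append_iff last_map)
    have IH: "wf_comb (?P Xs)" "\<And>S. type_stack t S \<Longrightarrow> comb_op (?P Xs) vac S = 0"
      using snoc.IH[OF adj(1)] snoc.prems(2) adj(2) by auto
    have "comb_op (?P (Xs @ [q])) vac = comb_op X (comb_op (?P Xs) vac)"
      by (rule ext) (simp add: q comb_op_mult)
    then show ?case
      using comb_op_type[OF IH X] comb_mult_wf[OF IH(1) type_comb_wf[OF X(1)]] by (simp add: q)
  qed
  then show ?thesis using assms(1) by blast
qed

end

section \<open>The diagonal algebra\<close>

context diag_prob_space
begin

lemma proj_comb_closed: "(\<Oplus>k\<in>{..<d}. c k \<odot> p k) \<in> carrier A"
  using linear_comb_closed[of "{..<d}" p c] proj_closed by auto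

lemma diag_elem_closed: "diag_elem A d p c \<in> carrier A"
  unfolding diag_elem_def by (rule proj_comb_closed)

lemma state_times_diag_elem:
  "y \<in> carrier A \<Longrightarrow> state A (y \<otimes> diag_elem A d p c) = (\<Sum>k<d. c k * state A (y \<otimes> p k))"
  unfolding diag_elem_def using proj_closed by (intro state_times_linear_comb) auto

lemma proj_times_diag_elem:
  assumes "l < d"
  shows "p l \<otimes> diag_elem A d p c = c l \<odot> p l"
proof -
  have "p l \<otimes> diag_elem A d p c = (\<Oplus>k\<in>{..<d}. c k \<odot> (p l \<otimes> p k))"
    unfolding diag_elem_def using assms proj_closed by (intro times_linear_comb) auto
  also have "\<dots> = c l \<odot> (p l \<otimes> p l)"
    using assms proj_closed proj_orthogonal
    by (intro linear_comb_single) (auto simp: times_closed scale_zero)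
  finally show ?thesis using assms by (simp add: proj_idem)
qed

lemma diag_elem_cong: "(\<And>k. k < d \<Longrightarrow> c k = c' k) \<Longrightarrow> diag_elem A d p c = diag_elem A d p c'"
proof -
  assume *: "\<And>k. k < d \<Longrightarrow> c k = c' k"
  have "(\<Oplus>k\<in>I. c k \<odot> p k) = (\<Oplus>k\<in>I. c' k \<odot> p k)" if "finite I" "I \<subseteq> {..<d}" for I
    using that
  proof (induction I rule: finite_induct)
    case (insert i I)
    have cl: "p j \<in> carrier A" if "j \<in> insert i I" for j using insert.prems that proj_closed by auto
    have e: "(\<Oplus>k\<in>insert i I. c k \<odot> p k) = c i \<odot> p i \<oplus> (\<Oplus>k\<in>I. c k \<odot> p k)" for c
      by (rule linear_comb_insert[OF insert.hyps(1,2)]) (rule cl)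
    have "c i = c' i" using insert.prems * by auto
    then show ?case using insert by (simp add: e)
  qed (simp add: linear_comb_empty)
  then show ?thesis by (simp add: diag_elem_def)
qed

lemma diag_elem_mult: "diag_elem A d p c \<otimes> diag_elem A d p c' = diag_elem A d p (\<lambda>k. c k * c' k)"
proof -
  have "(\<Oplus>k\<in>I. c k \<odot> p k) \<otimes> diag_elem A d p c' = (\<Oplus>k\<in>I. (c k * c' k) \<odot> p k)"
    if "finite I" "I \<subseteq> {..<d}" for I
    using that
  proof (induction I rule: finite_induct)
    case empty
    then show ?case by (simp add: linear_comb_empty times_zero diag_elem_closed)
  next
    case (insert i I)
    have cl: "p j \<in> carrier A" if "j \<in> insert i I" for j using insert.prems that proj_closed by auto
    have i: "i < d" using insert.prems by auto
    have "(c i \<odot> p i) \<otimes> diag_elem A d p c' = (c i * c' i) \<odot> p i"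
      using smult_assoc1[of "c i" "c' i" "p i"] i
      by (simp add: smult_mult_left proj_closed diag_elem_closed proj_times_diag_elem class_ring_simps)
    then show ?case using insert cl
      by (simp add: linear_comb_insert[OF insert.hyps(1,2) cl] times_add_left linear_comb_closed
          alg_closed diag_elem_closed)
  qed
  from this[of "{..<d}"] show ?thesis by (simp add: diag_elem_def)
qed

lemma diag_elem_one: "diag_elem A d p (\<lambda>_. 1) = \<one>"
proof -
  have "(\<Oplus>k\<in>I. 1 \<odot> p k) = (\<Oplus>k\<in>I. p k)" if "finite I" "I \<subseteq> {..<d}" for I
    using that
  proof (induction I rule: finite_induct)
    case empty
    note am = abelian_group.axioms(1)[OF ring.is_abelian_group[OF ring_A]]
    show ?case by (simp add: linear_comb_empty abelian_monoid.finsum_empty[OF am])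
  next
    case (insert i I)
    note am = abelian_group.axioms(1)[OF ring.is_abelian_group[OF ring_A]]
    have cl: "p j \<in> carrier A" if "j \<in> insert i I" for j using insert.prems that proj_closed by auto
    have "(\<Oplus>k\<in>insert i I. p k) = p i \<oplus> (\<Oplus>k\<in>I. p k)"
      using cl by (intro abelian_monoid.finsum_insert[OF am insert.hyps]) auto
    moreover have "1 \<odot> p i = p i" using smult_one[of "p i"] cl by (simp add: class_ring_simps)
    moreover have "(\<Oplus>k\<in>insert i I. 1 \<odot> p k) = 1 \<odot> p i \<oplus> (\<Oplus>k\<in>I. 1 \<odot> p k)"
      by (rule linear_comb_insert[OF insert.hyps(1,2)]) (rule cl)
    ultimately show ?case using insert by simp
  qed
  from this[of "{..<d}"] show ?thesis by (simp add: diag_elem_def proj_sum)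
qed

lemma diag_elem_proj:
  assumes "l < d"
  shows "diag_elem A d p (\<lambda>k. if k = l then 1 else 0) = p l"
proof -
  have "diag_elem A d p (\<lambda>k. if k = l then 1 else 0) = (if l = l then 1 else 0) \<odot> p l"
    unfolding diag_elem_def using assms proj_closed by (intro linear_comb_single) (auto simp: scale_zero)
  then show ?thesis using smult_one[of "p l"] assms by (simp add: class_ring_simps proj_closed)
qed

lemma diag_elem_zero: "diag_elem A d p (\<lambda>_. 0) = \<zero>"
proof -
  have "(\<Oplus>k\<in>I. 0 \<odot> p k) = \<zero>" if "finite I" "I \<subseteq> {..<d}" for I
    using that
  proof (induction I rule: finite_induct)
    case (insert i I)
    have cl: "p j \<in> carrier A" if "j \<in> insert i I" for j using insert.prems that proj_closed by auto
    then show ?case using insert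
      by (simp add: linear_comb_insert[OF insert.hyps cl] scale_zero plus_zero zero_in)
  qed (rule linear_comb_empty)
  then show ?thesis by (simp add: diag_elem_def)
qed

lemma involution_diag_elem:
  "involution A (diag_elem A d p c) = diag_elem A d p (\<lambda>k. cnj (c k))"
proof -
  have "involution A (\<Oplus>k\<in>I. c k \<odot> p k) = (\<Oplus>k\<in>I. cnj (c k) \<odot> p k)" if "finite I" "I \<subseteq> {..<d}" for I
    using that
  proof (induction I rule: finite_induct)
    case empty
    have "involution A (0 \<odot> \<one>) = cnj 0 \<odot> involution A \<one>" by (rule involution_smult[OF unit_closed])
    then show ?case by (simp add: linear_comb_empty scale_zero unit_closed involution_one)
  next
    case (insert i I)
    have cl: "p j \<in> carrier A" if "j \<in> insert i I" for j using insert.prems that proj_closed by auto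
    then show ?case using insert
      by (simp add: linear_comb_insert[OF insert.hyps cl] involution_add linear_comb_closed alg_closed
          involution_smult proj_selfadjoint)
  qed
  then show ?thesis by (simp add: diag_elem_def)
qed

text \<open>Multiplication by \<open>p l\<close> isolates a coordinate, and the state detects it
  because the states of the projections are nonzero.\<close>

lemma diag_elem_eq_zeroD:
  assumes "diag_elem A d p c = \<zero>" "l < d"
  shows "c l = 0"
proof -
  have "c l * state A (p l) = state A (c l \<odot> p l)"
    using assms(2) by (simp add: state_smult proj_closed)
  also have "\<dots> = state A (p l \<otimes> diag_elem A d p c)"
    using assms(2) by (simp add: proj_times_diag_elem)
  also have "\<dots> = 0" using assms by (simp add: times_zero proj_closed state_zero)
  finally show ?thesis using assms(2) by (simp add: proj_state)
qed

lemma state_proj_compress: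
  assumes "k < d" "x \<in> carrier A"
  shows "state A (p k \<otimes> x \<otimes> p k) = state A (p k \<otimes> x)"
proof -
  have "state A (p k \<otimes> x \<otimes> p k) = state A (p k \<otimes> (p k \<otimes> x))"
    using assms by (intro state_trace) (simp_all add: proj_closed times_closed)
  also have "p k \<otimes> (p k \<otimes> x) = p k \<otimes> x"
    using assms times_assoc[of "p k" "p k" x] by (simp add: proj_closed proj_idem)
  finally show ?thesis .
qed

text \<open>By the trace property a compression by \<open>p k\<close> on both sides has the same
  state as a multiplication by \<open>p k\<close> on one side. The one-sided condition is the form
  in which centered elements enter the Fock argument.\<close>

lemma cond_exp_diag_eq_zero_iff:
  assumes "x \<in> carrier A"
  shows "cond_exp_diag A d p x = \<zero> \<longleftrightarrow> (\<forall>k<d. state A (p k \<otimes> x) = 0)"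
proof
  assume "cond_exp_diag A d p x = \<zero>"
  then show "\<forall>k<d. state A (p k \<otimes> x) = 0"
    using diag_elem_eq_zeroD[of "cond_exp_coord A p x"] assms
    by (auto simp: cond_exp_diag_def cond_exp_coord_def state_proj_compress proj_state)
next
  assume "\<forall>k<d. state A (p k \<otimes> x) = 0"
  then have "cond_exp_diag A d p x = diag_elem A d p (\<lambda>_. 0)"
    unfolding cond_exp_diag_def using assms
    by (intro diag_elem_cong) (simp add: cond_exp_coord_def state_proj_compress)
  then show "cond_exp_diag A d p x = \<zero>" by (simp add: diag_elem_zero)
qed

text \<open>For \<open>d = 0\<close> the unit would be an empty sum, contradicting
  \<open>state A \<one> = 1\<close>. Positivity is what turns \<open>d \<le> n\<close> into
  \<open>0 < n\<close>.\<close>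

lemma d_pos: "0 < d"
proof (rule ccontr)
  assume "\<not> 0 < d"
  then have "diag_elem A d p (\<lambda>_. 1) = \<zero>" by (simp add: diag_elem_def linear_comb_empty)
  then show False using state_zero state_one diag_elem_one by simp
qed

text \<open>Testing a combination of diagonal elements with \<open>p k\<close> gives its k-th
  coordinate times the nonzero number \<open>state A (p k)\<close>. A combination that is invisible
  to the diagonal algebra therefore has all coordinates zero, even if the state is not faithful on
  \<open>A\<close>.\<close>

lemma amalg_diag: "amalg A (diag_algebra A d p)"
proof unfold_locales
  show "diag_algebra A d p \<subseteq> carrier A" using diag_elem_closed by (auto simp: diag_algebra_def)
  show "\<one> \<in> diag_algebra A d p"
    unfolding diag_algebra_def diag_elem_one[symmetric] by (rule rangeI)
  show "x \<otimes> y \<in> diag_algebra A d p" if "x \<in> diag_algebra A d p" "y \<in> diag_algebra A d p" for x y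
    using that by (auto simp: diag_algebra_def diag_elem_mult)
  fix L :: "(complex \<times> 'a) list" and y
  assume L: "\<And>a x. (a, x) \<in> set L \<Longrightarrow> x \<in> diag_algebra A d p"
    and null: "\<And>e. e \<in> diag_algebra A d p \<Longrightarrow> (\<Sum>(a, x)\<leftarrow>L. a * state A (e \<otimes> x)) = 0"
    and y: "y \<in> carrier A"
  define c where "c x = (SOME c. x = diag_elem A d p c)" for x
  have c: "x = diag_elem A d p (c x)" if "(a, x) \<in> set L" for a x
  proof -
    have "\<exists>c. x = diag_elem A d p c" using L[OF that] by (auto simp: diag_algebra_def)
    then show ?thesis unfolding c_def by (rule someI_ex)
  qed
  have zero: "(\<Sum>(a, x)\<leftarrow>L. a * c x k) = 0" if k: "k < d" for k
  proof -
    have "p k \<in> diag_algebra A d p"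
      unfolding diag_algebra_def diag_elem_proj[OF k, symmetric] by (rule rangeI)
    from null[OF this] have "0 = (\<Sum>q\<leftarrow>L. fst q * state A (p k \<otimes> snd q))"
      by (simp add: case_prod_unfold)
    also have "\<dots> = (\<Sum>q\<leftarrow>L. fst q * c (snd q) k * state A (p k))"
    proof (intro arg_cong[where f = sum_list] map_cong refl)
      fix q assume "q \<in> set L"
      then have "snd q = diag_elem A d p (c (snd q))" using c[of "fst q" "snd q"] by simp
      then have "state A (p k \<otimes> snd q) = state A (c (snd q) k \<odot> p k)"
        using proj_times_diag_elem[OF k, of "c (snd q)"] by simp
      then show "fst q * state A (p k \<otimes> snd q) = fst q * c (snd q) k * state A (p k)"
        using k by (simp add: state_smult proj_closed)
    qed
    also have "\<dots> = (\<Sum>q\<leftarrow>L. fst q * c (snd q) k) * state A (p k)"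
      by (simp add: sum_list_mult_const)
    finally show ?thesis using k by (simp add: proj_state case_prod_unfold)
  qed
  have "(\<Sum>q\<leftarrow>L. fst q * state A (y \<otimes> snd q)) =
      (\<Sum>q\<leftarrow>L. \<Sum>k<d. fst q * c (snd q) k * state A (y \<otimes> p k))"
  proof (intro arg_cong[where f = sum_list] map_cong refl)
    fix q assume "q \<in> set L"
    then have "snd q = diag_elem A d p (c (snd q))" using c[of "fst q" "snd q"] by simp
    then have "state A (y \<otimes> snd q) = (\<Sum>k<d. c (snd q) k * state A (y \<otimes> p k))"
      using state_times_diag_elem[OF y, of "c (snd q)"] by simp
    then show "fst q * state A (y \<otimes> snd q) = (\<Sum>k<d. fst q * c (snd q) k * state A (y \<otimes> p k))"
      by (simp add: sum_distrib_left mult.assoc)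
  qed
  also have "\<dots> = (\<Sum>k<d. (\<Sum>q\<leftarrow>L. fst q * c (snd q) k) * state A (y \<otimes> p k))"
    by (induction L) (simp_all add: sum.distrib distrib_right)
  also have "\<dots> = 0" using zero by (simp add: case_prod_unfold)
  finally show "(\<Sum>(a, x)\<leftarrow>L. a * state A (y \<otimes> x)) = 0" by (simp add: case_prod_unfold)
qed

text \<open>Makes everything shown so far for \<open>A\<close> available in the space that contains
  the limits of the constant matrices and, later, in the quotient.\<close>

lemma enlargement_diag:
  assumes "enlargement A C \<iota>"
  shows "diag_prob_space C d (\<iota> \<circ> p)"
    and "\<iota> (diag_elem A d p c) = diag_elem C d (\<iota> \<circ> p) c"
proof -
  have C: "tracial_star_prob_space C" and hom: "\<iota> \<in> Ring.ring_hom A C" and inj: "inj_on \<iota> (carrier A)"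
    and sc: "\<And>c x. x \<in> carrier A \<Longrightarrow> \<iota> (c \<odot> x) = c \<odot>\<^bsub>C\<^esub> \<iota> x"
    and st: "\<And>x. x \<in> carrier A \<Longrightarrow> \<iota> (involution A x) = involution C (\<iota> x)"
    and state: "\<And>x. x \<in> carrier A \<Longrightarrow> state C (\<iota> x) = state A x"
    using assms by (auto simp: enlargement_def)
  interpret C: tracial_star_prob_space C by (rule C)
  have zero: "\<iota> \<zero> = \<zero>\<^bsub>C\<^esub>"
  proof -
    have "\<iota> (0 \<odot> \<one>) = 0 \<odot>\<^bsub>C\<^esub> \<iota> \<one>" by (rule sc[OF unit_closed])
    moreover have "\<iota> \<one> \<in> carrier C" using hom unit_closed by (rule ring_hom_closed)
    moreover have "0 \<odot>\<^bsub>C\<^esub> y = \<zero>\<^bsub>C\<^esub>" if "y \<in> carrier C" for y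
      using C.smult_l_null[of y] that by (simp add: class_ring_simps)
    ultimately show ?thesis by (simp add: scale_zero unit_closed)
  qed
  have lin: "\<iota> (\<Oplus>k\<in>I. c k \<odot> p k) = (\<Oplus>\<^bsub>C\<^esub>k\<in>I. c k \<odot>\<^bsub>C\<^esub> (\<iota> \<circ> p) k)" if "finite I" "I \<subseteq> {..<d}" for I c
    using that
  proof (induction I rule: finite_induct)
    case empty
    then show ?case by (simp add: linear_comb_empty C.linear_comb_empty zero)
  next
    case (insert i I)
    have cl: "p j \<in> carrier A" if "j \<in> insert i I" for j using insert.prems that proj_closed by auto
    then have cl': "(\<iota> \<circ> p) j \<in> carrier C" if "j \<in> insert i I" for j
      using ring_hom_closed[OF hom] that by simp
    have "(\<Oplus>k\<in>insert i I. c k \<odot> p k) = c i \<odot> p i \<oplus> (\<Oplus>k\<in>I. c k \<odot> p k)"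
      by (rule linear_comb_insert[OF insert.hyps(1,2)]) (rule cl)
    moreover have "(\<Oplus>\<^bsub>C\<^esub>k\<in>insert i I. c k \<odot>\<^bsub>C\<^esub> (\<iota> \<circ> p) k) =
        c i \<odot>\<^bsub>C\<^esub> (\<iota> \<circ> p) i \<oplus>\<^bsub>C\<^esub> (\<Oplus>\<^bsub>C\<^esub>k\<in>I. c k \<odot>\<^bsub>C\<^esub> (\<iota> \<circ> p) k)"
      by (rule C.linear_comb_insert[OF insert.hyps(1,2)]) (rule cl')
    ultimately show ?case
      using insert cl by (simp add: ring_hom_add[OF hom] sc alg_closed linear_comb_closed)
  qed
  show eq: "\<iota> (diag_elem A d p c) = diag_elem C d (\<iota> \<circ> p) c" for c
    unfolding diag_elem_def by (rule lin) auto
  show "diag_prob_space C d (\<iota> \<circ> p)"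
  proof unfold_locales
    show "(\<iota> \<circ> p) k \<in> carrier C" if "k < d" for k
      using ring_hom_closed[OF hom proj_closed[OF that]] by simp
    show "involution C ((\<iota> \<circ> p) k) = (\<iota> \<circ> p) k" if "k < d" for k
      using st[OF proj_closed[OF that]] that by (simp add: proj_selfadjoint)
    show "(\<iota> \<circ> p) k \<otimes>\<^bsub>C\<^esub> (\<iota> \<circ> p) k = (\<iota> \<circ> p) k" if "k < d" for k
      using ring_hom_mult[OF hom proj_closed[OF that] proj_closed[OF that]] that by (simp add: proj_idem)
    show "(\<iota> \<circ> p) k \<noteq> \<zero>\<^bsub>C\<^esub>" if "k < d" for k
      using inj_onD[OF inj, of "p k" \<zero>] proj_nonzero that proj_closed zero_in by (auto simp: zero)
    show "(\<iota> \<circ> p) k \<otimes>\<^bsub>C\<^esub> (\<iota> \<circ> p) l = \<zero>\<^bsub>C\<^esub>" if "k < d" "l < d" "k \<noteq> l" for k l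
      using ring_hom_mult[OF hom proj_closed[OF that(1)] proj_closed[OF that(2)]] that
      by (simp add: proj_orthogonal zero)
    show "state C ((\<iota> \<circ> p) k) \<noteq> 0" if "k < d" for k
      using state[OF proj_closed[OF that]] proj_state[OF that] by simp
    have "(\<Oplus>\<^bsub>C\<^esub>k\<in>I. 1 \<odot>\<^bsub>C\<^esub> (\<iota> \<circ> p) k) = (\<Oplus>\<^bsub>C\<^esub>k\<in>I. (\<iota> \<circ> p) k)" if "finite I" "I \<subseteq> {..<d}" for I
      using that
    proof (induction I rule: finite_induct)
      case empty
      note am = abelian_group.axioms(1)[OF ring.is_abelian_group[OF C.ring_A]]
      show ?case by (simp add: C.linear_comb_empty abelian_monoid.finsum_empty[OF am])
    next
      case (insert i I)
      note am = abelian_group.axioms(1)[OF ring.is_abelian_group[OF C.ring_A]]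
      have cl: "(\<iota> \<circ> p) j \<in> carrier C" if "j \<in> insert i I" for j
        using ring_hom_closed[OF hom, of "p j"] proj_closed insert.prems that by auto
      have "(\<Oplus>\<^bsub>C\<^esub>k\<in>insert i I. (\<iota> \<circ> p) k) = (\<iota> \<circ> p) i \<oplus>\<^bsub>C\<^esub> (\<Oplus>\<^bsub>C\<^esub>k\<in>I. (\<iota> \<circ> p) k)"
        using cl by (intro abelian_monoid.finsum_insert[OF am insert.hyps]) auto
      moreover have "1 \<odot>\<^bsub>C\<^esub> (\<iota> \<circ> p) i = (\<iota> \<circ> p) i"
        using C.smult_one[of "(\<iota> \<circ> p) i"] cl by (simp add: class_ring_simps)
      moreover have "(\<Oplus>\<^bsub>C\<^esub>k\<in>insert i I. 1 \<odot>\<^bsub>C\<^esub> (\<iota> \<circ> p) k) =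
          1 \<odot>\<^bsub>C\<^esub> (\<iota> \<circ> p) i \<oplus>\<^bsub>C\<^esub> (\<Oplus>\<^bsub>C\<^esub>k\<in>I. 1 \<odot>\<^bsub>C\<^esub> (\<iota> \<circ> p) k)"
        by (rule C.linear_comb_insert[OF insert.hyps(1,2)]) (rule cl)
      ultimately show ?case using insert by simp
    qed
    from this[of "{..<d}"] show "(\<Oplus>\<^bsub>C\<^esub>k\<in>{..<d}. (\<iota> \<circ> p) k) = \<one>\<^bsub>C\<^esub>"
      using eq[of "\<lambda>_. 1"] ring_hom_one[OF hom] unfolding diag_elem_one by (simp add: diag_elem_def)
  qed
qed

end

section \<open>Gaussian integration by parts\<close>

text \<open>The Stein identity for monomials, read off the closed formulas for the even and odd
  moments. For \<open>k = 0\<close> the truncated exponent \<open>k - 1\<close> is harmless because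
  of the factor \<open>real k\<close>.\<close>

lemma normal_moment_recursion:
  assumes "0 < \<sigma>"
  shows "(\<integral>x. normal_density 0 \<sigma> x * x ^ Suc k \<partial>lborel) =
    \<sigma>\<^sup>2 * real k * (\<integral>x. normal_density 0 \<sigma> x * x ^ (k - 1) \<partial>lborel)"
proof (cases "even k")
  case True
  then obtain m where k: "k = 2 * m" by blast
  have "(\<integral>x. normal_density 0 \<sigma> x * x ^ (k - 1) \<partial>lborel) = 0" if "m \<noteq> 0"
    using integral_normal_moment_odd[OF assms, of 0 "m - 1"] that
    by (cases m) (simp_all add: k)
  then show ?thesis using integral_normal_moment_odd[OF assms, of 0 m] by (cases "m = 0") (auto simp: k)
next
  case False
  then obtain m where k: "k = 2 * m + 1" by (auto elim: oddE)
  have "(\<integral>x. normal_density 0 \<sigma> x * x ^ (2 * Suc m) \<partial>lborel) =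
      fact (2 * Suc m) / ((2 / \<sigma>\<^sup>2) ^ Suc m * fact (Suc m))"
    using integral_normal_moment_even[OF assms, of 0 "Suc m"] by simp
  also have "\<dots> = \<sigma>\<^sup>2 * real k * (fact (2 * m) / ((2 / \<sigma>\<^sup>2) ^ m * fact m))"
    using assms by (simp add: k divide_simps)
  also have "fact (2 * m) / ((2 / \<sigma>\<^sup>2) ^ m * fact m) = (\<integral>x. normal_density 0 \<sigma> x * x ^ (2 * m) \<partial>lborel)"
    using integral_normal_moment_even[OF assms, of 0 m] by simp
  finally show ?thesis by (simp add: k)
qed

lemma
  fixes F :: "'x \<Rightarrow> 'w \<Rightarrow> complex" and M :: "'w measure"
  assumes "\<And>x. x \<in> set L \<Longrightarrow> integrable M (F x)"
  shows integral_sum_list: "(\<integral>\<omega>. (\<Sum>x\<leftarrow>L. F x \<omega>) \<partial>M) = (\<Sum>x\<leftarrow>L. \<integral>\<omega>. F x \<omega> \<partial>M)"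
    and integrable_sum_list: "integrable M (\<lambda>\<omega>. \<Sum>x\<leftarrow>L. F x \<omega>)"
proof -
  have "integrable M (\<lambda>\<omega>. \<Sum>x\<leftarrow>L. F x \<omega>) \<and> (\<integral>\<omega>. (\<Sum>x\<leftarrow>L. F x \<omega>) \<partial>M) = (\<Sum>x\<leftarrow>L. \<integral>\<omega>. F x \<omega> \<partial>M)"
    using assms by (induction L) auto
  then show "(\<integral>\<omega>. (\<Sum>x\<leftarrow>L. F x \<omega>) \<partial>M) = (\<Sum>x\<leftarrow>L. \<integral>\<omega>. F x \<omega> \<partial>M)"
    "integrable M (\<lambda>\<omega>. \<Sum>x\<leftarrow>L. F x \<omega>)" by auto
qed

locale gaussian_family = prob_space M for M :: "'w measure" +
  fixes \<xi> :: "'t \<Rightarrow> 'w \<Rightarrow> real" and I :: "'t set" and \<sigma> :: real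
  assumes \<sigma>_pos: "0 < \<sigma>"
    and indep: "indep_vars (\<lambda>_. borel) \<xi> I"
    and normal: "t \<in> I \<Longrightarrow> distributed M lborel (\<xi> t) (normal_density 0 \<sigma>)"
begin

definition moment :: "nat \<Rightarrow> real" where
  "moment k = (\<integral>x. normal_density 0 \<sigma> x * x ^ k \<partial>lborel)"

lemma moment_Suc: "moment (Suc k) = \<sigma>\<^sup>2 * real k * moment (k - 1)"
  unfolding moment_def by (rule normal_moment_recursion[OF \<sigma>_pos])

lemma
  assumes "t \<in> I"
  shows expectation_power: "(\<integral>\<omega>. complex_of_real (\<xi> t \<omega>) ^ k \<partial>M) = of_real (moment k)"
    and integrable_power: "integrable M (\<lambda>\<omega>. complex_of_real (\<xi> t \<omega>) ^ k)"
proof -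
  have "integrable lborel (\<lambda>x. normal_density 0 \<sigma> x * x ^ k)"
    using integrable_normal_moment[OF \<sigma>_pos, of 0 k] by simp
  then have "integrable M (\<lambda>\<omega>. \<xi> t \<omega> ^ k)"
    using distributed_integrable[OF normal[OF assms], of "\<lambda>x. x ^ k"] by simp
  moreover have "(\<integral>\<omega>. \<xi> t \<omega> ^ k \<partial>M) = moment k"
    using distributed_integral[OF normal[OF assms], of "\<lambda>x. x ^ k"] by (simp add: moment_def)
  ultimately show "(\<integral>\<omega>. complex_of_real (\<xi> t \<omega>) ^ k \<partial>M) = of_real (moment k)"
    "integrable M (\<lambda>\<omega>. complex_of_real (\<xi> t \<omega>) ^ k)"
    unfolding of_real_power[symmetric] by (simp_all only: integral_of_real integrable_of_real)
qed

definition mon :: "'t list \<Rightarrow> 'w \<Rightarrow> complex" where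
  "mon ts \<omega> = (\<Prod>t\<leftarrow>ts. of_real (\<xi> t \<omega>))"

lemma mon_eq_prod:
  assumes "finite J" "set ts \<subseteq> J"
  shows "mon ts \<omega> = (\<Prod>t\<in>J. of_real (\<xi> t \<omega>) ^ count_list ts t)"
  using assms(2)
proof (induction ts)
  case (Cons s ts)
  have "(\<Prod>t\<in>J. complex_of_real (\<xi> t \<omega>) ^ count_list (s # ts) t) =
      (\<Prod>t\<in>J. (if t = s then of_real (\<xi> s \<omega>) else 1) * of_real (\<xi> t \<omega>) ^ count_list ts t)"
    by (intro prod.cong) auto
  also have "\<dots> = of_real (\<xi> s \<omega>) * (\<Prod>t\<in>J. of_real (\<xi> t \<omega>) ^ count_list ts t)"
    using Cons.prems assms(1) by (simp add: prod.distrib prod.delta)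
  finally show ?case using Cons by (simp add: mon_def)
qed (simp add: mon_def)

lemma
  assumes "finite J" "set ts \<subseteq> J" "J \<subseteq> I"
  shows expectation_mon: "(\<integral>\<omega>. mon ts \<omega> \<partial>M) = (\<Prod>t\<in>J. of_real (moment (count_list ts t)))"
    and integrable_mon': "integrable M (mon ts)"
proof -
  have ind: "indep_vars (\<lambda>_. borel) (\<lambda>t \<omega>. complex_of_real (\<xi> t \<omega>) ^ count_list ts t) J"
    using indep_vars_subset[OF indep assms(3)] by (rule indep_vars_compose2) simp
  have int: "integrable M (\<lambda>\<omega>. complex_of_real (\<xi> t \<omega>) ^ count_list ts t)" if "t \<in> J" for t
    using integrable_power assms(3) that by auto
  have eq: "mon ts = (\<lambda>\<omega>. \<Prod>t\<in>J. of_real (\<xi> t \<omega>) ^ count_list ts t)"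
    using mon_eq_prod[OF assms(1,2)] by (intro ext)
  show "(\<integral>\<omega>. mon ts \<omega> \<partial>M) = (\<Prod>t\<in>J. of_real (moment (count_list ts t)))"
  proof -
    have "(\<integral>\<omega>. mon ts \<omega> \<partial>M) = (\<Prod>t\<in>J. \<integral>\<omega>. complex_of_real (\<xi> t \<omega>) ^ count_list ts t \<partial>M)"
      unfolding eq by (rule indep_vars_lebesgue_integral[OF assms(1) ind int])
    also have "\<dots> = (\<Prod>t\<in>J. of_real (moment (count_list ts t)))"
      using assms(3) by (intro prod.cong) (auto simp: expectation_power)
    finally show ?thesis .
  qed
  show "integrable M (mon ts)"
    unfolding eq by (rule indep_vars_integrable[OF assms(1) ind int])
qed

lemma integrable_mon: "set ts \<subseteq> I \<Longrightarrow> integrable M (mon ts)"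
  by (rule integrable_mon'[of "set ts"]) auto

lemma mon_simps: "mon [] \<omega> = 1" "mon (t # ts) \<omega> = of_real (\<xi> t \<omega>) * mon ts \<omega>"
    "mon (ts @ us) \<omega> = mon ts \<omega> * mon us \<omega>"
  by (simp_all add: mon_def)

text \<open>The product rule along the list of variables; \<open>mon_deriv_eq\<close> collects the
  equal terms, in the form that is compared with moments.\<close>

fun mon_deriv :: "'t \<Rightarrow> 't list \<Rightarrow> 'w \<Rightarrow> complex" where
  "mon_deriv t [] \<omega> = 0"
| "mon_deriv t (s # ts) \<omega> =
     (if s = t then mon ts \<omega> else 0) + of_real (\<xi> s \<omega>) * mon_deriv t ts \<omega>"

lemma mon_deriv_append:
  "mon_deriv t (ts @ us) \<omega> = mon_deriv t ts \<omega> * mon us \<omega> + mon ts \<omega> * mon_deriv t us \<omega>"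
  by (induction ts) (auto simp: mon_simps algebra_simps)

lemma mon_deriv_eq: "mon_deriv t ts \<omega> = of_nat (count_list ts t) * mon (remove1 t ts) \<omega>"
proof (induction ts)
  case (Cons s ts)
  have "mon ts \<omega> = of_real (\<xi> t \<omega>) * mon (remove1 t ts) \<omega>" if "t \<in> set ts"
    using that by (induction ts) (auto simp: mon_simps)
  moreover have "count_list ts t = 0" if "t \<notin> set ts" using that by (simp add: count_list_0_iff)
  ultimately show ?case using Cons
    by (cases "t \<in> set ts") (auto simp: mon_simps algebra_simps)
qed simp

lemma count_list_remove1: "count_list (remove1 t ts) s = count_list ts s - (if s = t then 1 else 0)"
proof (induction ts)
  case (Cons u ts)
  show ?case
  proof (cases "u = t")
    case False
    have "count_list ts t > 0 \<or> s \<noteq> t \<or> count_list ts t = 0" by auto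
    then show ?thesis using Cons False by auto
  qed auto
qed simp

text \<open>Independence factors the expectation over the distinct variables. Only the factor of
  \<open>t\<close> changes, and there the one-dimensional moment recursion applies.\<close>

lemma mon_integration_by_parts:
  assumes "t \<in> I" "set ts \<subseteq> I"
  shows "(\<integral>\<omega>. mon (t # ts) \<omega> \<partial>M) = of_real (\<sigma>\<^sup>2) * (\<integral>\<omega>. mon_deriv t ts \<omega> \<partial>M)"
proof -
  let ?J = "insert t (set ts)"
  have J: "finite ?J" "?J \<subseteq> I" using assms by auto
  let ?P = "\<Prod>s\<in>?J - {t}. complex_of_real (moment (count_list ts s))"
  have "(\<integral>\<omega>. mon (t # ts) \<omega> \<partial>M) = (\<Prod>s\<in>?J. of_real (moment (count_list (t # ts) s)))"
    using J by (intro expectation_mon) auto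
  also have "\<dots> = of_real (moment (count_list (t # ts) t)) *
      (\<Prod>s\<in>?J - {t}. of_real (moment (count_list (t # ts) s)))"
    using J(1) by (rule prod.remove) simp
  also have "(\<Prod>s\<in>?J - {t}. complex_of_real (moment (count_list (t # ts) s))) = ?P"
    by (intro prod.cong) auto
  also have "of_real (moment (count_list (t # ts) t)) * ?P = of_real (\<sigma>\<^sup>2) * (of_nat (count_list ts t) *
      (of_real (moment (count_list (remove1 t ts) t)) * ?P))"
    by (simp add: moment_Suc count_list_remove1)
  also have "?P = (\<Prod>s\<in>?J - {t}. of_real (moment (count_list (remove1 t ts) s)))"
    by (intro prod.cong) (auto simp: count_list_remove1)
  also have "of_real (moment (count_list (remove1 t ts) t)) * \<dots> =
      (\<Prod>s\<in>?J. of_real (moment (count_list (remove1 t ts) s)))"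
    using J(1) by (rule prod.remove[symmetric]) simp
  also have "\<dots> = (\<integral>\<omega>. mon (remove1 t ts) \<omega> \<partial>M)"
    using J notin_set_remove1 set_remove1_subset[of t ts] by (intro expectation_mon[symmetric]) auto
  finally show ?thesis by (simp add: mon_deriv_eq[abs_def])
qed

lemma integrable_mon_deriv: "set ts \<subseteq> I \<Longrightarrow> integrable M (mon_deriv t ts)"
  using integrable_mon[of "remove1 t ts"] set_remove1_subset[of t ts]
  by (auto simp: mon_deriv_eq[abs_def])

text \<open>A relation and not a function, because a random variable does not remember the
  polynomial in the \<xi> that represents it.\<close>

inductive partial :: "'t \<Rightarrow> ('w \<Rightarrow> complex) \<Rightarrow> ('w \<Rightarrow> complex) \<Rightarrow> bool" for t where
  const: "partial t (\<lambda>\<omega>. c) (\<lambda>\<omega>. 0)"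
| var: "s \<in> I \<Longrightarrow> partial t (\<lambda>\<omega>. of_real (\<xi> s \<omega>)) (\<lambda>\<omega>. if s = t then 1 else 0)"
| add: "partial t f f' \<Longrightarrow> partial t g g' \<Longrightarrow> partial t (\<lambda>\<omega>. f \<omega> + g \<omega>) (\<lambda>\<omega>. f' \<omega> + g' \<omega>)"
| mult: "partial t f f' \<Longrightarrow> partial t g g' \<Longrightarrow>
    partial t (\<lambda>\<omega>. f \<omega> * g \<omega>) (\<lambda>\<omega>. f' \<omega> * g \<omega> + f \<omega> * g' \<omega>)"

text \<open>One and the same list of monomials represents \<open>f\<close> and its derivative, so
  integration by parts can be applied monomial by monomial.\<close>

lemma partial_monomials:
  assumes "partial t f f'"
  shows "\<exists>L. (\<forall>(c, ts)\<in>set L. set ts \<subseteq> I) \<and> f = (\<lambda>\<omega>. \<Sum>(c, ts)\<leftarrow>L. c * mon ts \<omega>) \<and>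
    f' = (\<lambda>\<omega>. \<Sum>(c, ts)\<leftarrow>L. c * mon_deriv t ts \<omega>)"
  using assms
proof induction
  case (const c)
  show ?case by (rule exI[of _ "[(c, [])]"]) (simp add: mon_simps)
next
  case (var s)
  then show ?case by (intro exI[of _ "[(1, [s])]"]) (simp add: mon_simps fun_eq_iff)
next
  case (add f f' g g')
  then obtain L K where "\<forall>(c, ts)\<in>set L. set ts \<subseteq> I" "f = (\<lambda>\<omega>. \<Sum>(c, ts)\<leftarrow>L. c * mon ts \<omega>)"
    "f' = (\<lambda>\<omega>. \<Sum>(c, ts)\<leftarrow>L. c * mon_deriv t ts \<omega>)"
    "\<forall>(c, ts)\<in>set K. set ts \<subseteq> I" "g = (\<lambda>\<omega>. \<Sum>(c, ts)\<leftarrow>K. c * mon ts \<omega>)"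
    "g' = (\<lambda>\<omega>. \<Sum>(c, ts)\<leftarrow>K. c * mon_deriv t ts \<omega>)"
    by blast
  then show ?case by (intro exI[of _ "L @ K"]) auto
next
  case (mult f f' g g')
  then obtain L K where *: "\<forall>(c, ts)\<in>set L. set ts \<subseteq> I" "f = (\<lambda>\<omega>. \<Sum>(c, ts)\<leftarrow>L. c * mon ts \<omega>)"
    "f' = (\<lambda>\<omega>. \<Sum>(c, ts)\<leftarrow>L. c * mon_deriv t ts \<omega>)"
    "\<forall>(c, ts)\<in>set K. set ts \<subseteq> I" "g = (\<lambda>\<omega>. \<Sum>(c, ts)\<leftarrow>K. c * mon ts \<omega>)"
    "g' = (\<lambda>\<omega>. \<Sum>(c, ts)\<leftarrow>K. c * mon_deriv t ts \<omega>)"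
    by blast
  let ?P = "concat (map (\<lambda>(c, ts). map (\<lambda>(b, us). (c * b, ts @ us)) K) L)"
  have sc: "(\<Sum>x\<leftarrow>concat xss. F x) = (\<Sum>xs\<leftarrow>xss. \<Sum>x\<leftarrow>xs. F x)"
    for xss :: "(complex \<times> 't list) list list" and F :: "_ \<Rightarrow> complex"
    by (induction xss) auto
  have prod: "(\<Sum>p\<leftarrow>L. F p) * (\<Sum>q\<leftarrow>K. G q) = (\<Sum>p\<leftarrow>L. \<Sum>q\<leftarrow>K. F p * G q)" for F G :: "_ \<Rightarrow> complex"
    by (simp add: sum_list_const_mult sum_list_mult_const)
  have "f \<omega> * g \<omega> = (\<Sum>(c, ts)\<leftarrow>?P. c * mon ts \<omega>)" for \<omega>
    unfolding *(2,5) prod sc by (simp add: comp_def case_prod_unfold mon_simps mult_ac)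
  moreover have "f' \<omega> * g \<omega> + f \<omega> * g' \<omega> = (\<Sum>(c, ts)\<leftarrow>?P. c * mon_deriv t ts \<omega>)" for \<omega>
    unfolding *(2,3,5,6) prod sc sum_list_addf[symmetric]
    by (simp add: comp_def case_prod_unfold mon_deriv_append algebra_simps sum_list_addf)
  moreover have "\<forall>(c, ts)\<in>set ?P. set ts \<subseteq> I" using *(1,4) by fastforce
  ultimately show ?case by (intro exI[of _ ?P]) (auto simp: fun_eq_iff)
qed

lemma partial_integrable:
  assumes "partial t f f'"
  shows "integrable M f" "integrable M f'"
proof -
  obtain L where L: "\<forall>(c, ts)\<in>set L. set ts \<subseteq> I" "f = (\<lambda>\<omega>. \<Sum>(c, ts)\<leftarrow>L. c * mon ts \<omega>)"
    "f' = (\<lambda>\<omega>. \<Sum>(c, ts)\<leftarrow>L. c * mon_deriv t ts \<omega>)"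
    using partial_monomials[OF assms] by blast
  then show "integrable M f" "integrable M f'"
    by (auto simp: case_prod_unfold integrable_mon integrable_mon_deriv
        intro!: integrable_sum_list integrable_mult_right)
qed

lemma gaussian_integration_by_parts:
  assumes "partial t f f'" "t \<in> I"
  shows "(\<integral>\<omega>. of_real (\<xi> t \<omega>) * f \<omega> \<partial>M) = of_real (\<sigma>\<^sup>2) * (\<integral>\<omega>. f' \<omega> \<partial>M)"
proof -
  obtain L where L: "\<forall>(c, ts)\<in>set L. set ts \<subseteq> I" "f = (\<lambda>\<omega>. \<Sum>(c, ts)\<leftarrow>L. c * mon ts \<omega>)"
    "f' = (\<lambda>\<omega>. \<Sum>(c, ts)\<leftarrow>L. c * mon_deriv t ts \<omega>)"
    using partial_monomials[OF assms(1)] by blast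
  have L1: "set ts \<subseteq> I" if "(c, ts) \<in> set L" for c ts
    using L(1) that by blast
  have "(\<integral>\<omega>. of_real (\<xi> t \<omega>) * f \<omega> \<partial>M) = (\<integral>\<omega>. (\<Sum>p\<leftarrow>L. fst p * mon (t # snd p) \<omega>) \<partial>M)"
    by (simp add: L(2) case_prod_unfold sum_list_const_mult[symmetric] mon_simps mult_ac)
  also have "\<dots> = (\<Sum>p\<leftarrow>L. \<integral>\<omega>. fst p * mon (t # snd p) \<omega> \<partial>M)"
    using L1 assms(2) by (intro integral_sum_list integrable_mult_right)
      (simp add: integrable_mon split_paired_all)
  also have "\<dots> = (\<Sum>p\<leftarrow>L. of_real (\<sigma>\<^sup>2) * (\<integral>\<omega>. fst p * mon_deriv t (snd p) \<omega> \<partial>M))"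
    using L1 assms(2) by (intro arg_cong[where f = sum_list] map_cong refl)
      (simp add: mon_integration_by_parts split_paired_all)
  also have "\<dots> = of_real (\<sigma>\<^sup>2) * (\<integral>\<omega>. (\<Sum>p\<leftarrow>L. fst p * mon_deriv t (snd p) \<omega>) \<partial>M)"
    using L1 by (subst integral_sum_list)
      (simp_all add: integrable_mon_deriv split_paired_all sum_list_const_mult)
  finally show ?thesis by (simp add: L(3) case_prod_unfold)
qed

end

section \<open>Loop equations\<close>

text \<open>All ways to single out one member of a list; the Leibniz rule for a product of traces
  sums over them.\<close>

fun picks :: "'x list \<Rightarrow> ('x \<times> 'x list) list" where
  "picks [] = []"
| "picks (x # xs) = (x, xs) # map (\<lambda>(y, ys). (y, x # ys)) (picks xs)"

lemma picks_in: "(w, vs) \<in> set (picks ws) \<Longrightarrow> mset ws = add_mset w (mset vs)"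
  by (induction ws arbitrary: w vs) auto

fun gens_in :: "'g set \<Rightarrow> ('k, 'g) letter \<Rightarrow> bool" where
  "gens_in G (Const k) \<longleftrightarrow> True"
| "gens_in G (Gen g s) \<longleftrightarrow> g \<in> G"

text \<open>The interface between the Gaussian entries and the combinatorics.
  \<open>der g s i j\<close> stands for the derivative with respect to the complex conjugate of the
  entry (i,j) of the matrix \<open>z g s\<close>; this conjugate is the entry (j,i) of the adjoint
  matrix, whence the swapped indices in \<open>der_z\<close>. The factor 1/n is the second absolute
  moment of an entry.\<close>

locale gaussian_matrices = prob_space M for M :: "'w measure" +
  fixes n :: nat and z :: "'g \<Rightarrow> bool \<Rightarrow> nat \<Rightarrow> nat \<Rightarrow> 'w \<Rightarrow> complex" and G :: "'g set"
    and der :: "'g \<Rightarrow> bool \<Rightarrow> nat \<Rightarrow> nat \<Rightarrow> ('w \<Rightarrow> complex) \<Rightarrow> ('w \<Rightarrow> complex) \<Rightarrow> bool"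
  assumes n_pos: "0 < n"
    and der_const: "der g s i j (\<lambda>\<omega>. c) (\<lambda>\<omega>. 0)"
    and der_add: "der g s i j f f' \<Longrightarrow> der g s i j e e' \<Longrightarrow>
      der g s i j (\<lambda>\<omega>. f \<omega> + e \<omega>) (\<lambda>\<omega>. f' \<omega> + e' \<omega>)"
    and der_mult: "der g s i j f f' \<Longrightarrow> der g s i j e e' \<Longrightarrow>
      der g s i j (\<lambda>\<omega>. f \<omega> * e \<omega>) (\<lambda>\<omega>. f' \<omega> * e \<omega> + f \<omega> * e' \<omega>)"
    and der_z: "\<lbrakk>g \<in> G; h \<in> G; i < n; j < n; k < n; l < n\<rbrakk> \<Longrightarrow>
      der g s i j (z h t k l) (\<lambda>\<omega>. if h = g \<and> t \<noteq> s \<and> k = j \<and> l = i then 1 else 0)"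
    and der_integrable: "der g s i j f f' \<Longrightarrow> integrable M f"
    and der_integrable': "der g s i j f f' \<Longrightarrow> integrable M f'"
    and der_by_parts: "\<lbrakk>g \<in> G; i < n; j < n; der g s i j f f'\<rbrakk> \<Longrightarrow>
      (\<integral>\<omega>. z g s i j \<omega> * f \<omega> \<partial>M) = (\<integral>\<omega>. f' \<omega> \<partial>M) / of_nat n"
begin

lemma der_sum:
  assumes "\<And>x. x \<in> S \<Longrightarrow> der g s i j (F x) (F' x)"
  shows "der g s i j (\<lambda>\<omega>. \<Sum>x\<in>S. F x \<omega>) (\<lambda>\<omega>. \<Sum>x\<in>S. F' x \<omega>)"
  using assms
proof (induction S rule: infinite_finite_induct)
  case (insert x S)
  then show ?case using der_add[of g s i j "F x" "F' x"] by simp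
qed (simp_all add: der_const)

lemma der_scale: "der g s i j f f' \<Longrightarrow> der g s i j (\<lambda>\<omega>. c * f \<omega>) (\<lambda>\<omega>. c * f' \<omega>)"
  using der_mult[OF der_const] by simp

end

locale gaussian_words = gaussian_matrices M n z G der
  for M :: "'w measure" and n and z :: "'g \<Rightarrow> bool \<Rightarrow> nat \<Rightarrow> nat \<Rightarrow> 'w \<Rightarrow> complex" and G der +
  fixes K :: "'k \<Rightarrow> nat \<Rightarrow> nat \<Rightarrow> complex"
begin

text \<open>Matrix products are written out entrywise because the derivation acts on scalar random
  variables.\<close>

fun ent :: "('k, 'g) letter list \<Rightarrow> nat \<Rightarrow> nat \<Rightarrow> 'w \<Rightarrow> complex" where
  "ent [] i j \<omega> = (if i = j then 1 else 0)"
| "ent (Const k # w) i j \<omega> = (\<Sum>r<n. K k i r * ent w r j \<omega>)"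
| "ent (Gen g s # w) i j \<omega> = (\<Sum>r<n. z g s i r \<omega> * ent w r j \<omega>)"

lemma ent_append:
  "i < n \<Longrightarrow> ent (u @ v) i j \<omega> = (\<Sum>r<n. ent u i r \<omega> * ent v r j \<omega>)"
proof (induction u arbitrary: i)
  case Nil
  have "(\<Sum>r<n. ent [] i r \<omega> * ent v r j \<omega>) = (\<Sum>r<n. if i = r then ent v i j \<omega> else 0)"
    by (intro sum.cong) auto
  then show ?case using Nil by simp
next
  case (Cons l u)
  have swap: "(\<Sum>r<n. f r * (\<Sum>q<n. ent u r q \<omega> * ent v q j \<omega>)) = (\<Sum>q<n. (\<Sum>r<n. f r * ent u r q \<omega>) * ent v q j \<omega>)" for f
    unfolding sum_distrib_left sum_distrib_right by (subst sum.swap) (simp add: mult.assoc)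
  show ?case
  proof (cases l)
    case (Const k)
    then show ?thesis using Cons.IH swap[of "\<lambda>r. K k i r"] by simp
  next
    case (Gen g s)
    then show ?thesis using Cons.IH swap[of "\<lambda>r. z g s i r \<omega>"] by simp
  qed
qed

text \<open>The derivation replaces one occurrence of the adjoint letter by a matrix unit. This cuts
  the product in two and pins the inner indices to \<open>b\<close> on the left and \<open>a\<close>
  on the right.\<close>

lemma der_ent:
  assumes "g \<in> G" "a < n" "b < n" "list_all (gens_in G) w" "i < n" "j < n"
  shows "der g s a b (ent w i j) (\<lambda>\<omega>. \<Sum>(u, v)\<leftarrow>splits g (\<not> s) w. ent u i b \<omega> * ent v a j \<omega>)"
  using assms(4,5)
proof (induction w arbitrary: i)
  case Nil
  have "ent [] i j = (\<lambda>\<omega>. if i = j then 1 else 0)" by (rule ext) simp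
  then show ?case using der_const by simp
next
  case (Cons l w)
  let ?D = "\<lambda>i \<omega>. \<Sum>(u, v)\<leftarrow>splits g (\<not> s) w. ent u i b \<omega> * ent v a j \<omega>"
  have swap: "(\<Sum>r<n. f r * (\<Sum>(u, v)\<leftarrow>S. F u r * H v)) = (\<Sum>(u, v)\<leftarrow>S. (\<Sum>r<n. f r * F u r) * H v)"
    for f :: "nat \<Rightarrow> complex" and F :: "('k, 'g) letter list \<Rightarrow> nat \<Rightarrow> complex" and H S
    by (induction S) (auto simp: algebra_simps sum.distrib sum_distrib_left sum_distrib_right)
  show ?case
  proof (cases l)
    case (Const k)
    have e: "ent (l # w) i j = (\<lambda>\<omega>. \<Sum>r<n. K k i r * ent w r j \<omega>)"
      unfolding Const by (rule ext) simp
    have "der g s a b (ent (l # w) i j) (\<lambda>\<omega>. \<Sum>r<n. K k i r * ?D r \<omega>)"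
      unfolding e using Cons by (intro der_sum der_scale) auto
    also have "(\<lambda>\<omega>. \<Sum>r<n. K k i r * ?D r \<omega>) =
        (\<lambda>\<omega>. \<Sum>(u, v)\<leftarrow>splits g (\<not> s) (l # w). ent u i b \<omega> * ent v a j \<omega>)"
      unfolding swap by (rule ext) (simp add: Const comp_def case_prod_unfold)
    finally show ?thesis .
  next
    case (Gen h t)
    have e: "ent (l # w) i j = (\<lambda>\<omega>. \<Sum>r<n. z h t i r \<omega> * ent w r j \<omega>)"
      unfolding Gen by (rule ext) simp
    have h: "h \<in> G" using Cons.prems Gen by simp
    have "der g s a b (ent (l # w) i j) (\<lambda>\<omega>. \<Sum>r<n.
        (if h = g \<and> t \<noteq> s \<and> i = b \<and> r = a then 1 else 0) * ent w r j \<omega> + z h t i r \<omega> * ?D r \<omega>)"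
      unfolding e using Cons assms(1-3) h by (intro der_sum der_mult der_z) auto
    also have "(\<lambda>\<omega>. \<Sum>r<n.
        (if h = g \<and> t \<noteq> s \<and> i = b \<and> r = a then 1 else 0) * ent w r j \<omega> + z h t i r \<omega> * ?D r \<omega>) =
        (\<lambda>\<omega>. \<Sum>(u, v)\<leftarrow>splits g (\<not> s) (l # w). ent u i b \<omega> * ent v a j \<omega>)"
    proof (rule ext)
      fix \<omega>
      have "(\<Sum>r<n. (if h = g \<and> t \<noteq> s \<and> i = b \<and> r = a then 1 else 0) * ent w r j \<omega>) =
          (\<Sum>r<n. if r = a then (if h = g \<and> t \<noteq> s \<and> i = b then ent w a j \<omega> else 0) else 0)"
        by (intro sum.cong) auto
      also have "\<dots> = (if h = g \<and> t \<noteq> s then ent [] i b \<omega> * ent w a j \<omega> else 0)"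
        using assms(2) by simp
      finally show "(\<Sum>r<n. (if h = g \<and> t \<noteq> s \<and> i = b \<and> r = a then 1 else 0) * ent w r j \<omega> +
          z h t i r \<omega> * ?D r \<omega>) =
          (\<Sum>(u, v)\<leftarrow>splits g (\<not> s) (l # w). ent u i b \<omega> * ent v a j \<omega>)"
        unfolding sum.distrib swap by (auto simp: Gen comp_def case_prod_unfold)
    qed
    finally show ?thesis .
  qed
qed

definition tr :: "('k, 'g) letter list \<Rightarrow> 'w \<Rightarrow> complex" where
  "tr w \<omega> = (\<Sum>i<n. ent w i i \<omega>) / of_nat n"

definition trs :: "('k, 'g) letter list list \<Rightarrow> 'w \<Rightarrow> complex" where
  "trs ws \<omega> = (\<Prod>w\<leftarrow>ws. tr w \<omega>)"

lemma trs_simps: "trs [] \<omega> = 1" "trs (w # ws) \<omega> = tr w \<omega> * trs ws \<omega>"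
  by (simp_all add: trs_def)

lemma tr_append: "tr (u @ v) \<omega> = (\<Sum>i<n. \<Sum>r<n. ent u i r \<omega> * ent v r i \<omega>) / of_nat n"
  by (simp add: tr_def ent_append)

lemma tr_commute: "tr (u @ v) \<omega> = tr (v @ u) \<omega>"
  unfolding tr_append by (subst sum.swap) (simp add: mult.commute)

text \<open>Differentiation opens the cycle of a trace at an adjoint letter; what remains is read
  cyclically from that place on, which gives \<open>v @ u\<close>. The factor 1/n of the normalized
  trace survives and is responsible for the small terms of the loop equation.\<close>

lemma der_tr:
  assumes "g \<in> G" "a < n" "b < n" "list_all (gens_in G) w"
  shows "der g s a b (tr w) (\<lambda>\<omega>. (\<Sum>(u, v)\<leftarrow>splits g (\<not> s) w. ent (v @ u) a b \<omega>) / of_nat n)"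
proof -
  have e: "tr w = (\<lambda>\<omega>. (1 / of_nat n) * (\<Sum>i<n. ent w i i \<omega>))"
    by (rule ext) (simp add: tr_def)
  have "der g s a b (tr w) (\<lambda>\<omega>. (1 / of_nat n) *
      (\<Sum>i<n. \<Sum>(u, v)\<leftarrow>splits g (\<not> s) w. ent u i b \<omega> * ent v a i \<omega>))"
    unfolding e using assms by (intro der_scale der_sum der_ent) auto
  also have "(\<lambda>\<omega>. (1 / of_nat n) * (\<Sum>i<n. \<Sum>(u, v)\<leftarrow>splits g (\<not> s) w. ent u i b \<omega> * ent v a i \<omega>)) =
      (\<lambda>\<omega>. (\<Sum>(u, v)\<leftarrow>splits g (\<not> s) w. ent (v @ u) a b \<omega>) / of_nat n)"
  proof (rule ext)
    fix \<omega>
    have "(\<Sum>i<n. \<Sum>(u, v)\<leftarrow>S. ent u i b \<omega> * ent v a i \<omega>) = (\<Sum>(u, v)\<leftarrow>S. ent (v @ u) a b \<omega>)" for S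
      using assms(2) by (induction S) (auto simp: sum.distrib ent_append mult.commute)
    then show "(1 / of_nat n) * (\<Sum>i<n. \<Sum>(u, v)\<leftarrow>splits g (\<not> s) w. ent u i b \<omega> * ent v a i \<omega>) =
      (\<Sum>(u, v)\<leftarrow>splits g (\<not> s) w. ent (v @ u) a b \<omega>) / of_nat n" by simp
  qed
  finally show ?thesis .
qed

lemma der_trs:
  assumes "g \<in> G" "a < n" "b < n" "list_all (list_all (gens_in G)) ws"
  shows "der g s a b (trs ws) (\<lambda>\<omega>. (\<Sum>(w, vs)\<leftarrow>picks ws.
    (\<Sum>(u, v)\<leftarrow>splits g (\<not> s) w. ent (v @ u) a b \<omega>) / of_nat n * trs vs \<omega>))"
  using assms(4)
proof (induction ws)
  case Nil
  have "trs [] = (\<lambda>\<omega>. 1)" by (rule ext) (simp add: trs_simps)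
  then show ?case using der_const by simp
next
  case (Cons w ws)
  let ?D = "\<lambda>w \<omega>. (\<Sum>(u, v)\<leftarrow>splits g (\<not> s) w. ent (v @ u) a b \<omega>) / of_nat n"
  have e: "trs (w # ws) = (\<lambda>\<omega>. tr w \<omega> * trs ws \<omega>)"
    by (rule ext) (simp add: trs_simps)
  have "der g s a b (trs (w # ws)) (\<lambda>\<omega>. ?D w \<omega> * trs ws \<omega> +
      tr w \<omega> * (\<Sum>(w, vs)\<leftarrow>picks ws. ?D w \<omega> * trs vs \<omega>))"
    unfolding e using Cons assms(1-3) by (intro der_mult der_tr) auto
  also have "(\<lambda>\<omega>. ?D w \<omega> * trs ws \<omega> + tr w \<omega> * (\<Sum>(w, vs)\<leftarrow>picks ws. ?D w \<omega> * trs vs \<omega>)) =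
      (\<lambda>\<omega>. (\<Sum>(w, vs)\<leftarrow>picks (w # ws). ?D w \<omega> * trs vs \<omega>))"
    by (rule ext) (simp add: comp_def case_prod_unfold trs_simps sum_list_const_mult[symmetric] mult_ac)
  finally show ?case .
qed

text \<open>Integrability is supplied by the derivation, so some generator to differentiate by must
  be at hand.\<close>

lemma integrable_trs:
  assumes "list_all (list_all (gens_in G)) ws" "G \<noteq> {}"
  shows "integrable M (trs ws)"
proof -
  obtain g where "g \<in> G" using assms(2) by auto
  from der_integrable[OF der_trs[OF this n_pos n_pos assms(1)]] show ?thesis .
qed

lemma integral_double_sum:
  fixes F :: "nat \<Rightarrow> nat \<Rightarrow> 'w \<Rightarrow> complex"
  assumes "\<And>a b. a < m \<Longrightarrow> b < m \<Longrightarrow> integrable M (F a b)"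
  shows "(\<integral>\<omega>. (\<Sum>a<m. \<Sum>b<m. F a b \<omega>) \<partial>M) = (\<Sum>a<m. \<Sum>b<m. \<integral>\<omega>. F a b \<omega> \<partial>M)"
proof -
  have "(\<integral>\<omega>. (\<Sum>a<m. \<Sum>b<m. F a b \<omega>) \<partial>M) = (\<Sum>a<m. \<integral>\<omega>. (\<Sum>b<m. F a b \<omega>) \<partial>M)"
    using assms by (intro Bochner_Integration.integral_sum Bochner_Integration.integrable_sum) auto
  also have "\<dots> = (\<Sum>a<m. \<Sum>b<m. \<integral>\<omega>. F a b \<omega> \<partial>M)"
    using assms by (intro sum.cong refl Bochner_Integration.integral_sum) auto
  finally show ?thesis .
qed

text \<open>Integration by parts and the normalization of the leading trace give n^-2 in front of a
  double sum over indices. If the derivative hits the same trace, this splits into two, the double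
  sum yields n^2 and the term has order 1. If it hits another trace, the two merge: the index sum
  yields only n, cancelled by the normalization of the second trace, and n^-2 remains.\<close>

lemma loop_equation:
  assumes g: "g \<in> G" and w: "list_all (gens_in G) w" and ws: "list_all (list_all (gens_in G)) ws"
  shows "(\<integral>\<omega>. trs ((Gen g s # w) # ws) \<omega> \<partial>M) =
    (\<Sum>(u, v)\<leftarrow>splits g (\<not> s) w. \<integral>\<omega>. trs (u # v # ws) \<omega> \<partial>M) +
    (\<Sum>(w', vs)\<leftarrow>picks ws. \<Sum>(u, v)\<leftarrow>splits g (\<not> s) w'. \<integral>\<omega>. trs ((w @ v @ u) # vs) \<omega> \<partial>M) / (of_nat n)\<^sup>2"
proof -
  let ?N = "of_nat n :: complex"
  have N: "?N \<noteq> 0" using n_pos by simp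
  define F' where "F' a b \<omega> = (\<Sum>(u, v)\<leftarrow>splits g (\<not> s) w. ent u b b \<omega> * ent v a a \<omega>) * trs ws \<omega> +
    ent w b a \<omega> * (\<Sum>(w', vs)\<leftarrow>picks ws. (\<Sum>(u, v)\<leftarrow>splits g (\<not> s) w'. ent (v @ u) a b \<omega>) / ?N * trs vs \<omega>)"
    for a b \<omega>
  have der: "der g s a b (\<lambda>\<omega>. ent w b a \<omega> * trs ws \<omega>) (F' a b)" if "a < n" "b < n" for a b
    unfolding F'_def[abs_def] using that assms by (intro der_mult der_ent der_trs) auto
  have int: "integrable M (\<lambda>\<omega>. z g s a b \<omega> * (ent w b a \<omega> * trs ws \<omega>))" if "a < n" "b < n" for a b
    using der_integrable[OF der_mult[OF der_z[OF g g that that] der[OF that]]] by simp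
  have trs_eq: "trs ((Gen g s # w) # ws) \<omega> = (\<Sum>a<n. \<Sum>b<n. z g s a b \<omega> * (ent w b a \<omega> * trs ws \<omega>)) / ?N" for \<omega>
    by (simp add: trs_simps tr_def sum_distrib_right mult.assoc)
  have "(\<integral>\<omega>. trs ((Gen g s # w) # ws) \<omega> \<partial>M) =
      (\<Sum>a<n. \<Sum>b<n. \<integral>\<omega>. z g s a b \<omega> * (ent w b a \<omega> * trs ws \<omega>) \<partial>M) / ?N"
    unfolding trs_eq using integral_double_sum[of n, OF int] by simp
  also have "\<dots> = (\<Sum>a<n. \<Sum>b<n. (\<integral>\<omega>. F' a b \<omega> \<partial>M) / ?N) / ?N"
    using der_by_parts[OF g _ _ der] by simp
  also have "\<dots> = (\<integral>\<omega>. (\<Sum>a<n. \<Sum>b<n. F' a b \<omega>) / ?N\<^sup>2 \<partial>M)"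
    using integral_double_sum[of n, OF der_integrable'[OF der]]
    by (simp add: power2_eq_square flip: sum_divide_distrib)
  also have "(\<lambda>\<omega>. (\<Sum>a<n. \<Sum>b<n. F' a b \<omega>) / ?N\<^sup>2) = (\<lambda>\<omega>. (\<Sum>(u, v)\<leftarrow>splits g (\<not> s) w. trs (u # v # ws) \<omega>) +
    (\<Sum>(w', vs)\<leftarrow>picks ws. \<Sum>(u, v)\<leftarrow>splits g (\<not> s) w'. trs ((w @ v @ u) # vs) \<omega>) / ?N\<^sup>2)"
  proof (rule ext)
    fix \<omega>
    \<comment> \<open>The indices \<open>a\<close> and \<open>b\<close> close up into separate
      cycles, hence two factors n.\<close>
    have 1: "(\<Sum>a<n. \<Sum>b<n. (\<Sum>(u, v)\<leftarrow>S. ent u b b \<omega> * ent v a a \<omega>)) = (\<Sum>(u, v)\<leftarrow>S. ?N\<^sup>2 * (tr u \<omega> * tr v \<omega>))" for S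
    proof (induction S)
      case (Cons p S)
      obtain u v where p: "p = (u, v)" by (cases p)
      have "(\<Sum>a<n. \<Sum>b<n. ent u b b \<omega> * ent v a a \<omega>) = (\<Sum>b<n. ent u b b \<omega>) * (\<Sum>a<n. ent v a a \<omega>)"
        unfolding sum_product by (rule sum.swap)
      also have "\<dots> = ?N\<^sup>2 * (tr u \<omega> * tr v \<omega>)" using N by (simp add: tr_def power2_eq_square)
      finally show ?case using Cons by (simp add: p sum.distrib)
    qed simp
    \<comment> \<open>Here both indices lie on one cycle, hence a single factor n.\<close>
    have 2: "(\<Sum>a<n. \<Sum>b<n. ent w b a \<omega> * (\<Sum>(u, v)\<leftarrow>S. ent (v @ u) a b \<omega>)) = (\<Sum>(u, v)\<leftarrow>S. ?N * tr (w @ v @ u) \<omega>)" for S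
    proof (induction S)
      case (Cons p S)
      obtain u v where p: "p = (u, v)" by (cases p)
      have "(\<Sum>a<n. \<Sum>b<n. ent w b a \<omega> * ent (v @ u) a b \<omega>) = ?N * tr (w @ v @ u) \<omega>"
        unfolding tr_append[of w] using N by (subst sum.swap) simp
      then show ?case using Cons by (simp add: p sum.distrib distrib_left)
    qed simp
    have 3: "(\<Sum>a<n. \<Sum>b<n. ent w b a \<omega> * (\<Sum>(w', vs)\<leftarrow>L. (\<Sum>(u, v)\<leftarrow>splits g (\<not> s) w'. ent (v @ u) a b \<omega>) / ?N * trs vs \<omega>)) =
      (\<Sum>(w', vs)\<leftarrow>L. \<Sum>(u, v)\<leftarrow>splits g (\<not> s) w'. trs ((w @ v @ u) # vs) \<omega>)" for L
    proof (induction L)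
      case (Cons p L)
      obtain w' vs where p: "p = (w', vs)" by (cases p)
      let ?S = "splits g (\<not> s) w'"
      have "(\<Sum>a<n. \<Sum>b<n. ent w b a \<omega> * ((\<Sum>(u, v)\<leftarrow>?S. ent (v @ u) a b \<omega>) / ?N * trs vs \<omega>)) =
          (\<Sum>a<n. \<Sum>b<n. ent w b a \<omega> * (\<Sum>(u, v)\<leftarrow>?S. ent (v @ u) a b \<omega>)) / ?N * trs vs \<omega>"
        by (simp add: sum_distrib_right sum_divide_distrib mult.assoc)
      also have "\<dots> = (\<Sum>(u, v)\<leftarrow>?S. trs ((w @ v @ u) # vs) \<omega>)"
      proof -
        have "(\<Sum>(u, v)\<leftarrow>S. ?N * tr (w @ v @ u) \<omega>) / ?N * trs vs \<omega> =
            (\<Sum>(u, v)\<leftarrow>S. trs ((w @ v @ u) # vs) \<omega>)" for S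
          using N by (induction S) (auto simp: trs_simps add_divide_distrib distrib_right)
        then show ?thesis unfolding 2 .
      qed
      finally show ?case using Cons by (simp add: p sum.distrib distrib_left)
    qed simp
    have 4: "(\<Sum>(u, v)\<leftarrow>S. ?N\<^sup>2 * (tr u \<omega> * tr v \<omega>)) * trs ws \<omega> / ?N\<^sup>2 = (\<Sum>(u, v)\<leftarrow>S. trs (u # v # ws) \<omega>)" for S
      using N by (induction S) (auto simp: trs_simps add_divide_distrib distrib_right)
    have "(\<Sum>a<n. \<Sum>b<n. F' a b \<omega>) =
        (\<Sum>a<n. \<Sum>b<n. (\<Sum>(u, v)\<leftarrow>splits g (\<not> s) w. ent u b b \<omega> * ent v a a \<omega>)) * trs ws \<omega> +
        (\<Sum>(w', vs)\<leftarrow>picks ws. \<Sum>(u, v)\<leftarrow>splits g (\<not> s) w'. trs ((w @ v @ u) # vs) \<omega>)"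
      unfolding F'_def sum.distrib 3 by (simp add: sum_distrib_right)
    then show "(\<Sum>a<n. \<Sum>b<n. F' a b \<omega>) / ?N\<^sup>2 = (\<Sum>(u, v)\<leftarrow>splits g (\<not> s) w. trs (u # v # ws) \<omega>) +
      (\<Sum>(w', vs)\<leftarrow>picks ws. \<Sum>(u, v)\<leftarrow>splits g (\<not> s) w'. trs ((w @ v @ u) # vs) \<omega>) / ?N\<^sup>2"
      by (simp only: 1 4 add_divide_distrib)
  qed
  also have "(\<integral>\<omega>. (\<Sum>(u, v)\<leftarrow>splits g (\<not> s) w. trs (u # v # ws) \<omega>) +
      (\<Sum>(w', vs)\<leftarrow>picks ws. \<Sum>(u, v)\<leftarrow>splits g (\<not> s) w'. trs ((w @ v @ u) # vs) \<omega>) / ?N\<^sup>2 \<partial>M) =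
      (\<Sum>(u, v)\<leftarrow>splits g (\<not> s) w. \<integral>\<omega>. trs (u # v # ws) \<omega> \<partial>M) +
      (\<Sum>(w', vs)\<leftarrow>picks ws. \<Sum>(u, v)\<leftarrow>splits g (\<not> s) w'. \<integral>\<omega>. trs ((w @ v @ u) # vs) \<omega> \<partial>M) / ?N\<^sup>2"
  proof -
    have G: "G \<noteq> {}" using g by auto
    have int1: "integrable M (trs (fst p # snd p # ws))" if "p \<in> set (splits g (\<not> s) w)" for p
      using w ws G splits_append[of "fst p" "snd p" g "\<not> s" w] that by (intro integrable_trs) auto
    have int2: "integrable M (trs ((w @ snd p @ fst p) # snd q))"
      if "p \<in> set (splits g (\<not> s) (fst q))" "q \<in> set (picks ws)" for p q
    proof (rule integrable_trs[OF _ G])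
      have "mset ws = add_mset (fst q) (mset (snd q))" using picks_in[of "fst q" "snd q"] that by simp
      then have "set ws = insert (fst q) (set (snd q))" by (metis set_mset_add_mset_insert set_mset_mset)
      then show "list_all (list_all (gens_in G)) ((w @ snd p @ fst p) # snd q)"
        using splits_append[of "fst p" "snd p" g "\<not> s" "fst q"] that w ws by (auto simp: list_all_iff)
    qed
    let ?A = "\<lambda>p. trs (fst p # snd p # ws)"
      and ?B = "\<lambda>q \<omega>. \<Sum>p\<leftarrow>splits g (\<not> s) (fst q). trs ((w @ snd p @ fst p) # snd q) \<omega>"
    have "integrable M (\<lambda>\<omega>. \<Sum>p\<leftarrow>splits g (\<not> s) w. ?A p \<omega>)"
      "(\<integral>\<omega>. (\<Sum>p\<leftarrow>splits g (\<not> s) w. ?A p \<omega>) \<partial>M) = (\<Sum>p\<leftarrow>splits g (\<not> s) w. \<integral>\<omega>. ?A p \<omega> \<partial>M)"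
      using integral_sum_list[of "splits g (\<not> s) w" M ?A]
        integrable_sum_list[of "splits g (\<not> s) w" M ?A] int1
      by auto
    moreover have B: "integrable M (?B q) \<and>
      (\<integral>\<omega>. ?B q \<omega> \<partial>M) = (\<Sum>p\<leftarrow>splits g (\<not> s) (fst q). \<integral>\<omega>. trs ((w @ snd p @ fst p) # snd q) \<omega> \<partial>M)"
      if "q \<in> set (picks ws)" for q
      using integral_sum_list[of "splits g (\<not> s) (fst q)" M "\<lambda>p. trs ((w @ snd p @ fst p) # snd q)"]
        integrable_sum_list[of "splits g (\<not> s) (fst q)" M "\<lambda>p. trs ((w @ snd p @ fst p) # snd q)"] int2 that
      by auto
    moreover have "integrable M (\<lambda>\<omega>. \<Sum>q\<leftarrow>picks ws. ?B q \<omega>)"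
      "(\<integral>\<omega>. (\<Sum>q\<leftarrow>picks ws. ?B q \<omega>) \<partial>M) = (\<Sum>q\<leftarrow>picks ws. \<integral>\<omega>. ?B q \<omega> \<partial>M)"
      using integral_sum_list[of "picks ws" M ?B]
        integrable_sum_list[of "picks ws" M ?B] B
      by auto
    moreover have "(\<Sum>q\<leftarrow>picks ws. \<integral>\<omega>. ?B q \<omega> \<partial>M) =
        (\<Sum>q\<leftarrow>picks ws. \<Sum>p\<leftarrow>splits g (\<not> s) (fst q). \<integral>\<omega>. trs ((w @ snd p @ fst p) # snd q) \<omega> \<partial>M)"
      using B by (intro arg_cong[where f = sum_list] map_cong refl) auto
    ultimately show ?thesis unfolding case_prod_unfold by simp
  qed
  finally show ?thesis .
qed

end

section \<open>Passage to the limit in the loop equations\<close>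

definition gen_count :: "('k, 'g) letter list \<Rightarrow> nat" where
  "gen_count w = length (filter (\<lambda>l. \<exists>g s. l = Gen g s) w)"

lemma gen_count_simps [simp]:
  "gen_count [] = 0" "gen_count (Const k # w) = gen_count w"
  "gen_count (Gen g s # w) = Suc (gen_count w)" "gen_count (u @ v) = gen_count u + gen_count v"
  by (simp_all add: gen_count_def)

lemma gen_count_zero:
  assumes "gen_count w = 0"
  shows "\<exists>ks. w = map Const ks"
proof -
  have "\<forall>l\<in>set w. \<not> (\<exists>g s. l = Gen g s)"
    using assms by (simp only: gen_count_def length_0_conv filter_empty_conv)
  then have "\<forall>l\<in>set w. \<exists>k. l = Const k" by (metis letter.exhaust)
  then have "\<exists>ks. map Const ks = w" by (induction w) (auto simp: Cons_eq_map_conv, metis list.map(2))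
  then show ?thesis by metis
qed

lemma gen_count_pos: "0 < gen_count w \<Longrightarrow> \<exists>u g s v. w = u @ Gen g s # v"
  by (force simp: gen_count_def filter_empty_conv dest: split_list)

lemma splits_map:
  "splits g s (map (map_letter h id) w) = map (\<lambda>(u, v). (map (map_letter h id) u, map (map_letter h id) v)) (splits g s w)"
proof (induction w)
  case (Cons l w)
  have "map_letter h id l = Gen g s \<longleftrightarrow> l = Gen g s" by (cases l) auto
  then show ?case using Cons by (cases "l = Gen g s") (simp_all add: comp_def case_prod_unfold id_def)
qed simp

lemma (in gaussian_words) ent_Const: "ent (map Const ks) i j \<omega> = ent (map Const ks) i j \<omega>'"
  by (induction ks arbitrary: i) auto

lemma (in gaussian_words) tr_Const: "tr (map Const ks) \<omega> = tr (map Const ks) \<omega>'"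
  by (simp add: tr_def ent_Const[of ks _ _ \<omega> \<omega>'])

lemma (in tracial_star_prob_space) fock_rotate_map:
  assumes "\<And>k. \<kappa> k \<in> carrier A"
  shows "fock (map (map_letter \<kappa> id) (u @ v)) = fock (map (map_letter \<kappa> id) (v @ u))"
proof -
  have "list_all wf_letter (map (map_letter \<kappa> id) w)" for w :: "('b, 'c) letter list"
  proof (induction w)
    case (Cons l w)
    then show ?case using assms by (cases l) auto
  qed simp
  then show ?thesis by (simp add: fock_commute)
qed

text \<open>Finite n and limit obey the same recursion up to a multiple of n^-2, and each term on
  its right-hand side has two generators fewer. As the claim concerns products of traces, asymptotic
  factorisation of expectations is part of the induction and no separate variance estimate
  enters.\<close>

theorem gaussian_words_limit:
  fixes M :: "'w measure" and G :: "'g set" and \<kappa> :: "'k \<Rightarrow> 'c"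
    and z :: "nat \<Rightarrow> 'g \<Rightarrow> bool \<Rightarrow> nat \<Rightarrow> nat \<Rightarrow> 'w \<Rightarrow> complex"
    and K :: "nat \<Rightarrow> 'k \<Rightarrow> nat \<Rightarrow> nat \<Rightarrow> complex"
  defines "\<theta> \<equiv> \<lambda>n. gaussian_words.tr n (z n) (K n)"
    and "\<Theta> \<equiv> \<lambda>n. gaussian_words.trs n (z n) (K n)"
  assumes C: "tracial_star_prob_space C"
    and gw: "eventually (\<lambda>n. gaussian_words M n (z n) G (der n)) sequentially"
    and \<kappa>: "\<And>k. \<kappa> k \<in> carrier C"
    and const: "\<And>ks \<omega>. (\<lambda>n. \<theta> n (map Const ks) \<omega>) \<longlonglongrightarrow> state C (foldr (\<otimes>\<^bsub>C\<^esub>) (map \<kappa> ks) \<one>\<^bsub>C\<^esub>)"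
    and ws: "list_all (list_all (gens_in G)) ws"
  shows "(\<lambda>n. \<integral>\<omega>. \<Theta> n ws \<omega> \<partial>M) \<longlonglongrightarrow>
    (\<Prod>w\<leftarrow>ws. tracial_star_prob_space.fock C (map (map_letter \<kappa> id) w))"
proof -
  interpret C: tracial_star_prob_space C by (rule C)
  define F :: "('k, 'g) letter list \<Rightarrow> complex" where "F w = C.fock (map (map_letter \<kappa> id) w)" for w
  have F_Const: "F (map Const ks) = state C (foldr (\<otimes>\<^bsub>C\<^esub>) (map \<kappa> ks) \<one>\<^bsub>C\<^esub>)" for ks
    using C.fock_Const[of "map \<kappa> ks"] by (simp add: F_def comp_def)
  have F_Gen: "F (Gen g s # w) = (\<Sum>(u, v)\<leftarrow>splits g (\<not> s) w. F u * F v)" for g s w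
    by (simp add: F_def C.fock_Gen splits_map comp_def case_prod_unfold)
  have "(\<lambda>n. \<integral>\<omega>. \<Theta> n ws \<omega> \<partial>M) \<longlonglongrightarrow> (\<Prod>w\<leftarrow>ws. F w)"
    using ws
  proof (induction "sum_list (map gen_count ws)" arbitrary: ws rule: less_induct)
    case less
    show ?case
    proof (cases "sum_list (map gen_count ws) = 0")
      case True
      then have "\<forall>w\<in>set ws. gen_count w = 0" by simp
      then have cw: "\<forall>w\<in>set ws. \<exists>ks. w = map Const ks" using gen_count_zero by blast
      \<comment> \<open>Traces of constant words do not depend on the sample point, so any point,
        here \<open>undefined\<close>, represents them.\<close>
      have "(\<lambda>n. \<Prod>w\<leftarrow>ws. \<theta> n w undefined) \<longlonglongrightarrow> (\<Prod>w\<leftarrow>ws. F w)"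
        using cw
      proof (induction ws)
        case (Cons w ws)
        then obtain ks where "w = map Const ks" by auto
        then have "(\<lambda>n. \<theta> n w undefined) \<longlonglongrightarrow> F w" using const[of ks] by (simp add: F_Const)
        then show ?case using Cons by (auto intro!: tendsto_mult)
      qed simp
      moreover have "eventually (\<lambda>n. (\<Prod>w\<leftarrow>ws. \<theta> n w undefined) = (\<integral>\<omega>. \<Theta> n ws \<omega> \<partial>M)) sequentially"
        using gw
      proof eventually_elim
        case (elim n)
        interpret gaussian_words M n "z n" G "der n" "K n" by (rule elim)
        have "\<Theta> n ws = (\<lambda>\<omega>. (\<Prod>w\<leftarrow>ws. \<theta> n w undefined))"
        proof (rule ext)
          fix \<omega>
          show "\<Theta> n ws \<omega> = (\<Prod>w\<leftarrow>ws. \<theta> n w undefined)"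
            unfolding \<Theta>_def local.trs_def \<theta>_def
            using cw tr_Const by (intro arg_cong[where f = prod_list] map_cong refl) metis
        qed
        then show ?case by (simp add: prob_space)
      qed
      ultimately show ?thesis by (rule Lim_transform_eventually)
    next
      case False
      then obtain w where w: "w \<in> set ws" "0 < gen_count w" by auto
      then obtain us vs where ws_eq: "ws = us @ w # vs" by (meson split_list)
      \<comment> \<open>Any generator letter will do. The trace property, on the matrix side and on
        the Fock side, rotates it to the front of its word, where the recursions apply.\<close>
      obtain p g s q where w_eq: "w = p @ Gen g s # q" using gen_count_pos[OF w(2)] by blast
      define u where "u = q @ p"
      define rest where "rest = us @ vs"
      have g: "g \<in> G" and u: "list_all (gens_in G) u" and rest: "list_all (list_all (gens_in G)) rest"
        using less.prems by (auto simp: ws_eq w_eq u_def rest_def)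
      have count: "sum_list (map gen_count ws) = Suc (gen_count u + sum_list (map gen_count rest))"
        by (simp add: ws_eq w_eq u_def rest_def)
      have G_splits: "list_all (gens_in G) u1" "list_all (gens_in G) u2" "Suc (gen_count u1 + gen_count u2) = gen_count u'"
        if "(u1, u2) \<in> set (splits g (\<not> s) u')" "list_all (gens_in G) u'" for u1 u2 u'
        using splits_append[OF that(1)] that(2) by auto
      have eq: "\<Theta> n ws \<omega> = \<Theta> n ((Gen g s # u) # rest) \<omega>"
        if "gaussian_words M n (z n) G (der n)" for n \<omega>
      proof -
        interpret gaussian_words M n "z n" G "der n" "K n" by (rule that)
        have "local.tr w \<omega> = local.tr (Gen g s # u) \<omega>"
          using tr_commute[of p "Gen g s # q"] by (simp add: w_eq u_def)
        then show ?thesis by (simp add: \<Theta>_def local.trs_def ws_eq rest_def mult_ac)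
      qed
      have pick: "list_all (gens_in G) w'" "list_all (list_all (gens_in G)) vs'"
        "sum_list (map gen_count rest) = gen_count w' + sum_list (map gen_count vs')"
        if "(w', vs') \<in> set (picks rest)" for w' vs'
      proof -
        have m: "mset rest = add_mset w' (mset vs')"
          using that by (rule picks_in)
        have "set rest = insert w' (set vs')" using m by (metis set_mset_add_mset_insert set_mset_mset)
        then show "list_all (gens_in G) w'" "list_all (list_all (gens_in G)) vs'"
          using rest by (auto simp: list_all_iff)
        show "sum_list (map gen_count rest) = gen_count w' + sum_list (map gen_count vs')"
          using m by (metis mset_map sum_mset_sum_list image_mset_add_mset sum_mset.add_mset)
      qed
      let ?L = "\<lambda>n. (\<Sum>(u1, u2)\<leftarrow>splits g (\<not> s) u. \<integral>\<omega>. \<Theta> n (u1 # u2 # rest) \<omega> \<partial>M)"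
      let ?R = "\<lambda>n. (\<Sum>(w', vs)\<leftarrow>picks rest. \<Sum>(u1, u2)\<leftarrow>splits g (\<not> s) w'. \<integral>\<omega>. \<Theta> n ((u @ u2 @ u1) # vs) \<omega> \<partial>M)"
      have tendsto_sum_list: "(\<lambda>n. \<Sum>x\<leftarrow>xs. f n x) \<longlonglongrightarrow> (\<Sum>x\<leftarrow>xs. l x)"
        if "\<And>x. x \<in> set xs \<Longrightarrow> (\<lambda>n. f n x) \<longlonglongrightarrow> l x"
        for xs :: "'y list" and f :: "nat \<Rightarrow> 'y \<Rightarrow> complex" and l
        using that by (induction xs) (auto intro!: tendsto_add)
      have "?L \<longlonglongrightarrow> (\<Sum>(u1, u2)\<leftarrow>splits g (\<not> s) u. \<Prod>w\<leftarrow>u1 # u2 # rest. F w)"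
        unfolding case_prod_unfold
      proof (rule tendsto_sum_list)
        fix x assume "x \<in> set (splits g (\<not> s) u)"
        then have x: "(fst x, snd x) \<in> set (splits g (\<not> s) u)" by simp
        show "(\<lambda>n. \<integral>\<omega>. \<Theta> n (fst x # snd x # rest) \<omega> \<partial>M) \<longlonglongrightarrow> (\<Prod>w\<leftarrow>fst x # snd x # rest. F w)"
          using G_splits[OF x u] rest count by (intro less.hyps) auto
      qed
      moreover have "?R \<longlonglongrightarrow> (\<Sum>(w', vs)\<leftarrow>picks rest. \<Sum>(u1, u2)\<leftarrow>splits g (\<not> s) w'. \<Prod>w\<leftarrow>(u @ u2 @ u1) # vs. F w)"
        unfolding case_prod_unfold
      proof (intro tendsto_sum_list)
        fix y x assume "y \<in> set (picks rest)" "x \<in> set (splits g (\<not> s) (fst y))"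
        then have y: "(fst y, snd y) \<in> set (picks rest)"
          and x: "(fst x, snd x) \<in> set (splits g (\<not> s) (fst y))" by simp_all
        show "(\<lambda>n. \<integral>\<omega>. \<Theta> n ((u @ snd x @ fst x) # snd y) \<omega> \<partial>M) \<longlonglongrightarrow>
            (\<Prod>w\<leftarrow>(u @ snd x @ fst x) # snd y. F w)"
          using G_splits[OF x pick(1)[OF y]] pick[OF y] u count by (intro less.hyps) auto
      qed
      moreover have "(\<lambda>n. 1 / (of_nat n)\<^sup>2 :: complex) \<longlonglongrightarrow> 0"
        using tendsto_power[OF lim_inverse_n, of 2] by (simp add: inverse_eq_divide power_one_over)
      ultimately have "(\<lambda>n. ?L n + ?R n * (1 / (of_nat n)\<^sup>2)) \<longlonglongrightarrow>
          (\<Sum>(u1, u2)\<leftarrow>splits g (\<not> s) u. \<Prod>w\<leftarrow>u1 # u2 # rest. F w) +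
          (\<Sum>(w', vs)\<leftarrow>picks rest. \<Sum>(u1, u2)\<leftarrow>splits g (\<not> s) w'. \<Prod>w\<leftarrow>(u @ u2 @ u1) # vs. F w) * 0"
        by (intro tendsto_add tendsto_mult)
      also have "(\<Sum>(u1, u2)\<leftarrow>splits g (\<not> s) u. \<Prod>w\<leftarrow>u1 # u2 # rest. F w) +
          (\<Sum>(w', vs)\<leftarrow>picks rest. \<Sum>(u1, u2)\<leftarrow>splits g (\<not> s) w'. \<Prod>w\<leftarrow>(u @ u2 @ u1) # vs. F w) * 0 =
          F (Gen g s # u) * (\<Prod>w\<leftarrow>rest. F w)"
        by (simp add: F_Gen sum_list_mult_const[symmetric] case_prod_unfold mult.assoc)
      also have "F (Gen g s # u) = F w"
        using C.fock_rotate_map[OF \<kappa>, where u = "Gen g s # q" and v = p] by (simp add: F_def w_eq u_def)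
      also have "F w * (\<Prod>w\<leftarrow>rest. F w) = (\<Prod>w\<leftarrow>ws. F w)"
        by (simp add: ws_eq rest_def mult_ac)
      finally have "(\<lambda>n. ?L n + ?R n * (1 / (of_nat n)\<^sup>2)) \<longlonglongrightarrow> (\<Prod>w\<leftarrow>ws. F w)" .
      moreover have "eventually (\<lambda>n. ?L n + ?R n * (1 / (of_nat n)\<^sup>2) = (\<integral>\<omega>. \<Theta> n ws \<omega> \<partial>M)) sequentially"
        using gw
      proof eventually_elim
        case (elim n)
        interpret gaussian_words M n "z n" G "der n" "K n" by (rule elim)
        show ?case
          using loop_equation[OF g u rest, of s] eq[OF elim] by (simp add: \<Theta>_def)
      qed
      ultimately show ?thesis by (rule Lim_transform_eventually)
    qed
  qed
  then show ?thesis by (simp add: F_def)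
qed

section \<open>Block Gaussian matrices\<close>

type_synonym gen = "nat \<times> nat \<times> nat"

fun gaussian_entry ::
    "(nat \<Rightarrow> nat \<Rightarrow> nat \<Rightarrow> nat \<Rightarrow> nat \<Rightarrow> nat \<Rightarrow> 'w \<Rightarrow> complex) \<Rightarrow> nat \<Rightarrow> gen \<Rightarrow> bool \<Rightarrow> nat \<Rightarrow> nat \<Rightarrow> 'w \<Rightarrow> complex"
  where
  "gaussian_entry a n (s, k, l) st i j \<omega> = (if st then cnj (a j i n k l s \<omega>) else a i j n k l s \<omega>)"

definition real_entry ::
    "(nat \<Rightarrow> nat \<Rightarrow> nat \<Rightarrow> nat \<Rightarrow> nat \<Rightarrow> nat \<Rightarrow> 'w \<Rightarrow> complex) \<Rightarrow> nat \<Rightarrow>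
     (complex \<Rightarrow> real) \<times> nat \<times> nat \<times> nat \<times> nat \<times> nat \<Rightarrow> 'w \<Rightarrow> real" where
  "real_entry a n = (\<lambda>(part, i, j, k, l, s) \<omega>. part (a i j n k l s \<omega>))"

definition entry_indices ::
    "nat \<Rightarrow> nat \<Rightarrow> ((complex \<Rightarrow> real) \<times> nat \<times> nat \<times> nat \<times> nat \<times> nat) set" where
  "entry_indices d n = {(part, i, j, k, l, s). part \<in> {Re, Im} \<and> i < n \<and> j < n \<and> k < d \<and> l < d}"

text \<open>The derivative with respect to the complex conjugate of an entry, a combination of the partial
  derivatives with respect to its real and imaginary parts.\<close>

fun conj_derivative ::
    "(nat \<Rightarrow> nat \<Rightarrow> nat \<Rightarrow> nat \<Rightarrow> nat \<Rightarrow> nat \<Rightarrow> 'w \<Rightarrow> complex) \<Rightarrow> nat \<Rightarrow> nat \<Rightarrow> gen \<Rightarrow> bool \<Rightarrow>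
     nat \<Rightarrow> nat \<Rightarrow> ('w \<Rightarrow> complex) \<Rightarrow> ('w \<Rightarrow> complex) \<Rightarrow> bool" where
  "conj_derivative a d n (s, k, l) st i j f f' \<longleftrightarrow> (\<exists>f1 f2.
     gaussian_family.partial (real_entry a n) (entry_indices d n)
       (Re, if st then j else i, if st then i else j, k, l, s) f f1 \<and>
     gaussian_family.partial (real_entry a n) (entry_indices d n)
       (Im, if st then j else i, if st then i else j, k, l, s) f f2 \<and>
     f' = (\<lambda>\<omega>. (f1 \<omega> + (if st then - \<i> else \<i>) * f2 \<omega>) / 2))"

lemma Re_neq_Im: "Re \<noteq> Im" "Im \<noteq> Re"
proof -
  have "Re \<i> \<noteq> Im \<i>" by simp
  then show "Re \<noteq> Im" "Im \<noteq> Re" by metis+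
qed

text \<open>Two of the axioms carry content: integration by parts, combined from the real and the
  imaginary direction, and the values of the derivation on the entries themselves. The others are
  inherited from \<open>partial\<close> in both directions.\<close>

lemma gaussian_matrices_entries:
  assumes M: "prob_space M" and g: "gaussian_entries M d n a" and n: "0 < n"
  shows "gaussian_matrices M n (gaussian_entry a n) {(s, k, l). k < d \<and> l < d} (conj_derivative a d n)"
proof -
  interpret prob_space M by (rule M)
  let ?I = "entry_indices d n"
  let ?\<sigma> = "sqrt (1 / (2 * real n))"
  interpret F: gaussian_family M "real_entry a n" ?I ?\<sigma>
    using g n by unfold_locales (auto simp: gaussian_entries_def real_entry_def entry_indices_def Let_def)
  show ?thesis
  proof
    show "0 < n" by (rule n)
    fix g :: gen and st and i j :: nat
    obtain s k l where g: "g = (s, k, l)" by (metis surj_pair)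
    let ?i = "if st then j else i" and ?j = "if st then i else j" and ?e = "if st then - \<i> else \<i>"
    show "conj_derivative a d n g st i j (\<lambda>\<omega>. c) (\<lambda>\<omega>. 0)" for c
      unfolding g conj_derivative.simps
      by (intro exI[of _ "\<lambda>\<omega>. 0"] conjI F.partial.const) (simp add: fun_eq_iff)
    show "conj_derivative a d n g st i j (\<lambda>\<omega>. f \<omega> + e \<omega>) (\<lambda>\<omega>. f' \<omega> + e' \<omega>)"
      if f: "conj_derivative a d n g st i j f f'" and e: "conj_derivative a d n g st i j e e'" for f f' e e'
    proof -
      from f obtain f1 f2 where f: "F.partial (Re, ?i, ?j, k, l, s) f f1" "F.partial (Im, ?i, ?j, k, l, s) f f2"
        "f' = (\<lambda>\<omega>. (f1 \<omega> + ?e * f2 \<omega>) / 2)" unfolding g conj_derivative.simps by blast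
      from e obtain e1 e2 where e: "F.partial (Re, ?i, ?j, k, l, s) e e1" "F.partial (Im, ?i, ?j, k, l, s) e e2"
        "e' = (\<lambda>\<omega>. (e1 \<omega> + ?e * e2 \<omega>) / 2)" unfolding g conj_derivative.simps by blast
      show ?thesis unfolding g conj_derivative.simps
        by (intro exI[of _ "\<lambda>\<omega>. f1 \<omega> + e1 \<omega>"] exI[of _ "\<lambda>\<omega>. f2 \<omega> + e2 \<omega>"] conjI
            F.partial.add[OF f(1) e(1)] F.partial.add[OF f(2) e(2)])
          (simp add: f(3) e(3) fun_eq_iff field_simps)
    qed
    show "conj_derivative a d n g st i j (\<lambda>\<omega>. f \<omega> * e \<omega>) (\<lambda>\<omega>. f' \<omega> * e \<omega> + f \<omega> * e' \<omega>)"
      if f: "conj_derivative a d n g st i j f f'" and e: "conj_derivative a d n g st i j e e'" for f f' e e'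
    proof -
      from f obtain f1 f2 where f: "F.partial (Re, ?i, ?j, k, l, s) f f1" "F.partial (Im, ?i, ?j, k, l, s) f f2"
        "f' = (\<lambda>\<omega>. (f1 \<omega> + ?e * f2 \<omega>) / 2)" unfolding g conj_derivative.simps by blast
      from e obtain e1 e2 where e: "F.partial (Re, ?i, ?j, k, l, s) e e1" "F.partial (Im, ?i, ?j, k, l, s) e e2"
        "e' = (\<lambda>\<omega>. (e1 \<omega> + ?e * e2 \<omega>) / 2)" unfolding g conj_derivative.simps by blast
      show ?thesis unfolding g conj_derivative.simps
        by (intro exI[of _ "\<lambda>\<omega>. f1 \<omega> * e \<omega> + f \<omega> * e1 \<omega>"] exI[of _ "\<lambda>\<omega>. f2 \<omega> * e \<omega> + f \<omega> * e2 \<omega>"] conjI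
            F.partial.mult[OF f(1) e(1)] F.partial.mult[OF f(2) e(2)])
          (simp add: f(3) e(3) fun_eq_iff field_simps)
    qed
    show "integrable M f" "integrable M f'" if f: "conj_derivative a d n g st i j f f'" for f f'
    proof -
      from f obtain f1 f2 where f: "F.partial (Re, ?i, ?j, k, l, s) f f1" "F.partial (Im, ?i, ?j, k, l, s) f f2"
        "f' = (\<lambda>\<omega>. (f1 \<omega> + ?e * f2 \<omega>) / 2)" unfolding g conj_derivative.simps by blast
      show "integrable M f" using F.partial_integrable[OF f(1)] by simp
      show "integrable M f'" unfolding f(3)
        using F.partial_integrable[OF f(1)] F.partial_integrable[OF f(2)]
        by (intro integrable_divide Bochner_Integration.integrable_add integrable_mult_right) auto
    qed
    show "(\<integral>\<omega>. gaussian_entry a n g st i j \<omega> * f \<omega> \<partial>M) = (\<integral>\<omega>. f' \<omega> \<partial>M) / of_nat n"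
      if "g \<in> {(s, k, l). k < d \<and> l < d}" "i < n" "j < n" and f: "conj_derivative a d n g st i j f f'" for f f'
    proof -
      from f obtain f1 f2 where f: "F.partial (Re, ?i, ?j, k, l, s) f f1" "F.partial (Im, ?i, ?j, k, l, s) f f2"
        "f' = (\<lambda>\<omega>. (f1 \<omega> + ?e * f2 \<omega>) / 2)" unfolding g conj_derivative.simps by blast
      have I: "(Re, ?i, ?j, k, l, s) \<in> ?I" "(Im, ?i, ?j, k, l, s) \<in> ?I"
        using that by (auto simp: g entry_indices_def)
      let ?X = "\<lambda>\<omega>. of_real (real_entry a n (Re, ?i, ?j, k, l, s) \<omega>) * f \<omega>"
      let ?Y = "\<lambda>\<omega>. of_real (real_entry a n (Im, ?i, ?j, k, l, s) \<omega>) * f \<omega>"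
      have int: "integrable M ?X" "integrable M ?Y"
        using F.partial_integrable(1)[OF F.partial.mult[OF F.partial.var[OF I(1)] f(1)]]
          F.partial_integrable(1)[OF F.partial.mult[OF F.partial.var[OF I(2)] f(1)]] by auto
      have entry: "gaussian_entry a n g st i j \<omega> * f \<omega> = ?X \<omega> + ?e * ?Y \<omega>" for \<omega>
      proof -
        have "gaussian_entry a n g st i j \<omega> = of_real (Re (a ?i ?j n k l s \<omega>)) + ?e * of_real (Im (a ?i ?j n k l s \<omega>))"
          by (cases st) (simp_all add: g complex_eq_iff)
        then show ?thesis by (simp add: real_entry_def algebra_simps)
      qed
      \<comment> \<open>The variance 1/(2n) of the real and imaginary parts and the factor 1/2 in
        \<open>conj_derivative\<close> combine to the factor 1/n.\<close>
      have \<sigma>2: "complex_of_real (?\<sigma>\<^sup>2) = 1 / (2 * of_nat n)" using n by simp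
      have "(\<integral>\<omega>. gaussian_entry a n g st i j \<omega> * f \<omega> \<partial>M) = (\<integral>\<omega>. ?X \<omega> \<partial>M) + ?e * (\<integral>\<omega>. ?Y \<omega> \<partial>M)"
        unfolding entry using int by simp
      also have "\<dots> = 1 / (2 * of_nat n) * ((\<integral>\<omega>. f1 \<omega> \<partial>M) + ?e * (\<integral>\<omega>. f2 \<omega> \<partial>M))"
        unfolding F.gaussian_integration_by_parts[OF f(1) I(1)] F.gaussian_integration_by_parts[OF f(2) I(2)] \<sigma>2
        by (simp add: algebra_simps)
      also have "\<dots> = (\<integral>\<omega>. f' \<omega> \<partial>M) / of_nat n"
        unfolding f(3) using F.partial_integrable[OF f(1)] F.partial_integrable[OF f(2)] by simp
      finally show ?thesis .
    qed
    show "conj_derivative a d n g st i j (gaussian_entry a n h t k' l')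
        (\<lambda>\<omega>. if h = g \<and> t \<noteq> st \<and> k' = j \<and> l' = i then 1 else 0)"
      if "g \<in> {(s, k, l). k < d \<and> l < d}" "h \<in> {(s, k, l). k < d \<and> l < d}" "i < n" "j < n" "k' < n" "l' < n"
      for h t k' l'
    proof -
      obtain s' p p' where h: "h = (s', p, p')" by (metis surj_pair)
      let ?k = "if t then l' else k'" and ?l = "if t then k' else l'" and ?c = "if t then - \<i> else \<i>"
      let ?R = "(Re, ?k, ?l, p, p', s')" and ?J = "(Im, ?k, ?l, p, p', s')"
      have I: "?R \<in> ?I" "?J \<in> ?I" using that by (auto simp: h entry_indices_def)
      have entry: "gaussian_entry a n h t k' l' =
          (\<lambda>\<omega>. of_real (real_entry a n ?R \<omega>) + ?c * of_real (real_entry a n ?J \<omega>))"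
        by (rule ext, cases t) (simp_all add: h complex_eq_iff real_entry_def)
      have P: "F.partial u (gaussian_entry a n h t k' l') (\<lambda>\<omega>. (if ?R = u then 1 else 0) +
          (0 * of_real (real_entry a n ?J \<omega>) + ?c * (if ?J = u then 1 else 0)))" for u
        unfolding entry by (intro F.partial.add F.partial.mult F.partial.const F.partial.var I)
      show ?thesis unfolding g conj_derivative.simps
      proof (rule exI, rule exI, intro conjI, rule P, rule P)
        \<comment> \<open>If \<open>t = st\<close>, the real and imaginary directions cancel, 1 +
          \<i> * \<i> = 0: the derivative is holomorphic in the wrong variable. If
          \<open>t \<noteq> st\<close>, they add up to 2, and half of this is 1.\<close>
        show "(\<lambda>\<omega>. if h = (s, k, l) \<and> t \<noteq> st \<and> k' = j \<and> l' = i then 1 else 0) =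
          (\<lambda>\<omega>. ((if ?R = (Re, ?i, ?j, k, l, s) then 1 else 0) +
            (0 * of_real (real_entry a n ?J \<omega>) + ?c * (if ?J = (Re, ?i, ?j, k, l, s) then 1 else 0)) +
            ?e * ((if ?R = (Im, ?i, ?j, k, l, s) then 1 else 0) +
            (0 * of_real (real_entry a n ?J \<omega>) + ?c * (if ?J = (Im, ?i, ?j, k, l, s) then 1 else 0)))) / 2)"
          by (rule ext, cases t; cases st) (auto simp: h Re_neq_Im)
      qed
    qed
  qed
qed

section \<open>Matrix words as words in constants and generators\<close>

datatype const_letter = CB nat bool | CD "nat \<Rightarrow> complex"

fun const_mat :: "nat \<Rightarrow> (nat \<Rightarrow> nat \<Rightarrow> nat) \<Rightarrow> (nat \<Rightarrow> nat \<Rightarrow> complex mat) \<Rightarrow> nat \<Rightarrow> const_letter \<Rightarrow> complex mat" where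
  "const_mat d q B n (CB j st) = (if st then mat_adjoint (B j n) else B j n)"
| "const_mat d q B n (CD c) = diag_blocks d q n c"

lemma diag_blocks_carrier: "diag_blocks d q n c \<in> carrier_mat n n"
  by (simp add: diag_blocks_def)

lemma mat_adjoint_eq: "X \<in> carrier_mat n m \<Longrightarrow> mat_adjoint X = mat m n (\<lambda>(i, j). cnj (X $$ (j, i)))"
  by (rule eq_matI) (auto simp: mat_adjoint_def mat_of_rows_def)

lemma const_mat_carrier:
  assumes "\<And>j. B j n \<in> carrier_mat n n"
  shows "const_mat d q B n k \<in> carrier_mat n n"
  using assms by (cases k) (simp_all add: diag_blocks_carrier mat_adjoint_eq[OF assms])

text \<open>The generator stands for the full Gaussian matrix with independent entries. The block
  structure is delegated to diagonal constants on both sides, which swap places for the adjoint;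
  thus the results on Gaussian words apply without any reference to blocks.\<close>

fun index_word :: "mat_index \<times> bool \<times> (nat \<Rightarrow> complex) \<Rightarrow> (const_letter, gen) letter list" where
  "index_word (B_index j, st, c) = [Const (CB j st), Const (CD c)]"
| "index_word (X_index s k l, st, c) =
     [Const (CD (\<lambda>i. if i = (if st then l else k) then 1 else 0)), Gen (s, k, l) st,
      Const (CD (\<lambda>i. if i = (if st then k else l) then 1 else 0)), Const (CD c)]"

context gaussian_words
begin

definition word_matrix :: "('k, 'g) letter list \<Rightarrow> 'w \<Rightarrow> complex mat" where
  "word_matrix w \<omega> = mat n n (\<lambda>(i, j). ent w i j \<omega>)"

lemma word_matrix_carrier: "word_matrix w \<omega> \<in> carrier_mat n n"
  by (simp add: word_matrix_def)

lemma word_matrix_Nil: "word_matrix [] \<omega> = 1\<^sub>m n"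
  by (rule eq_matI) (auto simp: word_matrix_def)

lemma word_matrix_append: "word_matrix (u @ v) \<omega> = word_matrix u \<omega> * word_matrix v \<omega>"
  by (rule eq_matI) (auto simp: word_matrix_def scalar_prod_def ent_append lessThan_atLeast0)

lemma word_matrix_Const: "word_matrix [Const k] \<omega> = mat n n (\<lambda>(i, j). K k i j)"
proof (rule eq_matI)
  fix i j assume "i < dim_row (mat n n (\<lambda>(i, j). K k i j))" "j < dim_col (mat n n (\<lambda>(i, j). K k i j))"
  moreover have "(\<Sum>r<n. K k i r * (if r = j then 1 else 0)) = (\<Sum>r<n. if r = j then K k i j else 0)"
    by (intro sum.cong) auto
  ultimately show "word_matrix [Const k] \<omega> $$ (i, j) = mat n n (\<lambda>(i, j). K k i j) $$ (i, j)"
    by (simp add: word_matrix_def)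
qed (simp_all add: word_matrix_def)

lemma word_matrix_Gen: "word_matrix [Gen g s] \<omega> = mat n n (\<lambda>(i, j). z g s i j \<omega>)"
proof (rule eq_matI)
  fix i j assume "i < dim_row (mat n n (\<lambda>(i, j). z g s i j \<omega>))" "j < dim_col (mat n n (\<lambda>(i, j). z g s i j \<omega>))"
  moreover have "(\<Sum>r<n. z g s i r \<omega> * (if r = j then 1 else 0)) = (\<Sum>r<n. if r = j then z g s i j \<omega> else 0)"
    by (intro sum.cong) auto
  ultimately show "word_matrix [Gen g s] \<omega> $$ (i, j) = mat n n (\<lambda>(i, j). z g s i j \<omega>) $$ (i, j)"
    by (simp add: word_matrix_def)
qed (simp_all add: word_matrix_def)

lemma mat_trace_word_matrix: "mat_trace (word_matrix w \<omega>) = of_nat n * tr w \<omega>"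
  using n_pos by (simp add: mat_trace_def word_matrix_def tr_def)

end

lemma mat_eta: "X \<in> carrier_mat n m \<Longrightarrow> mat n m (($$) X) = X"
  by (rule eq_matI) auto

text \<open>The projection matrices are real and diagonal, so the adjoint of the corner (k,l) is the
  corner (l,k) of the adjoint.\<close>

lemma block_gaussian_mat_adjoint:
  "mat_adjoint (block_gaussian_mat d q a s k l n \<omega>) =
    proj_mat d q n l * mat n n (\<lambda>(i, j). cnj (a j i n k l s \<omega>)) * proj_mat d q n k"
proof -
  define f where "f k i = (\<Sum>l<d. if i \<in> block q n l then (if l = k then 1 else 0) else (0 :: complex))" for k i
  have cnj_f: "cnj (f k i) = f k i" for k i
    unfolding f_def cnj_sum by (intro sum.cong) auto
  have P: "proj_mat d q n k = mat_diag n (f k)" for k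
    by (simp add: proj_mat_def diag_blocks_def f_def[abs_def])
  have triple: "mat_diag n u * mat n n h * mat_diag n v = mat n n (\<lambda>(i, j). u i * h (i, j) * v j)" for u v h
    by (rule eq_matI) (simp_all add: mat_diag_mult_left[of _ n n] mat_diag_mult_right[of _ n n])
  show ?thesis
    unfolding block_gaussian_mat_def P triple
    by (subst mat_adjoint_eq[of _ n n]) (auto intro!: eq_matI simp: cnj_f)
qed

lemma word_mat_carrier:
  assumes "\<And>i. i \<in> fst ` set w \<Longrightarrow> X i \<in> carrier_mat n n"
  shows "word_mat d q n X w \<in> carrier_mat n n"
  using assms
proof (induction w)
  case (Cons t w)
  obtain i st c where t: "t = (i, st, c)" by (metis surj_pair)
  have "X i \<in> carrier_mat n n" using Cons.prems[of i] by (simp add: t)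
  moreover from this have "mat_adjoint (X i) \<in> carrier_mat n n" by (simp add: mat_adjoint_eq)
  ultimately show ?case using Cons
    by (auto simp: word_mat_def t intro!: mult_carrier_mat[of _ n n] diag_blocks_carrier)
qed (simp add: word_mat_def)

lemma word_matrix_index_word:
  fixes a :: "nat \<Rightarrow> nat \<Rightarrow> nat \<Rightarrow> nat \<Rightarrow> nat \<Rightarrow> nat \<Rightarrow> 'w \<Rightarrow> complex"
  assumes gw: "gaussian_words M n (gaussian_entry a n) G der" and B: "\<And>j. B j n \<in> carrier_mat n n"
  shows "gaussian_words.word_matrix n (gaussian_entry a n) (\<lambda>k i j. const_mat d q B n k $$ (i, j))
      (concat (map index_word w)) \<omega> =
    word_mat d q n (\<lambda>i. mat_family B (block_gaussian_mat d q a) i n \<omega>) w"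
proof -
  interpret gaussian_words M n "gaussian_entry a n" G der "\<lambda>k i j. const_mat d q B n k $$ (i, j)" by (rule gw)
  show ?thesis
  proof (induction w)
    case Nil
    then show ?case by (simp add: word_matrix_Nil word_mat_def)
  next
    case (Cons t w)
    obtain i st c where t: "t = (i, st, c)" by (metis surj_pair)
    let ?X = "mat_family B (block_gaussian_mat d q a) i n \<omega>"
    have Const: "word_matrix [Const k] \<omega> = const_mat d q B n k" for k
      by (simp add: word_matrix_Const mat_eta[OF const_mat_carrier[where d = d and q = q and B = B, OF B]])
    have split: "word_matrix (l # u) \<omega> = word_matrix [l] \<omega> * word_matrix u \<omega>" for l u
      using word_matrix_append[of "[l]" u] by simp
    have "word_matrix (index_word t) \<omega> = (if st then mat_adjoint ?X else ?X) * diag_blocks d q n c"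
    proof (cases i)
      case (B_index j)
      have e: "word_matrix (index_word t) \<omega> = word_matrix [Const (CB j st)] \<omega> * word_matrix [Const (CD c)] \<omega>"
        using split[of "Const (CB j st)" "[Const (CD c)]"] by (simp add: t B_index)
      show ?thesis unfolding e Const by (simp add: B_index)
    next
      case (X_index s k l)
      let ?P = "\<lambda>m. proj_mat d q n m"
      have P: "const_mat d q B n (CD (\<lambda>i. if i = m then 1 else 0)) = ?P m" for m
        by (simp add: proj_mat_def)
      have Pc: "?P m \<in> carrier_mat n n" for m by (simp add: proj_mat_def diag_blocks_carrier)
      let ?u = "if st then l else k" and ?v = "if st then k else l"
      have e: "word_matrix (index_word t) \<omega> = word_matrix [Const (CD (\<lambda>i. if i = ?u then 1 else 0))] \<omega> *
          (word_matrix [Gen (s, k, l) st] \<omega> * (word_matrix [Const (CD (\<lambda>i. if i = ?v then 1 else 0))] \<omega> *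
          word_matrix [Const (CD c)] \<omega>))"
        unfolding t X_index index_word.simps
        by (subst split, subst (2) split, subst (3) split) (rule refl)
      have "word_matrix (index_word t) \<omega> = ?P ?u * (mat n n (\<lambda>(i, j). gaussian_entry a n (s, k, l) st i j \<omega>) *
          (?P ?v * diag_blocks d q n c))"
        unfolding e Const P word_matrix_Gen by simp
      also have "\<dots> = (?P ?u * mat n n (\<lambda>(i, j). gaussian_entry a n (s, k, l) st i j \<omega>) * ?P ?v) *
          diag_blocks d q n c"
        using Pc[of ?u] Pc[of ?v] diag_blocks_carrier[of d q n c]
        by (simp add: assoc_mult_mat[of _ n n _ n _ n] mult_carrier_mat[of _ n n _ n])
      also have "?P ?u * mat n n (\<lambda>(i, j). gaussian_entry a n (s, k, l) st i j \<omega>) * ?P ?v =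
          (if st then mat_adjoint ?X else ?X)"
      proof (cases st)
        case True
        then show ?thesis by (simp add: X_index block_gaussian_mat_adjoint)
      next
        case False
        then show ?thesis by (simp add: X_index block_gaussian_mat_def)
      qed
      finally show ?thesis .
    qed
    then show ?case
      using Cons by (simp add: word_matrix_append t word_mat_def)
  qed
qed

section \<open>Block sums, block traces and the limits of constant words\<close>

text \<open>The blocks are consecutive and disjoint, so at most one summand survives: the block of
  \<open>i\<close> is the one at which the partial sums of the block sizes exceed \<open>i\<close>
  for the smallest index. With this formula products of block diagonal matrices are computed
  entrywise.\<close>

lemma sum_blocks:
  "(\<Sum>k<m. if i \<in> block q n k then f k else 0) = (if i < (\<Sum>l<m. q l n) then
     f (LEAST k. i < (\<Sum>l\<le>k. q l n)) else (0 :: complex))"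
proof (induction m)
  case (Suc m)
  have S: "(\<Sum>l<Suc m. q l n) = (\<Sum>l\<le>m. q l n)" by (simp add: lessThan_Suc_atMost)
  show ?case
  proof (cases "i < (\<Sum>l<m. q l n)")
    case True
    then show ?thesis using Suc by (simp add: block_def)
  next
    case False
    show ?thesis
    proof (cases "i < (\<Sum>l\<le>m. q l n)")
      case True
      have "(LEAST k. i < (\<Sum>l\<le>k. q l n)) = m"
      proof (rule Least_equality)
        fix k assume "i < (\<Sum>l\<le>k. q l n)"
        show "m \<le> k"
        proof (rule ccontr)
          assume "\<not> m \<le> k"
          then have "(\<Sum>l\<le>k. q l n) \<le> (\<Sum>l<m. q l n)" by (intro sum_mono2) auto
          then show False using False \<open>i < (\<Sum>l\<le>k. q l n)\<close> by simp
        qed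
      qed (rule True)
      then show ?thesis using Suc False True S by (simp add: block_def)
    next
      case F: False
      then show ?thesis using Suc False S by (simp add: block_def)
    qed
  qed
qed simp

lemma block_card: "(\<Sum>i<n. if i \<in> block q n k then 1 else 0 :: complex) = of_nat (q k n)"
  if "(\<Sum>l<d. q l n) = n" "k < d"
proof -
  have "(\<Sum>l\<le>k. q l n) \<le> (\<Sum>l<d. q l n)" using that by (intro sum_mono2) auto
  then have "{..<n} \<inter> block q n k = block q n k" using that by (auto simp: block_def)
  then have "(\<Sum>i<n. if i \<in> block q n k then 1 else 0 :: complex) = of_nat (card (block q n k))"
    by (simp add: sum.inter_restrict[symmetric])
  also have "card (block q n k) = q k n"
    by (simp add: block_def lessThan_Suc_atMost[symmetric])
  finally show ?thesis .
qed

lemma diag_blocks_mult: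
  assumes "(\<Sum>k<d. q k n) = n"
  shows "diag_blocks d q n c * diag_blocks d q n c' = diag_blocks d q n (\<lambda>k. c k * c' k)"
  unfolding diag_blocks_def mat_diag_diag sum_blocks by (auto simp: assms mat_diag_def intro!: eq_matI)

lemma diag_blocks_one:
  assumes "(\<Sum>k<d. q k n) = n"
  shows "diag_blocks d q n (\<lambda>_. 1) = 1\<^sub>m n"
  unfolding diag_blocks_def sum_blocks by (auto simp: assms mat_diag_def intro!: eq_matI)

lemma mat_trace_compress:
  assumes "W \<in> carrier_mat n n" "k < d"
  shows "mat_trace (proj_mat d q n k * W * proj_mat d q n k) =
    (\<Sum>i<n. if i \<in> block q n k then W $$ (i, i) else 0)"
proof -
  let ?f = "\<lambda>i. \<Sum>l<d. if i \<in> block q n l then (if l = k then 1 else 0) else (0 :: complex)"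
  have f: "?f i = (if i \<in> block q n k then 1 else 0)" for i
  proof -
    have "?f i = (\<Sum>l<d. if l = k then (if i \<in> block q n k then 1 else 0) else 0)"
      by (intro sum.cong) auto
    then show ?thesis using assms(2) by simp
  qed
  have "proj_mat d q n k * W * proj_mat d q n k = mat n n (\<lambda>(i, j). ?f i * W $$ (i, j) * ?f j)"
    using assms(1) unfolding proj_mat_def diag_blocks_def
    by (auto simp: mat_diag_mult_left[of _ n n] mat_diag_mult_right[of _ n n] intro!: eq_matI)
  then show ?thesis by (auto simp: mat_trace_def f intro!: sum.cong)
qed

lemma mat_trace_diag_blocks:
  assumes "W \<in> carrier_mat n n"
  shows "mat_trace (diag_blocks d q n c * W) =
    (\<Sum>k<d. c k * mat_trace (proj_mat d q n k * W * proj_mat d q n k))"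
proof -
  have "mat_trace (diag_blocks d q n c * W) =
      (\<Sum>i<n. (\<Sum>k<d. if i \<in> block q n k then c k else 0) * W $$ (i, i))"
    unfolding diag_blocks_def using assms
    by (simp add: mat_diag_mult_left[of _ n n] mat_trace_def)
  also have "\<dots> = (\<Sum>i<n. \<Sum>k<d. c k * (if i \<in> block q n k then W $$ (i, i) else 0))"
    unfolding sum_distrib_right by (intro sum.cong) auto
  also have "\<dots> = (\<Sum>k<d. c k * (\<Sum>i<n. if i \<in> block q n k then W $$ (i, i) else 0))"
    unfolding sum_distrib_left by (rule sum.swap)
  also have "\<dots> = (\<Sum>k<d. c k * mat_trace (proj_mat d q n k * W * proj_mat d q n k))"
    using assms by (intro sum.cong refl) (simp add: mat_trace_compress)
  finally show ?thesis .
qed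

lemma tendsto_block_ratio:
  assumes "(\<lambda>n. of_nat (q n) / of_nat n :: complex) \<longlonglongrightarrow> \<rho>" "\<rho> \<noteq> 0"
  shows "(\<lambda>n. of_nat n / of_nat (q n) :: complex) \<longlonglongrightarrow> 1 / \<rho>"
  using tendsto_inverse[OF assms] by (simp add: inverse_eq_divide)

fun const_limit ::
    "('c, 'm) star_prob_space_scheme \<Rightarrow> nat \<Rightarrow> (nat \<Rightarrow> 'c) \<Rightarrow> (nat \<Rightarrow> 'c) \<Rightarrow> const_letter \<Rightarrow> 'c" where
  "const_limit C d P b (CB j st) = (if st then involution C (b j) else b j)"
| "const_limit C d P b (CD c) = diag_elem C d P c"

lemma (in diag_prob_space) word_alg_closed:
  assumes "\<And>i. i \<in> fst ` set w \<Longrightarrow> x i \<in> carrier A"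
  shows "word_alg A d p x w \<in> carrier A"
  using assms
proof (induction w)
  case (Cons t w)
  obtain i st c where t: "t = (i, st, c)" by (metis surj_pair)
  have "x i \<in> carrier A" using Cons.prems[of i] by (simp add: t)
  moreover have "word_alg A d p x w \<in> carrier A" using Cons by simp
  ultimately show ?case
    by (simp add: word_alg_def t times_closed involution_closed diag_elem_closed)
qed (simp add: word_alg_def unit_closed)

text \<open>Convergence in distribution is assumed only for words in which each matrix is followed
  by exactly one diagonal element. Adjacent diagonal elements are merged, missing ones are filled in
  by the unit, and a diagonal element in front is split off. One pair \<open>c\<close>,
  \<open>w\<close> serves all n and the limit algebra at once.\<close>

lemma const_normal_form:
  assumes C: "diag_prob_space C d P" and b: "\<And>j. b j \<in> carrier C"
    and q: "\<And>n. d \<le> n \<Longrightarrow> (\<Sum>k<d. q k n) = n"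
    and B: "\<And>j n. d \<le> n \<Longrightarrow> B j n \<in> carrier_mat n n"
  shows "\<exists>c w. (\<forall>n. d \<le> n \<longrightarrow> foldr (\<lambda>k X. const_mat d q B n k * X) ks (1\<^sub>m n) =
      diag_blocks d q n c * word_mat d q n (\<lambda>j. B j n) w) \<and>
    foldr (\<otimes>\<^bsub>C\<^esub>) (map (const_limit C d P b) ks) \<one>\<^bsub>C\<^esub> =
      diag_elem C d P c \<otimes>\<^bsub>C\<^esub> word_alg C d P b w"
proof (induction ks)
  case Nil
  interpret C: diag_prob_space C d P by (rule C)
  show ?case
    using q by (intro exI[of _ "\<lambda>_. 1"] exI[of _ "[]"])
      (simp add: word_mat_def word_alg_def diag_blocks_one C.diag_elem_one C.times_one C.unit_closed)
next
  case (Cons k ks)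
  interpret C: diag_prob_space C d P by (rule C)
  obtain c w where IH: "\<And>n. d \<le> n \<Longrightarrow> foldr (\<lambda>k X. const_mat d q B n k * X) ks (1\<^sub>m n) =
      diag_blocks d q n c * word_mat d q n (\<lambda>j. B j n) w"
    "foldr (\<otimes>\<^bsub>C\<^esub>) (map (const_limit C d P b) ks) \<one>\<^bsub>C\<^esub> =
      diag_elem C d P c \<otimes>\<^bsub>C\<^esub> word_alg C d P b w"
    using Cons by blast
  have W: "word_mat d q n (\<lambda>j. B j n) w \<in> carrier_mat n n" if "d \<le> n" for n
    using B[OF that] by (intro word_mat_carrier)
  have w: "word_alg C d P b w \<in> carrier C" using b by (intro C.word_alg_closed)
  show ?case
  proof (cases k)
    case (CB j st)
    have X: "const_mat d q B n k \<in> carrier_mat n n" if "d \<le> n" for n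
      using B[OF that] by (rule const_mat_carrier)
    have "const_mat d q B n k * (diag_blocks d q n c * word_mat d q n (\<lambda>j. B j n) w) =
        diag_blocks d q n (\<lambda>_. 1) * word_mat d q n (\<lambda>j. B j n) ((j, st, c) # w)" if n: "d \<le> n" for n
    proof -
      have "word_mat d q n (\<lambda>j. B j n) ((j, st, c) # w) =
          const_mat d q B n k * diag_blocks d q n c * word_mat d q n (\<lambda>j. B j n) w"
        by (simp add: word_mat_def CB)
      also have "\<dots> = const_mat d q B n k * (diag_blocks d q n c * word_mat d q n (\<lambda>j. B j n) w)"
        using X[OF n] W[OF n] diag_blocks_carrier by (intro assoc_mult_mat)
      finally show ?thesis
        using diag_blocks_one[where d = d and q = q and n = n, OF q[OF n]] X[OF n] W[OF n] diag_blocks_carrier[of d q n c]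
        by (simp add: mult_carrier_mat[of _ n n _ n])
    qed
    moreover have "const_limit C d P b k \<otimes>\<^bsub>C\<^esub> (diag_elem C d P c \<otimes>\<^bsub>C\<^esub> word_alg C d P b w) =
        diag_elem C d P (\<lambda>_. 1) \<otimes>\<^bsub>C\<^esub> word_alg C d P b ((j, st, c) # w)"
    proof -
      have k: "const_limit C d P b k \<in> carrier C" using b by (simp add: CB C.involution_closed)
      have "word_alg C d P b ((j, st, c) # w) =
          const_limit C d P b k \<otimes>\<^bsub>C\<^esub> diag_elem C d P c \<otimes>\<^bsub>C\<^esub> word_alg C d P b w"
        by (simp add: word_alg_def CB)
      then show ?thesis using k w
        by (simp add: C.diag_elem_one C.times_one C.times_closed C.diag_elem_closed C.times_assoc)
    qed
    ultimately show ?thesis using IH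
      by (intro exI[of _ "\<lambda>_. 1"] exI[of _ "(j, st, c) # w"]) simp
  next
    case (CD c')
    have "diag_blocks d q n c' * (diag_blocks d q n c * word_mat d q n (\<lambda>j. B j n) w) =
        diag_blocks d q n (\<lambda>k. c' k * c k) * word_mat d q n (\<lambda>j. B j n) w" if n: "d \<le> n" for n
      using W[OF n] diag_blocks_mult[where d = d and q = q and n = n and c = c' and c' = c, OF q[OF n], symmetric]
        assoc_mult_mat[OF diag_blocks_carrier[of d q n c'] diag_blocks_carrier[of d q n c] W[OF n]] by simp
    moreover have "diag_elem C d P c' \<otimes>\<^bsub>C\<^esub> (diag_elem C d P c \<otimes>\<^bsub>C\<^esub> word_alg C d P b w) =
        diag_elem C d P (\<lambda>k. c' k * c k) \<otimes>\<^bsub>C\<^esub> word_alg C d P b w"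
      using w by (simp add: C.diag_elem_mult[symmetric] C.diag_elem_closed C.times_assoc)
    ultimately show ?thesis using IH
      by (intro exI[of _ "\<lambda>k. c' k * c k"] exI[of _ w]) (simp add: CD)
  qed
qed

text \<open>The normalized trace is the average of the block averages with weights
  \<open>q k n / n\<close>, and these weights converge to the states of the projections. The leading
  diagonal factor of the normal form enters through its coordinates.\<close>

lemma const_trace_limit:
  assumes M: "prob_space M" and C: "diag_prob_space C d P"
    and q: "\<And>n. d \<le> n \<Longrightarrow> (\<Sum>k<d. q k n) = n" and q_pos: "\<And>k n. d \<le> n \<Longrightarrow> k < d \<Longrightarrow> 0 < q k n"
    and q_lim: "\<And>k. k < d \<Longrightarrow> (\<lambda>n. of_nat (q k n) / of_nat n) \<longlonglongrightarrow> state C (P k)"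
    and B: "\<And>j n. d \<le> n \<Longrightarrow> B j n \<in> carrier_mat n n"
    and conv: "converges_in_diag_distribution M d q UNIV (\<lambda>j n _. B j n) C P b"
  shows "(\<lambda>n. mat_trace (foldr (\<lambda>k X. const_mat d q B n k * X) ks (1\<^sub>m n)) / of_nat n)
    \<longlonglongrightarrow> state C (foldr (\<otimes>\<^bsub>C\<^esub>) (map (const_limit C d P b) ks) \<one>\<^bsub>C\<^esub>)"
proof -
  interpret C: diag_prob_space C d P by (rule C)
  interpret prob_space M by (rule M)
  have b: "b j \<in> carrier C" for j using conv by (auto simp: converges_in_diag_distribution_def)
  obtain c w where nf: "\<And>n. d \<le> n \<Longrightarrow> foldr (\<lambda>k X. const_mat d q B n k * X) ks (1\<^sub>m n) =
      diag_blocks d q n c * word_mat d q n (\<lambda>j. B j n) w"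
    "foldr (\<otimes>\<^bsub>C\<^esub>) (map (const_limit C d P b) ks) \<one>\<^bsub>C\<^esub> =
      diag_elem C d P c \<otimes>\<^bsub>C\<^esub> word_alg C d P b w"
    using const_normal_form[where C = C and d = d and P = P and b = b and q = q and B = B and ks = ks, OF C b q B]
    by blast
  let ?W = "\<lambda>n. word_mat d q n (\<lambda>j. B j n) w"
  let ?w = "word_alg C d P b w"
  have W: "?W n \<in> carrier_mat n n" if "d \<le> n" for n
    using B[OF that] by (intro word_mat_carrier)
  have w: "?w \<in> carrier C" using b by (intro C.word_alg_closed)
  let ?t = "\<lambda>n k. mat_trace (proj_mat d q n k * ?W n * proj_mat d q n k)"
  have coord: "(\<lambda>n. ?t n k / of_nat (q k n)) \<longlonglongrightarrow> cond_exp_coord C P ?w k" if k: "k < d" for k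
  proof (cases "w = []")
    \<comment> \<open>The assumed convergence covers nonempty words only; for the empty word both
      the block average and its limit are 1.\<close>
    case True
    have "eventually (\<lambda>n. ?t n k / of_nat (q k n) = 1) sequentially"
    proof (rule eventually_sequentiallyI[of d])
      fix n assume n: "d \<le> n"
      have "?t n k = (\<Sum>i<n. if i \<in> block q n k then 1 else 0)"
        unfolding mat_trace_compress[OF W[OF n] k] by (intro sum.cong) (auto simp: True word_mat_def)
      also have "\<dots> = of_nat (q k n)" by (rule block_card[where d = d and q = q and n = n and k = k, OF q[OF n] k])
      finally show "?t n k / of_nat (q k n) = 1" using q_pos[OF n k] by simp
    qed
    moreover have "cond_exp_coord C P ?w k = 1"
      using k by (simp add: True word_alg_def cond_exp_coord_def C.proj_closed C.times_one C.proj_idem C.proj_state)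
    ultimately show ?thesis by (simp add: tendsto_eventually)
  next
    case False
    then show ?thesis
      using conv k by (auto simp: converges_in_diag_distribution_def mat_cond_exp_def prob_space)
  qed
  \<comment> \<open>Multiplying and dividing by \<open>q k n\<close> separates the weight of a block
    from its average.\<close>
  have "(\<lambda>n. \<Sum>k<d. c k * (of_nat (q k n) / of_nat n) * (?t n k / of_nat (q k n))) \<longlonglongrightarrow>
      (\<Sum>k<d. c k * state C (P k) * cond_exp_coord C P ?w k)"
    using q_lim coord by (intro tendsto_sum tendsto_mult tendsto_const) auto
  also have "(\<Sum>k<d. c k * state C (P k) * cond_exp_coord C P ?w k) = state C (diag_elem C d P c \<otimes>\<^bsub>C\<^esub> ?w)"
  proof -
    have "state C (diag_elem C d P c \<otimes>\<^bsub>C\<^esub> ?w) = (\<Sum>k<d. c k * state C (?w \<otimes>\<^bsub>C\<^esub> P k))"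
      using w by (simp add: C.state_trace[OF C.diag_elem_closed w] C.state_times_diag_elem)
    also have "\<dots> = (\<Sum>k<d. c k * state C (P k) * cond_exp_coord C P ?w k)"
    proof (intro sum.cong refl)
      fix k assume "k \<in> {..<d}"
      then have k: "k < d" by simp
      have "cond_exp_coord C P ?w k = state C (?w \<otimes>\<^bsub>C\<^esub> P k) / state C (P k)"
        by (simp only: cond_exp_coord_def C.state_proj_compress[OF k w] C.state_trace[OF C.proj_closed[OF k] w])
      then show "c k * state C (?w \<otimes>\<^bsub>C\<^esub> P k) = c k * state C (P k) * cond_exp_coord C P ?w k"
        using C.proj_state[OF k] by simp
    qed
    finally show ?thesis by simp
  qed
  finally have lim: "(\<lambda>n. \<Sum>k<d. c k * (of_nat (q k n) / of_nat n) * (?t n k / of_nat (q k n))) \<longlonglongrightarrow>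
      state C (foldr (\<otimes>\<^bsub>C\<^esub>) (map (const_limit C d P b) ks) \<one>\<^bsub>C\<^esub>)"
    by (simp add: nf(2))
  have "eventually (\<lambda>n. (\<Sum>k<d. c k * (of_nat (q k n) / of_nat n) * (?t n k / of_nat (q k n))) =
      mat_trace (foldr (\<lambda>k X. const_mat d q B n k * X) ks (1\<^sub>m n)) / of_nat n) sequentially"
  proof (rule eventually_sequentiallyI[of d])
    fix n assume n: "d \<le> n"
    have "(\<Sum>k<d. c k * (of_nat (q k n) / of_nat n) * (?t n k / of_nat (q k n))) = (\<Sum>k<d. c k * ?t n k) / of_nat n"
      unfolding sum_divide_distrib
    proof (intro sum.cong refl)
      fix k assume "k \<in> {..<d}"
      then have "q k n \<noteq> 0" using q_pos[OF n, of k] by simp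
      then show "c k * (of_nat (q k n) / of_nat n) * (?t n k / of_nat (q k n)) = c k * ?t n k / of_nat n" by simp
    qed
    then show "(\<Sum>k<d. c k * (of_nat (q k n) / of_nat n) * (?t n k / of_nat (q k n))) =
      mat_trace (foldr (\<lambda>k X. const_mat d q B n k * X) ks (1\<^sub>m n)) / of_nat n"
      by (simp add: nf(1)[OF n] mat_trace_diag_blocks[OF W[OF n]])
  qed
  then show ?thesis using lim by (rule Lim_transform_eventually[rotated])
qed

section \<open>Quotients of the free algebra\<close>

text \<open>A copy of the list type whose addition is concatenation, so that the convolution product
  of finitely supported functions is the product of the free algebra.\<close>

datatype 'l free_word = FW (unFW: "'l list")

instantiation free_word :: (type) monoid_add
begin
definition "0 = FW []"
definition "u + v = FW (unFW u @ unFW v)"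
instance by standard (simp_all add: zero_free_word_def plus_free_word_def)
end

type_synonym 'l free_alg = "'l free_word \<Rightarrow>\<^sub>0 complex"

abbreviation single where "single \<equiv> Poly_Mapping.single"
abbreviation lookup where "lookup \<equiv> Poly_Mapping.lookup"
abbreviation keys where "keys \<equiv> Poly_Mapping.keys"

definition word :: "'l list \<Rightarrow> 'l free_alg" where
  "word u = single (FW u) 1"

definition scalar :: "complex \<Rightarrow> 'l free_alg" where
  "scalar c = single 0 c"

lemma word_mult: "word u * word v = word (u @ v)"
  by (simp add: word_def mult_single plus_free_word_def)

lemma word_Nil: "word [] = 1"
  by (simp add: word_def flip: zero_free_word_def)

lemma scalar_word: "scalar c * word u = single (FW u) c"
  by (simp add: word_def scalar_def mult_single)

lemma free_alg_eq_sum: "f = (\<Sum>w\<in>keys f. scalar (lookup f w) * word (unFW w))"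
proof (rule poly_mapping_eqI)
  fix k
  have "lookup (\<Sum>w\<in>keys f. scalar (lookup f w) * word (unFW w)) k =
      (\<Sum>w\<in>keys f. lookup f w when w = k)"
    by (simp add: scalar_word lookup_sum lookup_single)
  also have "\<dots> = (\<Sum>w\<in>keys f. if w = k then lookup f k else 0)"
    by (intro sum.cong) (auto simp: when_def)
  also have "\<dots> = lookup f k"
    by (simp add: in_keys_iff)
  finally show "lookup f k = lookup (\<Sum>w\<in>keys f. scalar (lookup f w) * word (unFW w)) k" ..
qed

lemma free_alg_induct [case_names zero monom add]:
  assumes "P 0" "\<And>c u. P (scalar c * word u)" "\<And>f g. P f \<Longrightarrow> P g \<Longrightarrow> P (f + g)"
  shows "P f"
proof -
  have "P (\<Sum>w\<in>K. scalar (lookup f w) * word (unFW w))" if "finite K" for K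
    using that by (induction K rule: finite_induct) (auto intro: assms)
  from this[of "keys f"] show ?thesis using free_alg_eq_sum[of f] by simp
qed

lemma scalar_commute: "scalar c * f = f * scalar c"
proof (induction f rule: free_alg_induct)
  case (monom a u)
  then show ?case by (simp add: scalar_def word_def mult_single mult.commute)
qed (simp_all add: algebra_simps)

lemma scalar_simps:
  "scalar (a + b) = scalar a + scalar b" "scalar (a * b) = scalar a * scalar b"
  "scalar 1 = 1" "scalar 0 = 0"
  by (simp_all add: scalar_def single_add mult_single)

definition lin_ext :: "('l list \<Rightarrow> complex) \<Rightarrow> 'l free_alg \<Rightarrow> complex" where
  "lin_ext h f = (\<Sum>w\<in>keys f. lookup f w * h (unFW w))"

lemma lin_ext_add: "lin_ext h (f + g) = lin_ext h f + lin_ext h g"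
  unfolding lin_ext_def by (rule setsum_keys_plus_distrib) (simp_all add: algebra_simps)

lemma lin_ext_single [simp]: "lin_ext h (single (FW u) c) = c * h u"
  by (simp add: lin_ext_def)

lemma lin_ext_zero [simp]: "lin_ext h 0 = 0"
  by (simp add: lin_ext_def)

lemma lin_ext_word [simp]: "lin_ext h (word u) = h u"
  by (simp add: word_def)

lemma lin_ext_scalar: "lin_ext h (scalar c * f) = c * lin_ext h f"
proof (induction f rule: free_alg_induct)
  case (monom a u)
  then show ?case by (simp add: scalar_word mult.assoc flip: scalar_simps)
    (metis scalar_word scalar_simps(2) lin_ext_single mult.assoc)
qed (simp_all add: distrib_left lin_ext_add)

lemma lin_ext_minus: "lin_ext h (f - g) = lin_ext h f - lin_ext h g"
  using lin_ext_add[of h "f - g" g] by simp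

lemma lin_ext_sum: "lin_ext h (\<Sum>i\<in>I. f i) = (\<Sum>i\<in>I. lin_ext h (f i))"
  by (induction I rule: infinite_finite_induct) (auto simp: lin_ext_add)

definition star_ext :: "('l \<Rightarrow> 'l) \<Rightarrow> 'l free_alg \<Rightarrow> 'l free_alg" where
  "star_ext s f = (\<Sum>w\<in>keys f. single (FW (rev (map s (unFW w)))) (cnj (lookup f w)))"

lemma star_ext_add: "star_ext s (f + g) = star_ext s f + star_ext s g"
  unfolding star_ext_def by (rule setsum_keys_plus_distrib) (simp_all add: single_add)

lemma star_ext_zero [simp]: "star_ext s 0 = 0"
  by (simp add: star_ext_def)

lemma star_ext_single: "star_ext s (single (FW u) c) = single (FW (rev (map s u))) (cnj c)"
  by (simp add: star_ext_def)

lemma star_ext_word: "star_ext s (word u) = word (rev (map s u))"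
  by (simp add: word_def star_ext_single)

lemma star_ext_minus: "star_ext s (f - g) = star_ext s f - star_ext s g"
  using star_ext_add[of s "f - g" g] by (simp add: algebra_simps)

lemma star_ext_scalar: "star_ext s (scalar c * f) = scalar (cnj c) * star_ext s f"
proof (induction f rule: free_alg_induct)
  case (monom a u)
  have "scalar c * (scalar a * word u) = single (FW u) (c * a)"
    by (metis scalar_word scalar_simps(2) mult.assoc)
  moreover have "scalar (cnj c) * single (FW v) b = single (FW v) (cnj c * b)" for v :: "'a list" and b :: complex
    by (simp add: scalar_def mult_single)
  ultimately show ?case by (simp add: scalar_word star_ext_single)
qed (simp_all add: distrib_left star_ext_add)

lemma star_ext_mult: "star_ext s (f * g) = star_ext s g * star_ext s f"
proof (induction f rule: free_alg_induct)
  case (monom a u)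
  show ?case
  proof (induction g rule: free_alg_induct)
    case (monom b v)
    show ?case by (simp add: scalar_word mult_single plus_free_word_def star_ext_single mult.commute)
  qed (simp_all add: algebra_simps star_ext_add)
qed (simp_all add: algebra_simps star_ext_add)

lemma star_ext_star_ext:
  assumes "\<And>l. s (s l) = l"
  shows "star_ext s (star_ext s f) = f"
proof (induction f rule: free_alg_induct)
  case (monom a u)
  have "rev (map s (rev (map s u))) = u"
    by (simp add: rev_map comp_def assms)
  then show ?case by (simp add: scalar_word star_ext_single)
qed (simp_all add: star_ext_add)

text \<open>Two kinds of data on the free algebra: a positive trace \<tau>, and an evaluation
  \<open>evl\<close> in an algebra already at hand. The axioms on \<open>sl\<close> hold for all
  letters, which forces values even for letters without meaning.\<close>

locale word_state = C: tracial_star_prob_space C for C :: "('c, 'm) star_prob_space_scheme" +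
  fixes evl :: "'l \<Rightarrow> 'c" and sl :: "'l \<Rightarrow> 'l" and \<tau> :: "'l list \<Rightarrow> complex"
  assumes evl_closed: "evl l \<in> carrier C"
    and evl_star: "evl (sl l) = involution C (evl l)"
    and sl_sl: "sl (sl l) = l"
    and \<tau>_Nil: "\<tau> [] = 1"
    and \<tau>_commute: "\<tau> (u @ v) = \<tau> (v @ u)"
    and \<tau>_star: "\<tau> (rev (map sl w)) = cnj (\<tau> w)"
    and \<tau>_positive: "finite W \<Longrightarrow> (\<Sum>u\<in>W. \<Sum>v\<in>W. cnj (a u) * a v * \<tau> (rev (map sl u) @ v)) \<in> \<real>\<^sub>\<ge>\<^sub>0"
begin

definition evw :: "'l list \<Rightarrow> 'c" where
  "evw u = foldr (\<lambda>l x. evl l \<otimes>\<^bsub>C\<^esub> x) u \<one>\<^bsub>C\<^esub>"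

lemma evw_simps: "evw [] = \<one>\<^bsub>C\<^esub>" "evw (l # u) = evl l \<otimes>\<^bsub>C\<^esub> evw u"
  by (simp_all add: evw_def)

lemma evw_closed: "evw u \<in> carrier C"
  by (induction u) (simp_all add: evw_simps C.alg_closed evl_closed)

lemma evw_append: "evw (u @ v) = evw u \<otimes>\<^bsub>C\<^esub> evw v"
  by (induction u) (simp_all add: evw_simps C.alg_closed evl_closed evw_closed C.times_assoc C.times_one)

lemma evw_star: "evw (rev (map sl u)) = involution C (evw u)"
  by (induction u)
    (simp_all add: evw_append evw_simps C.involution_one C.involution_mult C.times_one evl_closed evl_star
      evw_closed C.involution_closed)

definition ev :: "'l free_alg \<Rightarrow> 'c" where
  "ev f = (\<Oplus>\<^bsub>C\<^esub>w\<in>keys f. lookup f w \<odot>\<^bsub>C\<^esub> evw (unFW w))"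

lemma ev_superset:
  assumes "finite K" "keys f \<subseteq> K"
  shows "ev f = (\<Oplus>\<^bsub>C\<^esub>w\<in>K. lookup f w \<odot>\<^bsub>C\<^esub> evw (unFW w))"
proof -
  have "(\<Oplus>\<^bsub>C\<^esub>w\<in>keys f \<union> J. lookup f w \<odot>\<^bsub>C\<^esub> evw (unFW w)) = ev f"
    if "finite J" "J \<inter> keys f = {}" for J
    using that
  proof (induction J rule: finite_induct)
    case empty
    then show ?case by (simp add: ev_def)
  next
    case (insert w J)
    have "(\<Oplus>\<^bsub>C\<^esub>w\<in>insert w (keys f \<union> J). lookup f w \<odot>\<^bsub>C\<^esub> evw (unFW w)) =
        lookup f w \<odot>\<^bsub>C\<^esub> evw (unFW w) \<oplus>\<^bsub>C\<^esub> (\<Oplus>\<^bsub>C\<^esub>w\<in>keys f \<union> J. lookup f w \<odot>\<^bsub>C\<^esub> evw (unFW w))"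
      using insert by (intro C.linear_comb_insert) (auto simp: evw_closed)
    moreover have "lookup f w = 0" using insert.prems by (auto simp: in_keys_iff)
    ultimately show ?case using insert
      by (simp add: C.scale_zero(2) evw_closed C.plus_zero ev_def C.linear_comb_closed)
  qed
  moreover have "(K - keys f) \<inter> keys f = {}" "keys f \<union> (K - keys f) = K" using assms by blast+
  ultimately show ?thesis using assms by (metis finite_Diff)
qed

lemma ev_closed: "ev f \<in> carrier C"
  unfolding ev_def by (intro C.linear_comb_closed) (auto simp: evw_closed)

lemma ev_zero: "ev 0 = \<zero>\<^bsub>C\<^esub>"
  by (simp add: ev_def C.linear_comb_empty)

lemma ev_single: "ev (single (FW u) c) = c \<odot>\<^bsub>C\<^esub> evw u"
proof -
  have "ev (single (FW u) c) = (\<Oplus>\<^bsub>C\<^esub>w\<in>{FW u}. lookup (single (FW u) c) w \<odot>\<^bsub>C\<^esub> evw (unFW w))"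
    by (rule ev_superset) auto
  also have "\<dots> = c \<odot>\<^bsub>C\<^esub> evw u"
    by (subst C.linear_comb_insert) (auto simp: evw_closed C.linear_comb_empty C.plus_zero C.alg_closed)
  finally show ?thesis .
qed

lemma plus_swap:
  assumes "a \<in> carrier C" "b \<in> carrier C" "c \<in> carrier C" "d \<in> carrier C"
  shows "(a \<oplus>\<^bsub>C\<^esub> b) \<oplus>\<^bsub>C\<^esub> (c \<oplus>\<^bsub>C\<^esub> d) = (a \<oplus>\<^bsub>C\<^esub> c) \<oplus>\<^bsub>C\<^esub> (b \<oplus>\<^bsub>C\<^esub> d)"
proof -
  note am = abelian_group.axioms(1)[OF ring.is_abelian_group[OF C.ring_A]]
  show ?thesis using assms
    by (simp add: C.plus_closed abelian_monoid.a_assoc[OF am] abelian_monoid.a_lcomm[OF am])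
qed

lemma linear_comb_add:
  assumes "finite K" "\<And>i. i \<in> K \<Longrightarrow> x i \<in> carrier C"
  shows "(\<Oplus>\<^bsub>C\<^esub>i\<in>K. (a i + b i) \<odot>\<^bsub>C\<^esub> x i) =
    (\<Oplus>\<^bsub>C\<^esub>i\<in>K. a i \<odot>\<^bsub>C\<^esub> x i) \<oplus>\<^bsub>C\<^esub> (\<Oplus>\<^bsub>C\<^esub>i\<in>K. b i \<odot>\<^bsub>C\<^esub> x i)"
  using assms
proof (induction K rule: finite_induct)
  case empty
  then show ?case by (simp add: C.linear_comb_empty C.plus_zero C.zero_in)
next
  case (insert i K)
  have "(a i + b i) \<odot>\<^bsub>C\<^esub> x i = a i \<odot>\<^bsub>C\<^esub> x i \<oplus>\<^bsub>C\<^esub> b i \<odot>\<^bsub>C\<^esub> x i"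
    using insert.prems C.smult_l_distr[of "a i" "b i" "x i"] by (simp add: class_ring_simps)
  then show ?case using insert
    by (simp add: C.linear_comb_insert plus_swap C.alg_closed C.linear_comb_closed)
qed

lemma ev_add: "ev (f + g) = ev f \<oplus>\<^bsub>C\<^esub> ev g"
proof -
  let ?K = "keys f \<union> keys g"
  have "ev (f + g) = (\<Oplus>\<^bsub>C\<^esub>w\<in>?K. (lookup f w + lookup g w) \<odot>\<^bsub>C\<^esub> evw (unFW w))"
    using ev_superset[of ?K "f + g"] keys_add[of f g] by (simp add: lookup_add)
  also have "\<dots> = ev f \<oplus>\<^bsub>C\<^esub> ev g"
    using ev_superset[of ?K f] ev_superset[of ?K g] by (simp add: linear_comb_add evw_closed)
  finally show ?thesis .
qed

lemma ev_mult: "ev (f * g) = ev f \<otimes>\<^bsub>C\<^esub> ev g"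
proof (induction f rule: free_alg_induct)
  case zero
  show ?case by (simp add: ev_zero C.times_zero ev_closed)
next
  case (add f h)
  then show ?case by (simp add: distrib_right ev_add C.times_add_left ev_closed)
next
  case (monom a u)
  show ?case
  proof (induction g rule: free_alg_induct)
    case zero
    show ?case by (simp add: ev_zero C.times_zero ev_closed)
  next
    case (add f h)
    then show ?case by (simp add: distrib_left ev_add C.times_add_right ev_closed)
  next
    case (monom b v)
    have "a \<odot>\<^bsub>C\<^esub> (b \<odot>\<^bsub>C\<^esub> x) = (a * b) \<odot>\<^bsub>C\<^esub> x" if "x \<in> carrier C" for x a b
      using C.smult_assoc1[of a b x] that by (simp add: class_ring_simps)
    then show ?case
      by (simp add: scalar_word mult_single plus_free_word_def ev_single evw_append C.smult_mult_left
          C.smult_mult_right evw_closed C.alg_closed mult.commute[of a])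
  qed
qed

lemma ev_star: "ev (star_ext sl f) = involution C (ev f)"
proof (induction f rule: free_alg_induct)
  case zero
  show ?case
    using C.involution_smult[OF C.unit_closed, of 0] C.scale_zero(2)[OF C.unit_closed]
      C.scale_zero(2)[OF C.involution_closed[OF C.unit_closed]] by (simp add: ev_zero)
next
  case (monom a u)
  show ?case by (simp add: scalar_word star_ext_single ev_single evw_star C.involution_smult evw_closed)
qed (simp add: star_ext_add ev_add C.involution_add ev_closed)

abbreviation T :: "'l free_alg \<Rightarrow> complex" where "T \<equiv> lin_ext \<tau>"
abbreviation star :: "'l free_alg \<Rightarrow> 'l free_alg" where "star \<equiv> star_ext sl"

lemma T_commute: "T (f * g) = T (g * f)"
proof (induction f rule: free_alg_induct)
  case (monom a u)
  show ?case
  proof (induction g rule: free_alg_induct)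
    case (monom b v)
    show ?case using \<tau>_commute[of u v]
      by (simp add: scalar_word mult_single plus_free_word_def mult.commute)
  qed (simp_all add: algebra_simps lin_ext_add)
qed (simp_all add: algebra_simps lin_ext_add)

lemma T_star: "T (star f) = cnj (T f)"
proof (induction f rule: free_alg_induct)
  case (monom a u)
  show ?case by (simp add: scalar_word star_ext_single \<tau>_star)
qed (simp_all add: star_ext_add lin_ext_add)

lemma T_positive: "T (star f * f) \<in> \<real>\<^sub>\<ge>\<^sub>0"
proof -
  have "T (star f * g) = (\<Sum>u\<in>keys f. \<Sum>v\<in>keys g. cnj (lookup f u) * lookup g v *
      \<tau> (rev (map sl (unFW u)) @ unFW v))" for g
  proof -
    have "star f * g = (\<Sum>u\<in>keys f. \<Sum>v\<in>keys g.
        single (FW (rev (map sl (unFW u)))) (cnj (lookup f u)) * (scalar (lookup g v) * word (unFW v)))"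
      unfolding sum_distrib_left[symmetric] free_alg_eq_sum[of g, symmetric]
      by (simp add: star_ext_def sum_distrib_right)
    then show ?thesis
      by (simp add: lin_ext_sum scalar_word mult_single plus_free_word_def)
  qed
  also have "(\<Sum>u\<in>keys f. \<Sum>v\<in>keys f. cnj (lookup f u) * lookup f v * \<tau> (rev (map sl (unFW u)) @ unFW v)) =
      (\<Sum>u\<in>unFW ` keys f. \<Sum>v\<in>unFW ` keys f. cnj (lookup f (FW u)) * lookup f (FW v) * \<tau> (rev (map sl u) @ v))"
    by (simp add: sum.reindex inj_on_def free_word.expand)
  also have "\<dots> \<in> \<real>\<^sub>\<ge>\<^sub>0"
    by (rule \<tau>_positive) simp
  finally show ?thesis .
qed

text \<open>Multiplying on one side suffices: by the trace property the elements found form a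
  two-sided ideal, and by hermitian symmetry it is closed under the involution.\<close>

definition null :: "'l free_alg \<Rightarrow> bool" where
  "null f \<longleftrightarrow> (\<forall>g. T (f * g) = 0) \<and> ev f = \<zero>\<^bsub>C\<^esub>"

lemma null_wordI:
  assumes "\<And>u. T (f * word u) = 0" "ev f = \<zero>\<^bsub>C\<^esub>"
  shows "null f"
proof -
  have "T (f * g) = 0" for g
  proof (induction g rule: free_alg_induct)
    case (monom a u)
    have "f * (scalar a * word u) = scalar a * (f * word u)"
      by (metis scalar_commute mult.assoc)
    then show ?case by (simp add: lin_ext_scalar assms)
  qed (simp_all add: distrib_left lin_ext_add)
  then show ?thesis using assms(2) by (simp add: null_def)
qed

lemma ev_diff:
  assumes "ev f = ev g"
  shows "ev (f - g) = \<zero>\<^bsub>C\<^esub>"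
proof -
  note am = abelian_group.axioms(1)[OF ring.is_abelian_group[OF C.ring_A]]
  let ?y = "(- 1) \<odot>\<^bsub>C\<^esub> ev g"
  have y: "ev g \<oplus>\<^bsub>C\<^esub> ?y = \<zero>\<^bsub>C\<^esub>" "?y \<in> carrier C"
  proof -
    have "ev g = 1 \<odot>\<^bsub>C\<^esub> ev g" using C.smult_one[OF ev_closed] by (simp add: class_ring_simps)
    then show "ev g \<oplus>\<^bsub>C\<^esub> ?y = \<zero>\<^bsub>C\<^esub>"
      using C.smult_l_distr[of 1 "- 1" "ev g"] ev_closed[of g] C.scale_zero(2)[OF ev_closed[of g]]
      by (simp add: class_ring_simps)
  qed (simp add: C.scale_closed ev_closed)
  have "ev (f - g) \<oplus>\<^bsub>C\<^esub> ev g = ev g"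
    using assms ev_add[of "f - g" g] by simp
  then have "ev (f - g) \<oplus>\<^bsub>C\<^esub> (ev g \<oplus>\<^bsub>C\<^esub> ?y) = ev g \<oplus>\<^bsub>C\<^esub> ?y"
    using y(2) by (simp add: abelian_monoid.a_assoc[OF am, symmetric] ev_closed)
  then show ?thesis by (simp add: y C.plus_zero ev_closed)
qed

lemma null_diffI:
  assumes "\<And>u. T (f * word u) = T (g * word u)" "ev f = ev g"
  shows "null (f - g)"
  using assms by (intro null_wordI ev_diff) (simp_all add: left_diff_distrib lin_ext_minus)

lemma null_ev_eq: "null (f - g) \<Longrightarrow> ev f = ev g"
  using ev_add[of "f - g" g] by (simp add: null_def C.plus_zero ev_closed)

lemma null_zero: "null 0"
  by (simp add: null_def ev_zero)

lemma null_add: "null f \<Longrightarrow> null g \<Longrightarrow> null (f + g)"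
  by (simp add: null_def distrib_right lin_ext_add ev_add C.plus_zero C.zero_in)

lemma null_mult: "null f \<Longrightarrow> null (f * g)" "null f \<Longrightarrow> null (g * f)"
proof -
  assume f: "null f"
  have "T (g * f * h) = 0" for h
    using f T_commute[of g "f * h"] by (simp add: null_def mult.assoc)
  then show "null (f * g)" "null (g * f)" using f
    by (simp_all add: null_def mult.assoc ev_mult C.times_zero ev_closed)
qed

lemma null_uminus: "null f \<Longrightarrow> null (- f)"
  using null_mult(1)[of f "- 1"] by simp

lemma null_star:
  assumes "null f"
  shows "null (star f)"
proof -
  have "T (star f * g) = 0" for g
  proof -
    have "star f * g = star (star g * f)"
      by (simp add: star_ext_mult star_ext_star_ext sl_sl)
    then have "T (star f * g) = cnj (T (f * star g))"
      by (simp add: T_star T_commute)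
    then show ?thesis using assms by (simp add: null_def)
  qed
  moreover have "ev (star f) = \<zero>\<^bsub>C\<^esub>"
    using assms ev_star[of f] ev_star[of 0] by (simp add: null_def ev_zero)
  ultimately show ?thesis by (simp add: null_def)
qed

lemma null_T: "null f \<Longrightarrow> T f = 0"
  using null_def[of f] by (metis mult.right_neutral)

text \<open>Classes are sets of coefficient functions on lists, since this is the type in which
  \<open>asymptotically_free_amalg\<close> seeks the enlargement. No information is lost, as a
  polynomial is determined by its coefficients.\<close>

definition cls :: "'l free_alg \<Rightarrow> ('l list \<Rightarrow> complex) set" where
  "cls f = {\<lambda>w. lookup g (FW w) | g. null (g - f)}"

lemma cls_eq_iff: "cls f = cls g \<longleftrightarrow> null (f - g)"
proof
  assume "cls f = cls g"
  moreover have "(\<lambda>w. lookup f (FW w)) \<in> cls f"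
    using null_zero by (auto simp: cls_def intro!: exI[of _ f])
  ultimately obtain h where h: "(\<lambda>w. lookup f (FW w)) = (\<lambda>w. lookup h (FW w))" "null (h - g)"
    by (auto simp: cls_def)
  have "f = h"
  proof (rule poly_mapping_eqI)
    fix k show "lookup f k = lookup h k" using fun_cong[OF h(1), of "unFW k"] by simp
  qed
  then show "null (f - g)" using h(2) by simp
next
  assume fg: "null (f - g)"
  have "null (h - f) \<longleftrightarrow> null (h - g)" for h
  proof
    assume "null (h - f)"
    from null_add[OF this fg] show "null (h - g)" by simp
  next
    assume "null (h - g)"
    from null_add[OF this null_uminus[OF fg]] show "null (h - f)" by simp
  qed
  then show "cls f = cls g" by (simp add: cls_def)
qed

definition rep :: "('l list \<Rightarrow> complex) set \<Rightarrow> 'l free_alg" where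
  "rep y = (SOME f. cls f = y)"

lemma cls_rep: "cls (rep (cls f)) = cls f"
  unfolding rep_def by (rule someI[where x = f]) simp

lemma rep_null: "null (rep (cls f) - f)"
  using cls_rep[of f] by (simp add: cls_eq_iff)

text \<open>All operations go through chosen representatives. The rules proved next show
  independence of the choice and are the only access to the quotient from there on.\<close>

definition quot :: "('l list \<Rightarrow> complex) set star_prob_space" where
  "quot = \<lparr>carrier = range cls, monoid.mult = (\<lambda>x y. cls (rep x * rep y)), one = cls 1, zero = cls 0,
     add = (\<lambda>x y. cls (rep x + rep y)), smult = (\<lambda>c x. cls (scalar c * rep x)),
     involution = (\<lambda>x. cls (star (rep x))), state = (\<lambda>x. T (rep x))\<rparr>"

lemma quot_carrier: "carrier quot = range cls"
  by (simp add: quot_def)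

lemma quot_one: "\<one>\<^bsub>quot\<^esub> = cls 1" and quot_zero: "\<zero>\<^bsub>quot\<^esub> = cls 0"
  by (simp_all add: quot_def)

lemma quot_mult: "cls f \<otimes>\<^bsub>quot\<^esub> cls g = cls (f * g)"
proof -
  have "rep (cls f) * rep (cls g) - f * g = (rep (cls f) - f) * rep (cls g) + f * (rep (cls g) - g)"
    by (simp add: algebra_simps)
  then show ?thesis by (simp add: quot_def cls_eq_iff null_add null_mult rep_null)
qed

lemma quot_add: "cls f \<oplus>\<^bsub>quot\<^esub> cls g = cls (f + g)"
  by (simp add: quot_def cls_eq_iff add_diff_add null_add rep_null)

lemma quot_smult: "c \<odot>\<^bsub>quot\<^esub> cls f = cls (scalar c * f)"
proof -
  have "scalar c * rep (cls f) - scalar c * f = scalar c * (rep (cls f) - f)"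
    by (simp add: algebra_simps)
  then show ?thesis by (simp add: quot_def cls_eq_iff null_mult rep_null)
qed

lemma quot_involution: "involution quot (cls f) = cls (star f)"
  by (simp add: quot_def cls_eq_iff null_star rep_null flip: star_ext_minus)

lemma quot_state: "state quot (cls f) = T f"
  using null_T[OF rep_null[of f]] by (simp add: quot_def lin_ext_minus)

lemmas quot_simps = quot_carrier quot_one quot_zero quot_mult quot_add quot_smult quot_involution quot_state

lemma quot_ring: "ring quot"
proof (rule ringI)
  show "abelian_group quot"
  proof (rule abelian_groupI)
    fix x assume "x \<in> carrier quot"
    then obtain f where "x = cls f" by (auto simp: quot_simps)
    then show "\<exists>y\<in>carrier quot. y \<oplus>\<^bsub>quot\<^esub> x = \<zero>\<^bsub>quot\<^esub>"
      by (intro bexI[of _ "cls (- f)"]) (simp_all add: quot_simps)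
  qed (auto simp: quot_simps algebra_simps)
  show "monoid quot"
    by (rule monoidI) (auto simp: quot_simps algebra_simps)
qed (auto simp: quot_simps algebra_simps)

lemma tracial_quot: "tracial_star_prob_space quot"
proof (intro tracial_star_prob_space.intro tracial_star_prob_space_axioms.intro)
  show "ring quot" by (rule quot_ring)
  show "module class_ring quot"
  proof (rule moduleI)
    show "cring (class_ring :: complex ring)" by (rule C.R.is_cring)
    show "abelian_group quot" using quot_ring by (rule ring.is_abelian_group)
  qed (auto simp: quot_simps algebra_simps scalar_simps)
  fix x y assume xy: "x \<in> carrier quot" "y \<in> carrier quot"
  show "(c \<odot>\<^bsub>quot\<^esub> x) \<otimes>\<^bsub>quot\<^esub> y = c \<odot>\<^bsub>quot\<^esub> (x \<otimes>\<^bsub>quot\<^esub> y)" for c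
    using xy by (auto simp: quot_simps mult.assoc)
  show "x \<otimes>\<^bsub>quot\<^esub> (c \<odot>\<^bsub>quot\<^esub> y) = c \<odot>\<^bsub>quot\<^esub> (x \<otimes>\<^bsub>quot\<^esub> y)" for c
  proof -
    have "f * (scalar c * g) = scalar c * (f * g)" for f g :: "'l free_alg"
      by (metis scalar_commute mult.assoc)
    then show ?thesis using xy by (auto simp: quot_simps)
  qed
  show "involution quot (x \<oplus>\<^bsub>quot\<^esub> y) = involution quot x \<oplus>\<^bsub>quot\<^esub> involution quot y"
    using xy by (auto simp: quot_simps star_ext_add)
  show "involution quot (x \<otimes>\<^bsub>quot\<^esub> y) = involution quot y \<otimes>\<^bsub>quot\<^esub> involution quot x"
    using xy by (auto simp: quot_simps star_ext_mult)
  show "state quot (x \<oplus>\<^bsub>quot\<^esub> y) = state quot x + state quot y"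
    using xy by (auto simp: quot_simps lin_ext_add)
  show "state quot (x \<otimes>\<^bsub>quot\<^esub> y) = state quot (y \<otimes>\<^bsub>quot\<^esub> x)"
    using xy T_commute by (auto simp: quot_simps)
next
  fix x assume x: "x \<in> carrier quot"
  show "involution quot x \<in> carrier quot" using x by (auto simp: quot_simps)
  show "involution quot (involution quot x) = x"
    using x by (auto simp: quot_simps star_ext_star_ext sl_sl)
  show "involution quot (c \<odot>\<^bsub>quot\<^esub> x) = cnj c \<odot>\<^bsub>quot\<^esub> involution quot x" for c
    using x by (auto simp: quot_simps star_ext_scalar)
  show "state quot (c \<odot>\<^bsub>quot\<^esub> x) = c * state quot x" for c
    using x by (auto simp: quot_simps lin_ext_scalar)
  show "state quot (involution quot x \<otimes>\<^bsub>quot\<^esub> x) \<in> \<real>\<^sub>\<ge>\<^sub>0"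
    using x T_positive by (auto simp: quot_simps)
next
  show "state quot \<one>\<^bsub>quot\<^esub> = 1"
    by (simp add: quot_simps \<tau>_Nil flip: word_Nil)
qed

end

section \<open>The limit space\<close>

locale circular_extension = A: diag_prob_space A d p
  for A :: "'a star_prob_space" and d :: nat and p :: "nat \<Rightarrow> 'a" +
  fixes C :: "'c star_prob_space" and \<iota> :: "'a \<Rightarrow> 'c" and b :: "nat \<Rightarrow> 'c"
  assumes enl: "enlargement A C \<iota>" and b_closed: "b j \<in> carrier C"
begin

sublocale C: diag_prob_space C d "\<iota> \<circ> p"
  by (rule A.enlargement_diag(1)[OF enl])

lemma \<iota>_hom: "\<iota> \<in> Ring.ring_hom A C" and \<iota>_inj: "inj_on \<iota> (carrier A)"
    and \<iota>_smult: "\<And>c x. x \<in> carrier A \<Longrightarrow> \<iota> (c \<odot>\<^bsub>A\<^esub> x) = c \<odot>\<^bsub>C\<^esub> \<iota> x"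
    and \<iota>_involution: "\<And>x. x \<in> carrier A \<Longrightarrow> \<iota> (involution A x) = involution C (\<iota> x)"
    and \<iota>_state: "\<And>x. x \<in> carrier A \<Longrightarrow> state C (\<iota> x) = state A x"
  using enl by (auto simp: enlargement_def)

lemma \<iota>_closed: "x \<in> carrier A \<Longrightarrow> \<iota> x \<in> carrier C"
  by (rule ring_hom_closed[OF \<iota>_hom])

lemma \<iota>_mult: "x \<in> carrier A \<Longrightarrow> y \<in> carrier A \<Longrightarrow> \<iota> (x \<otimes>\<^bsub>A\<^esub> y) = \<iota> x \<otimes>\<^bsub>C\<^esub> \<iota> y"
  by (rule ring_hom_mult[OF \<iota>_hom])

lemma \<iota>_add: "x \<in> carrier A \<Longrightarrow> y \<in> carrier A \<Longrightarrow> \<iota> (x \<oplus>\<^bsub>A\<^esub> y) = \<iota> x \<oplus>\<^bsub>C\<^esub> \<iota> y"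
  by (rule ring_hom_add[OF \<iota>_hom])

lemma \<iota>_one: "\<iota> \<one>\<^bsub>A\<^esub> = \<one>\<^bsub>C\<^esub>"
  by (rule ring_hom_one[OF \<iota>_hom])

text \<open>The limit of \<open>X(s,k,l,n)\<close> is the corner of a circular element cut out by \<open>p k\<close> and \<open>p l\<close>.
  Letters outside the intended range are interpreted as zero.\<close>

definition cst :: "'a \<Rightarrow> 'c" where
  "cst a = (if a \<in> carrier A then \<iota> a else \<zero>\<^bsub>C\<^esub>)"

definition corner :: "nat \<Rightarrow> 'c" where
  "corner k = (if k < d then \<iota> (p k) else \<zero>\<^bsub>C\<^esub>)"

fun letter_word :: "'a + mat_index \<times> bool \<Rightarrow> ('c, gen) letter list" where
  "letter_word (Inl a) = [Const (cst a)]"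
| "letter_word (Inr (B_index j, st)) = [Const (if st then involution C (b j) else b j)]"
| "letter_word (Inr (X_index s k l, st)) =
     [Const (corner (if st then l else k)), Gen (s, k, l) st, Const (corner (if st then k else l))]"

text \<open>The circular elements are sent to zero. The resulting evaluation in \<open>C\<close>
  retains the elements of \<open>A\<close> that the trace cannot distinguish.\<close>

fun letter_value :: "'a + mat_index \<times> bool \<Rightarrow> 'c" where
  "letter_value (Inl a) = cst a"
| "letter_value (Inr (B_index j, st)) = (if st then involution C (b j) else b j)"
| "letter_value (Inr (X_index s k l, st)) = \<zero>\<^bsub>C\<^esub>"

text \<open>Letters for elements outside the carrier are fixed, so that the map is an involution on
  the whole letter type; their value zero is self-adjoint.\<close>

fun letter_star :: "'a + mat_index \<times> bool \<Rightarrow> 'a + mat_index \<times> bool" where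
  "letter_star (Inl a) = Inl (if a \<in> carrier A then involution A a else a)"
| "letter_star (Inr (i, st)) = Inr (i, \<not> st)"

definition fock_word :: "('a + mat_index \<times> bool) list \<Rightarrow> ('c, gen) letter list" where
  "fock_word w = concat (map letter_word w)"

lemma fock_word_simps:
  "fock_word [] = []" "fock_word (l # w) = letter_word l @ fock_word w"
  "fock_word (u @ v) = fock_word u @ fock_word v"
  by (simp_all add: fock_word_def)

lemma cst_closed: "cst a \<in> carrier C"
  by (simp add: cst_def \<iota>_closed C.zero_in)

lemma corner_closed: "corner k \<in> carrier C"
  by (simp add: corner_def \<iota>_closed A.proj_closed C.zero_in)

lemma involution_zero: "involution C \<zero>\<^bsub>C\<^esub> = \<zero>\<^bsub>C\<^esub>"
  using C.involution_diag_elem[of "\<lambda>_. 0"] by (simp add: C.diag_elem_zero)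

lemma cst_star: "cst (if a \<in> carrier A then involution A a else a) = involution C (cst a)"
  by (simp add: cst_def \<iota>_involution A.involution_closed involution_zero)

lemma corner_star: "involution C (corner k) = corner k"
  using \<iota>_involution[OF A.proj_closed, of k] by (simp add: corner_def involution_zero A.proj_selfadjoint)

lemma letter_word_wf: "list_all C.wf_letter (letter_word l)"
  by (cases l rule: letter_word.cases)
    (simp_all add: cst_closed corner_closed b_closed C.involution_closed)

lemma fock_word_wf: "list_all C.wf_letter (fock_word w)"
  by (induction w) (simp_all add: fock_word_simps letter_word_wf)

lemma letter_word_star: "C.star_word (letter_word l) = letter_word (letter_star l)"
proof (cases l rule: letter_word.cases)
  case (1 a)
  then show ?thesis by (simp add: C.star_word_def cst_star del: if_split_asm)
next
  case (2 j st)
  then show ?thesis by (simp add: C.star_word_def C.involution_involution b_closed)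
next
  case (3 s k l st)
  then show ?thesis by (simp add: C.star_word_def corner_star)
qed

lemma star_word_append: "C.star_word (u @ v) = C.star_word v @ C.star_word u"
  by (simp add: C.star_word_def)

lemma fock_word_star: "C.star_word (fock_word w) = fock_word (rev (map letter_star w))"
  by (induction w) (simp_all add: fock_word_simps star_word_append letter_word_star C.star_word_def[of "[]"])

sublocale Q: word_state C letter_value letter_star "\<lambda>w. C.fock (fock_word w)"
proof
  fix l show "letter_value l \<in> carrier C"
    by (cases l rule: letter_value.cases) (simp_all add: cst_closed b_closed C.involution_closed C.zero_in)
  show "letter_value (letter_star l) = involution C (letter_value l)"
    by (cases l rule: letter_value.cases)
      (simp_all add: cst_star C.involution_involution b_closed involution_zero del: if_split_asm)
  show "letter_star (letter_star l) = l"
    by (cases l rule: letter_star.cases) (simp_all add: A.involution_closed A.involution_involution)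
next
  show "C.fock (fock_word []) = 1" by (simp add: fock_word_simps)
next
  fix u v show "C.fock (fock_word (u @ v)) = C.fock (fock_word (v @ u))"
    using C.fock_commute[OF fock_word_wf fock_word_wf, of u v] by (simp add: fock_word_simps)
next
  fix w show "C.fock (fock_word (rev (map letter_star w))) = cnj (C.fock (fock_word w))"
    using C.fock_star[OF fock_word_wf, of w] by (simp add: fock_word_star)
next
  fix W :: "('a + mat_index \<times> bool) list set" and a assume "finite W"
  from C.fock_positive[OF this fock_word_wf, of a]
  show "(\<Sum>u\<in>W. \<Sum>v\<in>W. cnj (a u) * a v * C.fock (fock_word (rev (map letter_star u) @ v))) \<in> \<real>\<^sub>\<ge>\<^sub>0"
    by (simp add: fock_word_star fock_word_simps)
qed

definition emb :: "'a \<Rightarrow> (('a + mat_index \<times> bool) list \<Rightarrow> complex) set" where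
  "emb a = Q.cls (word [Inl a])"

definition lim :: "mat_index \<Rightarrow> (('a + mat_index \<times> bool) list \<Rightarrow> complex) set" where
  "lim i = Q.cls (word [Inr (i, False)])"

lemma ev_word: "Q.ev (word u) = Q.evw u"
proof -
  have "1 \<odot>\<^bsub>C\<^esub> Q.evw u = Q.evw u"
    using C.smult_one[OF Q.evw_closed, of u] by (simp add: class_ring_simps)
  then show ?thesis by (simp add: word_def Q.ev_single)
qed

lemma ev_scalar_word: "Q.ev (scalar c * word u) = c \<odot>\<^bsub>C\<^esub> Q.evw u"
  by (simp add: scalar_word Q.ev_single)

lemma evw_Inl: "x \<in> carrier A \<Longrightarrow> Q.evw [Inl x] = \<iota> x"
  by (simp add: Q.evw_simps cst_def C.times_one \<iota>_closed)

text \<open>One statement for sums, with both coefficients 1, and for scalar multiples, with second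
  coefficient 0.\<close>

lemma fock_Inl_linear:
  assumes "x \<in> carrier A" "y \<in> carrier A" "z \<in> carrier A"
    and "\<iota> x = c \<odot>\<^bsub>C\<^esub> \<iota> y \<oplus>\<^bsub>C\<^esub> e \<odot>\<^bsub>C\<^esub> \<iota> z"
  shows "C.fock (fock_word (Inl x # u)) = c * C.fock (fock_word (Inl y # u)) + e * C.fock (fock_word (Inl z # u))"
proof -
  have cl: "\<iota> x \<in> carrier C" "\<iota> y \<in> carrier C" "\<iota> z \<in> carrier C" using assms(1-3) by (simp_all add: \<iota>_closed)
  have "(\<Sum>(a, x)\<leftarrow>[(1, \<iota> x), (- c, \<iota> y), (- e, \<iota> z)]. a * C.fock (Const x # fock_word u)) = 0"
  proof (rule C.fock_linear[OF fock_word_wf])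
    show "v \<in> carrier C" if "(a, v) \<in> set [(1, \<iota> x), (- c, \<iota> y), (- e, \<iota> z)]" for a v
      using that cl by auto
    show "(\<Sum>(a, x)\<leftarrow>[(1, \<iota> x), (- c, \<iota> y), (- e, \<iota> z)]. a * state C (v \<otimes>\<^bsub>C\<^esub> x)) = 0" if "v \<in> carrier C" for v
      using that cl by (simp add: assms(4) C.times_add_right C.smult_mult_right C.alg_closed C.state_add C.state_smult)
  qed
  then show ?thesis using assms(1-3) by (simp add: fock_word_simps cst_def algebra_simps)
qed

lemma enlargement_emb: "enlargement A Q.quot emb"
  unfolding enlargement_def
proof (intro conjI allI ballI)
  show "tracial_star_prob_space Q.quot" by (rule Q.tracial_quot)
  show "emb \<in> Ring.ring_hom A Q.quot"
  proof (rule ring_hom_memI)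
    fix x y assume xy: "x \<in> carrier A" "y \<in> carrier A"
    have "Q.null (word [Inl (x \<otimes>\<^bsub>A\<^esub> y)] - word [Inl x] * word [Inl y])"
    proof (rule Q.null_diffI)
      fix u
      have "C.fock (Const (\<iota> x) # Const (\<iota> y) # fock_word u) = C.fock (Const (\<iota> x \<otimes>\<^bsub>C\<^esub> \<iota> y) # fock_word u)"
        using C.fock_merge[of "[]" "fock_word u" "\<iota> x" "\<iota> y"] xy by (simp add: fock_word_wf \<iota>_closed)
      then show "Q.T (word [Inl (x \<otimes>\<^bsub>A\<^esub> y)] * word u) = Q.T (word [Inl x] * word [Inl y] * word u)"
        using xy by (simp add: word_mult fock_word_simps cst_def A.times_closed \<iota>_mult)
      show "Q.ev (word [Inl (x \<otimes>\<^bsub>A\<^esub> y)]) = Q.ev (word [Inl x] * word [Inl y])"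
        using xy by (simp add: Q.ev_mult ev_word evw_Inl A.times_closed \<iota>_mult)
    qed
    then show "emb (x \<otimes>\<^bsub>A\<^esub> y) = emb x \<otimes>\<^bsub>Q.quot\<^esub> emb y"
      by (simp add: emb_def Q.quot_mult Q.cls_eq_iff)
    have one: "1 \<odot>\<^bsub>C\<^esub> v = v" if "v \<in> carrier C" for v
      using C.smult_one[OF that] by (simp add: class_ring_simps)
    have "Q.null (word [Inl (x \<oplus>\<^bsub>A\<^esub> y)] - (word [Inl x] + word [Inl y]))"
    proof (rule Q.null_diffI)
      fix u
      show "Q.T (word [Inl (x \<oplus>\<^bsub>A\<^esub> y)] * word u) = Q.T ((word [Inl x] + word [Inl y]) * word u)"
        using xy fock_Inl_linear[of "x \<oplus>\<^bsub>A\<^esub> y" x y 1 1 u]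
        by (simp add: word_mult A.plus_closed \<iota>_add one \<iota>_closed distrib_right lin_ext_add)
      show "Q.ev (word [Inl (x \<oplus>\<^bsub>A\<^esub> y)]) = Q.ev (word [Inl x] + word [Inl y])"
        using xy by (simp add: Q.ev_add ev_word evw_Inl A.plus_closed \<iota>_add)
    qed
    then show "emb (x \<oplus>\<^bsub>A\<^esub> y) = emb x \<oplus>\<^bsub>Q.quot\<^esub> emb y"
      by (simp add: emb_def Q.quot_add Q.cls_eq_iff)
  next
    have "Q.null (word [Inl \<one>\<^bsub>A\<^esub>] - 1)"
    proof (rule Q.null_diffI)
      fix u
      show "Q.T (word [Inl \<one>\<^bsub>A\<^esub>] * word u) = Q.T (1 * word u)"
        using C.fock_one[of "[]" "fock_word u"]
        by (simp add: word_mult fock_word_simps cst_def A.unit_closed \<iota>_one fock_word_wf)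
      show "Q.ev (word [Inl \<one>\<^bsub>A\<^esub>]) = Q.ev 1"
        unfolding word_Nil[symmetric] ev_word evw_Inl[OF A.unit_closed] \<iota>_one Q.evw_simps(1) ..
    qed
    then show "emb \<one>\<^bsub>A\<^esub> = \<one>\<^bsub>Q.quot\<^esub>"
      by (simp add: emb_def Q.quot_one Q.cls_eq_iff)
  qed (simp add: emb_def Q.quot_carrier)
  \<comment> \<open>Null elements evaluate to zero in \<open>C\<close>, so the class of a letter
    determines its value, and \<iota> is injective.\<close>
  show "inj_on emb (carrier A)"
  proof (rule inj_onI)
    fix x y assume xy: "x \<in> carrier A" "y \<in> carrier A" "emb x = emb y"
    then have "Q.ev (word [Inl x]) = Q.ev (word [Inl y])"
      by (intro Q.null_ev_eq) (simp add: emb_def Q.cls_eq_iff)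
    then have "\<iota> x = \<iota> y" using xy by (simp add: ev_word evw_Inl)
    then show "x = y" using \<iota>_inj xy by (auto dest: inj_onD)
  qed
  fix x assume x: "x \<in> carrier A"
  show "emb (c \<odot>\<^bsub>A\<^esub> x) = c \<odot>\<^bsub>Q.quot\<^esub> emb x" for c
  proof -
    have "Q.null (word [Inl (c \<odot>\<^bsub>A\<^esub> x)] - scalar c * word [Inl x])"
    proof (rule Q.null_diffI)
      fix u
      \<comment> \<open>A zero summand is added to fit the two-term form of
        \<open>fock_Inl_linear\<close>.\<close>
      have "\<iota> (c \<odot>\<^bsub>A\<^esub> x) = c \<odot>\<^bsub>C\<^esub> \<iota> x \<oplus>\<^bsub>C\<^esub> 0 \<odot>\<^bsub>C\<^esub> \<iota> x"
        using x by (simp add: \<iota>_smult C.scale_zero \<iota>_closed C.plus_zero C.scale_closed)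
      then show "Q.T (word [Inl (c \<odot>\<^bsub>A\<^esub> x)] * word u) = Q.T (scalar c * word [Inl x] * word u)"
        using x fock_Inl_linear[of "c \<odot>\<^bsub>A\<^esub> x" x x c 0 u]
        by (simp add: word_mult mult.assoc lin_ext_scalar A.scale_closed)
      show "Q.ev (word [Inl (c \<odot>\<^bsub>A\<^esub> x)]) = Q.ev (scalar c * word [Inl x])"
        using x by (simp add: ev_word ev_scalar_word evw_Inl A.scale_closed \<iota>_smult)
    qed
    then show ?thesis by (simp add: emb_def Q.quot_smult Q.cls_eq_iff)
  qed
  show "emb (involution A x) = involution Q.quot (emb x)"
    using x by (simp add: emb_def Q.quot_involution star_ext_word)
  show "state Q.quot (emb x) = state A x"
    using x C.fock_Const[of "[\<iota> x]"]
    by (simp add: emb_def Q.quot_state fock_word_simps cst_def \<iota>_state C.times_one \<iota>_closed)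
qed

sublocale E: diag_prob_space Q.quot d "emb \<circ> p"
  by (rule A.enlargement_diag(1)[OF enlargement_emb])

fun diag_letters :: "mat_index \<times> bool \<times> (nat \<Rightarrow> complex) \<Rightarrow> ('a + mat_index \<times> bool) list" where
  "diag_letters (i, st, c) = [Inr (i, st), Inl (diag_elem A d p c)]"

lemma diag_elem_quot: "diag_elem Q.quot d (emb \<circ> p) c = Q.cls (word [Inl (diag_elem A d p c)])"
  using A.enlargement_diag(2)[OF enlargement_emb, of c] by (simp add: emb_def)

lemma word_alg_quot: "word_alg Q.quot d (emb \<circ> p) lim w = Q.cls (word (concat (map diag_letters w)))"
proof (induction w)
  case Nil
  then show ?case by (simp add: word_alg_def Q.quot_one word_Nil)
next
  case (Cons t w)
  obtain i st c where t: "t = (i, st, c)" by (metis surj_pair)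
  have "(if st then involution Q.quot (lim i) else lim i) = Q.cls (word [Inr (i, st)])"
    by (simp add: lim_def Q.quot_involution star_ext_word)
  then show ?case using Cons
    by (simp add: word_alg_def t diag_elem_quot[unfolded comp_def] Q.quot_mult word_mult)
qed

lemma cond_exp_coord_quot:
  assumes "k < d"
  shows "cond_exp_coord Q.quot (emb \<circ> p) (Q.cls (word u)) k =
    C.fock (fock_word (Inl (p k) # u @ [Inl (p k)])) / state A (p k)"
proof -
  have "state Q.quot (emb (p k)) = state A (p k)"
    using enlargement_emb assms A.proj_closed by (auto simp: enlargement_def)
  then show ?thesis
    by (simp add: cond_exp_coord_def) (simp add: emb_def Q.quot_mult Q.quot_state word_mult)
qed

text \<open>The point where matrices and limits meet: the encoding of a matrix word, with constants
  replaced by their limits, is the Fock word of the corresponding element of the quotient. The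
  bounds on k and l ensure that the corners are genuine projections.\<close>

lemma map_index_word:
  assumes "fst ` set w \<subseteq> {X_index s k l | s k l. k < d \<and> l < d} \<union> range B_index"
  shows "map (map_letter (const_limit C d (\<iota> \<circ> p) b) id) (concat (map index_word w)) =
    fock_word (concat (map diag_letters w))"
  using assms
proof (induction w)
  case (Cons t w)
  obtain i st c where t: "t = (i, st, c)" by (metis surj_pair)
  have D: "cst (diag_elem A d p c) = diag_elem C d (\<iota> \<circ> p) c"
    using A.enlargement_diag(2)[OF enl] by (simp add: cst_def A.diag_elem_closed)
  have P: "diag_elem C d (\<iota> \<circ> p) (\<lambda>i. if i = k then 1 else 0) = corner k" if "k < d" for k
    using C.diag_elem_proj[OF that] that by (simp add: corner_def)
  have "map (map_letter (const_limit C d (\<iota> \<circ> p) b) id) (index_word t) = fock_word (diag_letters t)"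
  proof (cases i)
    case (B_index j)
    then show ?thesis by (simp add: t fock_word_simps D)
  next
    case (X_index s k l)
    then have "k < d" "l < d" using Cons.prems by (auto simp: t)
    then show ?thesis by (simp add: t X_index fock_word_simps D P)
  qed
  moreover have "fst ` set w \<subseteq> {X_index s k l | s k l. k < d \<and> l < d} \<union> range B_index"
    using Cons.prems by simp
  ultimately show ?case
    by (simp only: list.map concat.simps map_append fock_word_simps(3) Cons.IH)
qed (simp add: fock_word_simps)

section \<open>Freeness of the limits over the diagonal algebra\<close>

definition letters_span :: "('a + mat_index \<times> bool) set \<Rightarrow> (('a + mat_index \<times> bool) list \<Rightarrow> complex) set set" where
  "letters_span \<Lambda> = {Q.cls f | f. \<forall>w\<in>keys f. set (unFW w) \<subseteq> \<Lambda>}"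

lemma star_subalgebra_letters_span:
  assumes "letter_star ` \<Lambda> \<subseteq> \<Lambda>"
  shows "star_subalgebra Q.quot (letters_span \<Lambda>)"
  unfolding star_subalgebra_def
proof (intro conjI ballI allI)
  show "letters_span \<Lambda> \<subseteq> carrier Q.quot" by (auto simp: letters_span_def Q.quot_carrier)
  show "\<one>\<^bsub>Q.quot\<^esub> \<in> letters_span \<Lambda>"
    unfolding letters_span_def Q.quot_one by (auto intro!: exI[of _ 1] simp: zero_free_word_def)
  fix x assume "x \<in> letters_span \<Lambda>"
  then obtain f where f: "x = Q.cls f" "\<forall>w\<in>keys f. set (unFW w) \<subseteq> \<Lambda>" by (auto simp: letters_span_def)
  have scal: "\<forall>w\<in>keys (scalar c * f). set (unFW w) \<subseteq> \<Lambda>" for c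
  proof -
    have "keys (scalar c * f) \<subseteq> keys f"
    proof
      fix w assume "w \<in> keys (scalar c * f)"
      then obtain u v where "u \<in> keys (scalar c)" "v \<in> keys f" "w = u + v" using keys_mult[of "scalar c" f] by blast
      then show "w \<in> keys f" by (auto simp: scalar_def split: if_splits)
    qed
    then show ?thesis using f(2) by auto
  qed
  then show "c \<odot>\<^bsub>Q.quot\<^esub> x \<in> letters_span \<Lambda>" for c
    by (auto simp: f(1) Q.quot_smult letters_span_def)
  have "\<forall>w\<in>keys (Q.star f). set (unFW w) \<subseteq> \<Lambda>"
  proof
    fix w assume "w \<in> keys (Q.star f)"
    then obtain v where v: "v \<in> keys f" "w \<in> keys (single (FW (rev (map letter_star (unFW v)))) (cnj (lookup f v)))"
      unfolding star_ext_def by (metis (no_types, lifting) UN_E keys_sum subsetD)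
    then have "set (unFW w) = letter_star ` set (unFW v)" by (auto split: if_splits)
    then show "set (unFW w) \<subseteq> \<Lambda>" using f(2) v(1) assms by blast
  qed
  then show "involution Q.quot x \<in> letters_span \<Lambda>"
    by (auto simp: f(1) Q.quot_involution letters_span_def)
  fix y assume "y \<in> letters_span \<Lambda>"
  then obtain g where g: "y = Q.cls g" "\<forall>w\<in>keys g. set (unFW w) \<subseteq> \<Lambda>" by (auto simp: letters_span_def)
  have "\<forall>w\<in>keys (f + g). set (unFW w) \<subseteq> \<Lambda>" using keys_add[of f g] f(2) g(2) by blast
  then show "x \<oplus>\<^bsub>Q.quot\<^esub> y \<in> letters_span \<Lambda>" by (auto simp: f(1) g(1) Q.quot_add letters_span_def)
  have "\<forall>w\<in>keys (f * g). set (unFW w) \<subseteq> \<Lambda>"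
  proof
    fix w assume "w \<in> keys (f * g)"
    then obtain u v where "u \<in> keys f" "v \<in> keys g" "w = u + v" using keys_mult[of f g] by blast
    then show "set (unFW w) \<subseteq> \<Lambda>" using f(2) g(2) by (auto simp: plus_free_word_def)
  qed
  then show "x \<otimes>\<^bsub>Q.quot\<^esub> y \<in> letters_span \<Lambda>" by (auto simp: f(1) g(1) Q.quot_mult letters_span_def)
qed

lemma word_in_letters_span: "set u \<subseteq> \<Lambda> \<Longrightarrow> Q.cls (word u) \<in> letters_span \<Lambda>"
  unfolding letters_span_def word_def by (auto intro!: exI[of _ "single (FW u) 1"])

text \<open>The letters generating the subalgebra for each index. The one for the constant matrices
  receives all of \<open>A\<close>, not only the diagonal algebra: in the Fock space every constant
  has type \<open>None\<close>. The others get the diagonal algebra, one generator and its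
  adjoint.\<close>

fun set_letters :: "set_index \<Rightarrow> ('a + mat_index \<times> bool) set" where
  "set_letters B_set = range Inl \<union> {Inr (B_index j, st) | j st. True}"
| "set_letters (X_set s k l) = Inl ` diag_algebra A d p \<union> {Inr (X_index s k l, st) | st. True}"

fun set_type :: "set_index \<Rightarrow> gen option" where
  "set_type B_set = None"
| "set_type (X_set s k l) = Some (s, k, l)"

lemma set_letters_star: "letter_star ` set_letters i \<subseteq> set_letters i"
proof (cases i)
  case (X_set s k l)
  have "involution A a \<in> diag_algebra A d p" if "a \<in> diag_algebra A d p" for a
    using that by (auto simp: diag_algebra_def A.involution_diag_elem)
  then show ?thesis using X_set by auto
qed auto

sublocale D: amalg C "diag_algebra C d (\<iota> \<circ> p)"
  by (rule C.amalg_diag)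

text \<open>A polynomial as a list of weighted Fock words, by an arbitrary enumeration of its
  support; \<open>sum_free_alg_comb\<close> shows that the order does not matter.\<close>

definition free_alg_comb :: "('a + mat_index \<times> bool) free_alg \<Rightarrow> (complex \<times> ('c, gen) letter list) list" where
  "free_alg_comb f = map (\<lambda>w. (lookup f w, fock_word (unFW w))) (SOME ws. set ws = keys f \<and> distinct ws)"

lemma free_alg_comb_ex: "\<exists>ws. set ws = keys f \<and> distinct ws \<and>
    free_alg_comb f = map (\<lambda>w. (lookup f w, fock_word (unFW w))) ws"
  using someI_ex[OF finite_distinct_list[OF finite_keys[of f]]] by (auto simp: free_alg_comb_def)

lemma sum_free_alg_comb: "(\<Sum>(a, w)\<leftarrow>free_alg_comb f. a * h w) = lin_ext (\<lambda>u. h (fock_word u)) f"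
proof -
  obtain ws where "set ws = keys f" "distinct ws"
    "free_alg_comb f = map (\<lambda>w. (lookup f w, fock_word (unFW w))) ws" using free_alg_comb_ex by blast
  then show ?thesis
    by (simp add: lin_ext_def comp_def sum_list_distinct_conv_sum_set)
qed

lemma set_free_alg_comb: "(a, w) \<in> set (free_alg_comb f) \<Longrightarrow> \<exists>v\<in>keys f. w = fock_word (unFW v)"
  using free_alg_comb_ex[of f] by auto

lemma comb_op_free_alg_comb: "D.comb_op (free_alg_comb f) h S = lin_ext (\<lambda>u. fold C.left_op (fock_word u) h S) f"
  unfolding D.comb_op_def by (rule sum_free_alg_comb)

lemma comb_op_times:
  "D.comb_op (free_alg_comb (f * g)) h S = D.comb_op (free_alg_comb g) (D.comb_op (free_alg_comb f) h) S"
proof (induction f rule: free_alg_induct)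
  case zero
  have "fold C.left_op w (\<lambda>S. 0) S = 0" for w :: "('c, gen) letter list" and S
    using C.fold_left_op_linear[of w "\<lambda>S. 0" "-1" "\<lambda>S. 0" S] by simp
  then show ?case by (simp add: comb_op_free_alg_comb[abs_def]) (simp add: lin_ext_def)
next
  case (add f f')
  have "fold C.left_op w (\<lambda>S. F S + F' S) S = fold C.left_op w F S + fold C.left_op w F' S"
    for w :: "('c, gen) letter list" and F F' S
    using C.fold_left_op_linear[of w F 1 F' S] by simp
  moreover have "D.comb_op (free_alg_comb (f + f')) h =
      (\<lambda>S. D.comb_op (free_alg_comb f) h S + D.comb_op (free_alg_comb f') h S)"
    by (rule ext) (simp add: comb_op_free_alg_comb lin_ext_add)
  ultimately have "D.comb_op (free_alg_comb g) (D.comb_op (free_alg_comb (f + f')) h) S =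
      D.comb_op (free_alg_comb g) (D.comb_op (free_alg_comb f) h) S +
      D.comb_op (free_alg_comb g) (D.comb_op (free_alg_comb f') h) S"
    by (simp add: D.comb_op_def[of "free_alg_comb g"] case_prod_unfold distrib_left sum_list_addf)
  moreover have "D.comb_op (free_alg_comb ((f + f') * g)) h S =
      D.comb_op (free_alg_comb (f * g)) h S + D.comb_op (free_alg_comb (f' * g)) h S"
    by (simp add: comb_op_free_alg_comb distrib_right lin_ext_add)
  ultimately show ?case using add by simp
next
  case (monom c u)
  have 1: "D.comb_op (free_alg_comb (scalar c * word u)) h = (\<lambda>S. c * fold C.left_op (fock_word u) h S)"
    by (rule ext) (simp add: comb_op_free_alg_comb lin_ext_scalar)
  have "fold C.left_op w (\<lambda>S. c * F S) S = c * fold C.left_op w F S" for w :: "('c, gen) letter list" and F S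
  proof -
    have "fold C.left_op w (\<lambda>S. 0) S = 0" for w :: "('c, gen) letter list" and S
      using C.fold_left_op_linear[of w "\<lambda>S. 0" "-1" "\<lambda>S. 0" S] by simp
    then show ?thesis using C.fold_left_op_linear[of w "\<lambda>S. 0" c F S] by simp
  qed
  then have 2: "D.comb_op (free_alg_comb g) (\<lambda>S. c * F S) S = c * D.comb_op (free_alg_comb g) F S" for F
    by (simp add: D.comb_op_def case_prod_unfold sum_list_const_mult[symmetric] mult_ac)
  have 3: "lin_ext (\<lambda>v. fold C.left_op (fock_word v) h S) (word u * g) =
      lin_ext (\<lambda>v. fold C.left_op (fock_word v) (fold C.left_op (fock_word u) h) S) g"
  proof (induction g rule: free_alg_induct)
    case (monom e v)
    have "word u * (scalar e * word v) = scalar e * word (u @ v)"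
      by (metis scalar_commute mult.assoc word_mult)
    then show ?case by (simp add: lin_ext_scalar fock_word_simps)
  qed (simp_all add: distrib_left lin_ext_add)
  show ?case unfolding 1 2 by (simp add: comb_op_free_alg_comb mult.assoc lin_ext_scalar 3)
qed

lemma foldr_cls: "foldr (\<lambda>x y. x \<otimes>\<^bsub>Q.quot\<^esub> y) (map Q.cls fs) \<one>\<^bsub>Q.quot\<^esub> = Q.cls (foldr (*) fs 1)"
  by (induction fs) (simp_all add: Q.quot_one Q.quot_mult)

lemma comb_op_foldl:
  "D.comb_op (foldl D.comb_mult P (map free_alg_comb fs)) h S =
    D.comb_op (free_alg_comb (foldr (*) fs 1)) (D.comb_op P h) S"
proof (induction fs arbitrary: P)
  case Nil
  then show ?case by (simp add: comb_op_free_alg_comb fock_word_simps flip: word_Nil)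
next
  case (Cons f fs)
  have "D.comb_op (D.comb_mult P (free_alg_comb f)) h = D.comb_op (free_alg_comb f) (D.comb_op P h)"
    by (rule ext) (rule D.comb_op_mult)
  then show ?case by (simp add: Cons comb_op_times)
qed

lemma corner_in_D: "k < d \<Longrightarrow> corner k \<in> diag_algebra C d (\<iota> \<circ> p)"
  using C.diag_elem_proj[of k] by (auto simp: corner_def diag_algebra_def intro: range_eqI[OF sym])

lemma type_comb_letters:
  assumes "i \<in> set_indices d" "\<forall>w\<in>keys f. set (unFW w) \<subseteq> set_letters i"
  shows "D.type_comb (set_type i) (free_alg_comb f)"
proof -
  have letter: "list_all (D.type_letter (set_type i)) (letter_word l)" if "l \<in> set_letters i" for l
  proof (cases i)
    case B_set
    then show ?thesis using that by (auto simp: cst_closed b_closed C.involution_closed)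
  next
    case (X_set s k l')
    then have "k < d" "l' < d" using assms(1) by (auto simp: set_indices_def)
    moreover have "cst a \<in> diag_algebra C d (\<iota> \<circ> p)" if a_in: "a \<in> diag_algebra A d p" for a
    proof -
      obtain c where a: "a = diag_elem A d p c" using a_in by (auto simp: diag_algebra_def)
      show ?thesis unfolding a cst_def
        by (simp add: A.diag_elem_closed A.enlargement_diag(2)[OF enl] diag_algebra_def)
    qed
    ultimately show ?thesis using that X_set by (auto simp: corner_in_D)
  qed
  have "list_all (D.type_letter (set_type i)) (fock_word u)" if "set u \<subseteq> set_letters i" for u
    using that by (induction u) (simp_all add: fock_word_simps letter)
  then show ?thesis using assms(2) set_free_alg_comb[of _ _ f] by (fastforce simp: D.type_comb_def)
qed

text \<open>The conditional expectation tests only against the projections \<open>p k\<close>. A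
  general diagonal constant is a combination of these, and \<open>fock_linear\<close> transfers the
  combination to the Fock functional, where constants are mere symbols.\<close>

lemma centered_free_alg_comb:
  assumes "cond_exp_diag Q.quot d (emb \<circ> p) (Q.cls f) = \<zero>\<^bsub>Q.quot\<^esub>"
  shows "D.centered (free_alg_comb f)"
  unfolding D.centered_def
proof
  have zero: "lin_ext (\<lambda>u. C.fock (Const (\<iota> (p k)) # fock_word u)) f = 0" if k: "k < d" for k
  proof -
    have "state Q.quot (emb (p k) \<otimes>\<^bsub>Q.quot\<^esub> Q.cls f) = 0"
      using assms k E.cond_exp_diag_eq_zero_iff[of "Q.cls f"] by (simp add: Q.quot_carrier)
    then have "Q.T (word [Inl (p k)] * f) = 0" by (simp add: emb_def Q.quot_mult Q.quot_state)
    moreover have "Q.T (word [Inl (p k)] * f) = lin_ext (\<lambda>u. C.fock (Const (\<iota> (p k)) # fock_word u)) f"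
    proof (induction f rule: free_alg_induct)
      case (monom e v)
      have "word [Inl (p k)] * (scalar e * word v) = scalar e * word (Inl (p k) # v)"
        by (metis scalar_commute mult.assoc word_mult append_Cons append_Nil)
      then show ?case using k by (simp add: lin_ext_scalar fock_word_simps cst_def A.proj_closed)
    qed (simp_all add: distrib_left lin_ext_add)
    ultimately show ?thesis by simp
  qed
  fix e assume "e \<in> diag_algebra C d (\<iota> \<circ> p)"
  then obtain c where e: "e = diag_elem C d (\<iota> \<circ> p) c" by (auto simp: diag_algebra_def)
  have expand: "C.fock (Const e # w) = (\<Sum>k<d. c k * C.fock (Const (\<iota> (p k)) # w))"
    if w: "list_all C.wf_letter w" for w :: "('c, gen) letter list"
  proof -
    let ?L = "(1, e) # map (\<lambda>k. (- c k, \<iota> (p k))) [0..<d]"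
    have "(\<Sum>(a, x)\<leftarrow>?L. a * C.fock (Const x # w)) = 0"
    proof (rule C.fock_linear[OF w])
      show "x \<in> carrier C" if "(a, x) \<in> set ?L" for a x
        using that A.proj_closed \<iota>_closed C.diag_elem_closed by (auto simp: e)
      show "(\<Sum>(a, x)\<leftarrow>?L. a * state C (y \<otimes>\<^bsub>C\<^esub> x)) = 0" if "y \<in> carrier C" for y
        using C.state_times_diag_elem[OF that, of c]
        by (simp add: e comp_def interv_sum_list_conv_sum_set_nat sum_negf lessThan_atLeast0)
    qed
    then show ?thesis
      by (simp add: comp_def interv_sum_list_conv_sum_set_nat sum_negf lessThan_atLeast0)
  qed
  have "(\<Sum>(a, w)\<leftarrow>free_alg_comb f. a * C.fock (Const e # w)) =
      lin_ext (\<lambda>u. \<Sum>k<d. c k * C.fock (Const (\<iota> (p k)) # fock_word u)) f"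
    by (simp add: sum_free_alg_comb expand fock_word_wf)
  also have "\<dots> = (\<Sum>k<d. c k * lin_ext (\<lambda>u. C.fock (Const (\<iota> (p k)) # fock_word u)) f)"
    unfolding lin_ext_def sum_distrib_left by (subst sum.swap) (simp add: mult_ac)
  also have "\<dots> = 0" using zero by simp
  finally show "(\<Sum>(a, w)\<leftarrow>free_alg_comb f. a * C.fock (Const e # w)) = 0" .
qed

lemma free_lim: "free_amalg Q.quot d (emb \<circ> p) (set_indices d) (\<lambda>i. lim ` mats_in_set i)"
  unfolding free_amalg_def
proof (intro exI[of _ "\<lambda>i. letters_span (set_letters i)"] conjI ballI)
  fix i assume "i \<in> set_indices d"
  show "lim ` mats_in_set i \<subseteq> letters_span (set_letters i)"
    by (cases i) (auto simp: lim_def intro!: word_in_letters_span)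
next
  show "free_amalg_algebras Q.quot d (emb \<circ> p) (set_indices d) (\<lambda>i. letters_span (set_letters i))"
    unfolding free_amalg_algebras_def
  proof (intro conjI ballI allI impI)
    fix i assume "i \<in> set_indices d"
    show "star_subalgebra Q.quot (letters_span (set_letters i))"
      by (rule star_subalgebra_letters_span[OF set_letters_star])
    show "diag_algebra Q.quot d (emb \<circ> p) \<subseteq> letters_span (set_letters i)"
      by (cases i) (auto simp: diag_algebra_def diag_elem_quot intro!: word_in_letters_span)
  next
    fix w :: "(set_index \<times> (('a + mat_index \<times> bool) list \<Rightarrow> complex) set) list"
    assume w: "w \<noteq> [] \<and> distinct_adj (map fst w) \<and> (\<forall>(i, x)\<in>set w. i \<in> set_indices d \<and>
      x \<in> letters_span (set_letters i) \<and> cond_exp_diag Q.quot d (emb \<circ> p) x = \<zero>\<^bsub>Q.quot\<^esub>)"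
    have "\<forall>q\<in>set w. \<exists>f. snd q = Q.cls f \<and> (\<forall>v\<in>keys f. set (unFW v) \<subseteq> set_letters (fst q))"
      using w by (fastforce simp: letters_span_def)
    then obtain F where F: "\<And>q. q \<in> set w \<Longrightarrow> snd q = Q.cls (F q)"
      "\<And>q. q \<in> set w \<Longrightarrow> \<forall>v\<in>keys (F q). set (unFW v) \<subseteq> set_letters (fst q)"
      by metis
    define Xs where "Xs = map (\<lambda>q. (set_type (fst q), free_alg_comb (F q))) w"
    have cls: "map snd w = map Q.cls (map F w)" using F(1) by simp
    \<comment> \<open>Distinct index sets have distinct types, so alternation of the factors carries
      over to the types in \<open>fock_free\<close>.\<close>
    have inj: "inj_on set_type UNIV"
      by (rule inj_onI) (metis set_type.simps set_index.exhaust option.inject option.distinct(1) prod.inject)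
    have "distinct_adj (map fst Xs)"
    proof -
      have "map fst Xs = map set_type (map fst w)" by (simp add: Xs_def)
      then show ?thesis using w inj distinct_adj_mapI[of "map fst w" set_type] by (metis inj_on_subset subset_UNIV)
    qed
    moreover have "D.type_comb t X \<and> D.centered X" if tX: "(t, X) \<in> set Xs" for t X
    proof -
      from tX have "\<exists>q\<in>set w. t = set_type (fst q) \<and> X = free_alg_comb (F q)"
        by (force simp: Xs_def)
      then obtain q where q: "q \<in> set w" "t = set_type (fst q)" "X = free_alg_comb (F q)"
        by blast
      then have "fst q \<in> set_indices d" "cond_exp_diag Q.quot d (emb \<circ> p) (Q.cls (F q)) = \<zero>\<^bsub>Q.quot\<^esub>"
        using w F(1) by auto
      then show ?thesis using type_comb_letters F(2)[OF q(1)] centered_free_alg_comb by (simp add: q)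
    qed
    moreover have "Xs \<noteq> []" using w by (simp add: Xs_def)
    ultimately have free: "D.comb_op (foldl D.comb_mult [(1, [Const e])] (map snd Xs)) C.vac (\<one>\<^bsub>C\<^esub>, []) = 0"
      if "e \<in> diag_algebra C d (\<iota> \<circ> p)" for e
      using D.fock_free[of Xs e] that by blast
    have "state Q.quot (emb (p k) \<otimes>\<^bsub>Q.quot\<^esub> Q.cls (foldr (*) (map F w) 1)) = 0" if k: "k < d" for k
    proof -
      let ?g = "foldr (*) (map F w) 1"
      \<comment> \<open>The test element is the projection \<open>corner k\<close>; by the one-sided
        criterion this decides the k-th coordinate of the conditional expectation.\<close>
      have "D.comb_op (free_alg_comb ?g) (D.comb_op [(1, [Const (corner k)])] C.vac) (\<one>\<^bsub>C\<^esub>, []) = 0"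
        using free[OF corner_in_D[OF k]] comb_op_foldl[of "[(1, [Const (corner k)])]" "map F w"]
        by (simp add: Xs_def comp_def)
      moreover have "D.comb_op [(1, [Const (corner k)])] C.vac = D.comb_op (free_alg_comb (word [Inl (p k)])) C.vac"
      proof (rule ext)
        fix S
        show "D.comb_op [(1, [Const (corner k)])] C.vac S = D.comb_op (free_alg_comb (word [Inl (p k)])) C.vac S"
          unfolding comb_op_free_alg_comb using k
          by (simp add: D.comb_op_def fock_word_simps cst_def corner_def A.proj_closed)
      qed
      ultimately have "D.comb_op (free_alg_comb (word [Inl (p k)] * ?g)) C.vac (\<one>\<^bsub>C\<^esub>, []) = 0"
        by (simp add: comb_op_times)
      then have "Q.T (word [Inl (p k)] * ?g) = 0"
        unfolding comb_op_free_alg_comb by (simp only: C.fock_def)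
      then show ?thesis by (simp add: emb_def Q.quot_mult Q.quot_state)
    qed
    then show "cond_exp_diag Q.quot d (emb \<circ> p) (foldr (\<otimes>\<^bsub>Q.quot\<^esub>) (map snd w) \<one>\<^bsub>Q.quot\<^esub>) = \<zero>\<^bsub>Q.quot\<^esub>"
      unfolding cls foldr_cls by (subst E.cond_exp_diag_eq_zero_iff) (auto simp: Q.quot_carrier)
  qed
qed

end

section \<open>Joint convergence of the random matrices\<close>

lemma gaussian_words_entries:
  assumes "prob_space M" "gaussian_entries M d n a" "0 < n"
  shows "gaussian_words M n (gaussian_entry a n) {(s, k, l). k < d \<and> l < d} (conj_derivative a d n)"
  by (rule gaussian_words.intro[OF gaussian_matrices_entries[OF assms]])

lemma (in gaussian_words) word_matrix_map_Const:
  assumes "\<And>j. B j n \<in> carrier_mat n n" "K = (\<lambda>k i j. const_mat d q B n (f k) $$ (i, j))"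
  shows "word_matrix (map Const ks) \<omega> = foldr (\<lambda>k X. const_mat d q B n (f k) * X) ks (1\<^sub>m n)"
proof (induction ks)
  case Nil
  then show ?case by (simp add: word_matrix_Nil)
next
  case (Cons k ks)
  have "word_matrix [Const k] \<omega> = const_mat d q B n (f k)"
    using mat_eta[OF const_mat_carrier[where B = B and d = d and q = q and k = "f k", OF assms(1)]]
    by (simp only: word_matrix_Const) (simp add: assms(2))
  then show ?case using Cons word_matrix_append[of "[Const k]" "map Const ks" \<omega>] by simp
qed

theorem corollary4p3:
  fixes A :: "'a star_prob_space" and p :: "nat \<Rightarrow> 'a" and d :: nat
    and q :: "nat \<Rightarrow> nat \<Rightarrow> nat"
    and M :: "'w measure"
    and a :: "nat \<Rightarrow> nat \<Rightarrow> nat \<Rightarrow> nat \<Rightarrow> nat \<Rightarrow> nat \<Rightarrow> 'w \<Rightarrow> complex"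
    and B :: "nat \<Rightarrow> nat \<Rightarrow> complex mat"
    and A\<^sub>B :: "'c star_prob_space" and \<iota>\<^sub>B :: "'a \<Rightarrow> 'c" and b :: "nat \<Rightarrow> 'c"
  assumes space: "diag_prob_space A d p"
    and q_pos: "\<And>k n. d \<le> n \<Longrightarrow> k < d \<Longrightarrow> 0 < q k n"
    and q_sum: "\<And>n. d \<le> n \<Longrightarrow> (\<Sum>k<d. q k n) = n"
    and q_lim: "\<And>k. k < d \<Longrightarrow> (\<lambda>n. of_nat (q k n) / of_nat n) \<longlonglongrightarrow> state A (p k)"
    and M: "prob_space M"
    and gaussian: "\<And>n. d \<le> n \<Longrightarrow> gaussian_entries M d n a"
    and B_carrier: "\<And>j n. d \<le> n \<Longrightarrow> B j n \<in> carrier_mat n n"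
    and B_mult: "\<And>i j n. d \<le> n \<Longrightarrow> B i n * B j n \<in> range (\<lambda>m. B m n)"
    and B_adjoint: "\<And>j n. d \<le> n \<Longrightarrow> mat_adjoint (B j n) \<in> range (\<lambda>m. B m n)"
    and B_proj: "\<And>k n. d \<le> n \<Longrightarrow> k < d \<Longrightarrow> proj_mat d q n k \<in> range (\<lambda>m. B m n)"
    and B_bounded:
      "\<And>j. Bseq (\<lambda>n. mat_op_norm (diag_blocks d q n (mat_cond_exp M d q n (\<lambda>_. B j n))))"
    and B_enlargement: "enlargement A A\<^sub>B \<iota>\<^sub>B"
    and B_converges:
      "converges_in_diag_distribution M d q UNIV (\<lambda>j n _. B j n) A\<^sub>B (\<iota>\<^sub>B \<circ> p) b"
  shows "asymptotically_free_amalg M d q A p (set_indices d) mats_in_set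
           (mat_family B (block_gaussian_mat d q a))"
proof -
  let ?C = "A\<^sub>B" and ?\<iota> = "\<iota>\<^sub>B"
  interpret A: diag_prob_space A d p by (rule space)
  have b: "b j \<in> carrier ?C" for j
    using B_converges by (auto simp: converges_in_diag_distribution_def)
  interpret X: circular_extension A d p ?C ?\<iota> b
    by unfold_locales (rule B_enlargement, rule b)
  let ?G = "{(s :: nat, k, l). k < d \<and> l < d}"
  let ?K = "\<lambda>n k i j. const_mat d q B n k $$ (i, j)"
  let ?\<kappa> = "const_limit ?C d (?\<iota> \<circ> p) b"
  \<comment> \<open>Here \<open>d \<le> n\<close> together with \<open>A.d_pos\<close> provides the
    positivity of n.\<close>
  have gw: "gaussian_words M n (gaussian_entry a n) ?G (conj_derivative a d n)" if n: "d \<le> n" for n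
    using gaussian_words_entries[OF M gaussian[OF n]] n A.d_pos by simp
  have \<kappa>: "?\<kappa> k \<in> carrier ?C" for k
    by (cases k) (simp_all add: b X.C.involution_closed X.C.diag_elem_closed)
  have q_lim': "(\<lambda>n. of_nat (q k n) / of_nat n) \<longlonglongrightarrow> state ?C ((?\<iota> \<circ> p) k)" if "k < d" for k
    using q_lim[OF that] X.\<iota>_state[OF A.proj_closed[OF that]] by simp
  have const: "(\<lambda>n. gaussian_words.tr n (gaussian_entry a n) (?K n) (map Const ks) \<omega>) \<longlonglongrightarrow>
      state ?C (foldr (\<otimes>\<^bsub>?C\<^esub>) (map ?\<kappa> ks) \<one>\<^bsub>?C\<^esub>)" for ks \<omega>
  proof -
    have "eventually (\<lambda>n. mat_trace (foldr (\<lambda>k X. const_mat d q B n k * X) ks (1\<^sub>m n)) / of_nat n =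
        gaussian_words.tr n (gaussian_entry a n) (?K n) (map Const ks) \<omega>) sequentially"
    proof (rule eventually_sequentiallyI[of d])
      fix n assume n: "d \<le> n"
      interpret gaussian_words M n "gaussian_entry a n" ?G "conj_derivative a d n" "?K n" by (rule gw[OF n])
      have "foldr (\<lambda>k X. const_mat d q B n k * X) ks (1\<^sub>m n) = word_matrix (map Const ks) \<omega>"
        using word_matrix_map_Const[where B = B and d = d and q = q and f = "\<lambda>k. k" and ks = ks and \<omega> = \<omega>]
          B_carrier[OF n] by simp
      then show "mat_trace (foldr (\<lambda>k X. const_mat d q B n k * X) ks (1\<^sub>m n)) / of_nat n = tr (map Const ks) \<omega>"
        using n_pos by (simp add: mat_trace_word_matrix)
    qed
    then show ?thesis
      using const_trace_limit[where C = ?C and P = "?\<iota> \<circ> p" and d = d and q = q and B = B and b = b and ks = ks,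
        OF M X.C.diag_prob_space_axioms q_sum q_pos q_lim' B_carrier B_converges]
      by (rule Lim_transform_eventually[rotated])
  qed
  have indices: "(\<Union>i\<in>set_indices d. mats_in_set i) = {X_index s k l | s k l. k < d \<and> l < d} \<union> range B_index"
  proof (rule equalityI)
    show "{X_index s k l | s k l. k < d \<and> l < d} \<union> range B_index \<subseteq> (\<Union>i\<in>set_indices d. mats_in_set i)"
    proof (intro Un_least subsetI)
      fix x assume "x \<in> {X_index s k l | s k l. k < d \<and> l < d}"
      then obtain s k l where "x = X_index s k l" "k < d" "l < d" by blast
      then show "x \<in> (\<Union>i\<in>set_indices d. mats_in_set i)"
        by (intro UN_I[of "X_set s k l"]) (auto simp: set_indices_def)
    next
      fix x assume "x \<in> range B_index"
      then show "x \<in> (\<Union>i\<in>set_indices d. mats_in_set i)"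
        by (intro UN_I[of B_set]) (auto simp: set_indices_def)
    qed
  qed (auto simp: set_indices_def)
  have conv: "(\<lambda>n. mat_cond_exp M d q n
        (\<lambda>\<omega>. word_mat d q n (\<lambda>i. mat_family B (block_gaussian_mat d q a) i n \<omega>) w) k)
      \<longlonglongrightarrow> cond_exp_coord X.Q.quot (X.emb \<circ> p) (word_alg X.Q.quot d (X.emb \<circ> p) X.lim w) k"
    if w: "fst ` set w \<subseteq> {X_index s k l | s k l. k < d \<and> l < d} \<union> range B_index" and k: "k < d" for w k
  proof -
    \<comment> \<open>The letter of the projection \<open>p k\<close>. Framing the word by it makes
      the trace of \<open>u\<close> the trace of the compression to the k-th block.\<close>
    define e where "e = CD (\<lambda>i. if i = k then 1 else 0)"
    define u where "u = [Const e] @ concat (map index_word w) @ [Const e]"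
    have gens: "list_all (gens_in ?G) u"
    proof -
      have "list_all (gens_in ?G) (concat (map index_word w))"
        using w
      proof (induction w)
        case (Cons t w)
        obtain i st c where "t = (i, st, c)" by (metis surj_pair)
        then show ?case using Cons by (cases i) auto
      qed simp
      then show ?thesis by (simp add: u_def)
    qed
    have \<kappa>e: "?\<kappa> e = X.cst (p k)"
      using X.C.diag_elem_proj[OF k] A.proj_closed[OF k] by (simp add: e_def X.cst_def)
    have word: "map (map_letter ?\<kappa> id) u =
        X.fock_word (Inl (p k) # concat (map X.diag_letters w) @ [Inl (p k)])"
      using X.map_index_word[OF w] by (simp only: u_def map_append list.map letter.map \<kappa>e X.fock_word_simps
          X.letter_word.simps append_Cons append_Nil append_Nil2)
    have "(\<lambda>n. \<integral>\<omega>. gaussian_words.trs n (gaussian_entry a n) (?K n) [u] \<omega> \<partial>M) \<longlonglongrightarrow>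
        (\<Prod>w\<leftarrow>[u]. X.C.fock (map (map_letter ?\<kappa> id) w))"
      using gens
      by (intro gaussian_words_limit[where der = "\<lambda>n. conj_derivative a d n" and G = ?G, OF
          X.C.tracial_star_prob_space_axioms eventually_sequentiallyI[of d, OF gw] \<kappa> const]) simp_all
    \<comment> \<open>The factor n / q(k,n) passes from the normalized trace to the average over the
      block; its limit supplies the denominator \<open>state A (p k)\<close> of the
      coordinate.\<close>
    then have lim: "(\<lambda>n. of_nat n / of_nat (q k n) *
        (\<integral>\<omega>. gaussian_words.trs n (gaussian_entry a n) (?K n) [u] \<omega> \<partial>M)) \<longlonglongrightarrow>
        1 / state A (p k) * X.C.fock (map (map_letter ?\<kappa> id) u)"
      using tendsto_block_ratio[OF q_lim[OF k] A.proj_state[OF k]] by (intro tendsto_mult) simp_all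
    have coord: "1 / state A (p k) * X.C.fock (map (map_letter ?\<kappa> id) u) =
        cond_exp_coord X.Q.quot (X.emb \<circ> p) (word_alg X.Q.quot d (X.emb \<circ> p) X.lim w) k"
      unfolding word X.word_alg_quot X.cond_exp_coord_quot[OF k] by simp
    have "eventually (\<lambda>n. of_nat n / of_nat (q k n) *
        (\<integral>\<omega>. gaussian_words.trs n (gaussian_entry a n) (?K n) [u] \<omega> \<partial>M) = mat_cond_exp M d q n
        (\<lambda>\<omega>. word_mat d q n (\<lambda>i. mat_family B (block_gaussian_mat d q a) i n \<omega>) w) k) sequentially"
    proof (rule eventually_sequentiallyI[of d])
      fix n assume n: "d \<le> n"
      interpret gaussian_words M n "gaussian_entry a n" ?G "conj_derivative a d n" "?K n" by (rule gw[OF n])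
      have proj: "word_matrix [Const e] \<omega> = proj_mat d q n k" for \<omega>
        using mat_eta[OF diag_blocks_carrier] by (simp add: word_matrix_Const e_def proj_mat_def)
      have "mat_trace (proj_mat d q n k * word_mat d q n (\<lambda>i. mat_family B (block_gaussian_mat d q a) i n \<omega>) w *
          proj_mat d q n k) = of_nat n * tr u \<omega>" for \<omega>
      proof -
        have "word_matrix u \<omega> = proj_mat d q n k *
            (word_mat d q n (\<lambda>i. mat_family B (block_gaussian_mat d q a) i n \<omega>) w * proj_mat d q n k)"
          unfolding u_def word_matrix_append proj
          using word_matrix_index_word[where B = B and d = d and q = q and w = w and \<omega> = \<omega>, OF gw[OF n] B_carrier[OF n]]
          by simp
        also have "\<dots> = proj_mat d q n k * word_mat d q n (\<lambda>i. mat_family B (block_gaussian_mat d q a) i n \<omega>) w *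
            proj_mat d q n k"
        proof -
          have P: "proj_mat d q n k \<in> carrier_mat n n" by (simp add: proj_mat_def diag_blocks_carrier)
          have "word_mat d q n (\<lambda>i. mat_family B (block_gaussian_mat d q a) i n \<omega>) w \<in> carrier_mat n n"
            using word_matrix_index_word[where B = B and d = d and q = q and w = w and \<omega> = \<omega>, OF gw[OF n] B_carrier[OF n]]
              word_matrix_carrier[of "concat (map index_word w)" \<omega>] by simp
          from assoc_mult_mat[OF P this P] show ?thesis by simp
        qed
        finally show ?thesis using mat_trace_word_matrix[of u \<omega>] by simp
      qed
      then show "of_nat n / of_nat (q k n) * (\<integral>\<omega>. trs [u] \<omega> \<partial>M) = mat_cond_exp M d q n
        (\<lambda>\<omega>. word_mat d q n (\<lambda>i. mat_family B (block_gaussian_mat d q a) i n \<omega>) w) k"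
        by (simp add: mat_cond_exp_def trs_simps)
    qed
    from Lim_transform_eventually[OF lim this] show ?thesis unfolding coord .
  qed
  have "converges_in_diag_distribution M d q (\<Union>i\<in>set_indices d. mats_in_set i)
      (mat_family B (block_gaussian_mat d q a)) X.Q.quot (X.emb \<circ> p) X.lim"
    unfolding converges_in_diag_distribution_def indices
  proof (intro conjI allI impI)
    show "X.lim \<in> {X_index s k l | s k l. k < d \<and> l < d} \<union> range B_index \<rightarrow> carrier X.Q.quot"
      by (rule Pi_I) (simp add: X.lim_def X.Q.quot_carrier)
  qed (elim conjE, rule conv)
  then show ?thesis
    unfolding asymptotically_free_amalg_def
    by (intro exI[of _ X.Q.quot] exI[of _ X.emb] exI[of _ X.lim] conjI X.enlargement_emb X.free_lim)
qed

end
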